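(* Let $M$ and $N$ be $C^{\infty}$ manifolds (possibly with boundary), and let $k\in\mathbb{N}\cup\{0\}$. Then the set $\mathrm{Diff}^{k,1}(M,N)$ is open in the strong subspace topology of $C^{k,1}_{\partial}(M,N)$.
   Context: Let $m=\dim M$, $n=\dim N$. Charts of $M$ are smooth maps $\varphi:U\to M$ with $U$ open in $\mathbb{H}^m:=\{x\in\mathbb{R}^m:x_1\ge0\}$, and similarly for $N$. $C^{k,1}(M,N)$ is the set of $C^k$ maps $M\to N$ whose $k$-th order derivative is locally Lipschitz with respect to any pair of charts. $C^{k,1}_\partial(M,N)\subset C^{k,1}(M,N)$ is the subset of maps sending $\partial M$ into $\partial N$, with the subspace topology of the strong topology. $\mathrm{Diff}^{k,1}(M,N)$ is the set of $f\in C^{k,1}(M,N)$ that are invertible with inverse in $C^{k,1}(N,M)$. Strong topology on $C^{k,1}(M,N)$: for compact $K\subset\mathbb{H}^m$ let $\|f\|^{k,1}_K$ be the supremum of $|D^jf(x)|_{j,\mathrm{op}}$ ($x\in K$, $0\le j\le k$) and of $|D^kf(y)-D^kf(x)|_{k,\mathrm{op}}/|x-y|$ ($x\neq y\in K$), with multilinear operator norms. Given $f\in C^{k,1}(M,N)$, charts $\varphi:U\to M$, $\psi:V\to N$, compact $K\subset U$ with $f\circ\varphi(K)\subset\psi(V)$ and $\epsilon\in(0,\infty]$, the elementary neighbourhood $\mathcal{N}^{k,1}(f;K,(U,\varphi),(V,\psi),\epsilon)$ is the set of $h\in C^{k,1}(M,N)$ (with $h\circ\varphi(K)\subset\psi(V)$)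 such that $\|\psi^{-1}\circ h\circ\varphi-\psi^{-1}\circ f\circ\varphi\|^{k,1}_K<\epsilon$. The strong topology has as basis all sets $\bigcap_{i\in I}\mathcal{N}^{k,1}(f;K_i,(U_i,\varphi_i),(V_i,\psi_i),\epsilon_i)$ with $f\in C^{k,1}(M,N)$ and the family $\{K_i\}_{i\in I}$ (i.e. the images $\varphi_i(K_i)$ in $M$) locally finite. *)

theory Defs
  imports "HOL-Analysis.Analysis"
begin

section \<open>The model half-space\<close>

type_synonym 'm eucl_space = "(real, 'm) vec"

text \<open>
  Every type \<^typ>\<open>real ^ 'm\<close> has positive dimension. To include manifolds of dimension 0
  as well, the dimension is carried as a number \<open>m\<close>, which a manifold modelled on
  \<^typ>\<open>real ^ 'm\<close> requires to be \<^term>\<open>CARD('m)\<close> or 0 (see \<open>smooth_manifold\<close>). In the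
  latter case the model space is the one-point space, realised as the set containing just the
  origin; it has no boundary. The order on the index type only serves to single out the first
  coordinate.
\<close>

definition half_space :: "nat \<Rightarrow> ('m::{finite,linorder}) eucl_space set" where
  "half_space m = (if m = 0 then {0} else {x. 0 \<le> x $ Min UNIV})"

definition half_space_boundary :: "nat \<Rightarrow> ('m::{finite,linorder}) eucl_space set" where
  "half_space_boundary m = (if m = 0 then {} else {x. x $ Min UNIV = 0})"


section \<open>Higher derivatives relative to the half-space\<close>

text \<open>
  \<open>iter_deriv m j g x [v\<^sub>1, \<dots>, v\<^sub>j]\<close> is the value of the multilinear map \<open>D\<^sup>j g(x)\<close> at
  \<open>(v\<^sub>1, \<dots>, v\<^sub>j)\<close>. Derivatives are taken within the half-space (one-sided at its boundary), so
  they depend only on the germ of \<open>g\<close> at \<open>x\<close> in the half-space, and are unique on vectors in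
  the span of the half-space; this is the whole space except in dimension 0.
\<close>

primrec iter_deriv ::
    "nat \<Rightarrow> nat \<Rightarrow> (('m::{finite,linorder}) eucl_space \<Rightarrow> ('n::finite) eucl_space) \<Rightarrow> ('m::{finite,linorder}) eucl_space
      \<Rightarrow> ('m::{finite,linorder}) eucl_space list \<Rightarrow> ('n::finite) eucl_space" where
  "iter_deriv m 0 g x vs = g x"
| "iter_deriv m (Suc j) g x vs =
     frechet_derivative (\<lambda>y. iter_deriv m j g y (tl vs)) (at x within half_space m) (hd vs)"

definition vector_tuples :: "nat \<Rightarrow> nat \<Rightarrow> ('m::{finite,linorder}) eucl_space list set" where
  "vector_tuples m j = {vs \<in> lists (span (half_space m)). length vs = j}"

text \<open>
  Since the spaces are finite-dimensional, differentiability and continuity of the multilinear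
  maps \<open>D\<^sup>j g\<close> may be tested on each tuple of vectors separately.
\<close>

definition Ck_on ::
    "nat \<Rightarrow> nat \<Rightarrow> (('m::{finite,linorder}) eucl_space \<Rightarrow> ('n::finite) eucl_space) \<Rightarrow> 'm eucl_space set \<Rightarrow> bool" where
  "Ck_on m k g S \<longleftrightarrow>
     (\<forall>j<k. \<forall>vs\<in>vector_tuples m j. \<forall>x\<in>S.
        (\<lambda>y. iter_deriv m j g y vs) differentiable (at x within half_space m)) \<and>
     (\<forall>j\<le>k. \<forall>vs\<in>vector_tuples m j. continuous_on S (\<lambda>x. iter_deriv m j g x vs))"

definition multi_onorm ::
    "nat \<Rightarrow> nat \<Rightarrow> (('m::{finite,linorder}) eucl_space list \<Rightarrow> ('n::finite) eucl_space) \<Rightarrow> ennreal" where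
  "multi_onorm m j A =
     (SUP vs \<in> {vs \<in> vector_tuples m j. \<forall>v\<in>set vs. norm v \<le> 1}. ennreal (norm (A vs)))"

definition deriv_locally_Lipschitz_on ::
    "nat \<Rightarrow> nat \<Rightarrow> (('m::{finite,linorder}) eucl_space \<Rightarrow> ('n::finite) eucl_space) \<Rightarrow> 'm eucl_space set \<Rightarrow> bool" where
  "deriv_locally_Lipschitz_on m k g S \<longleftrightarrow>
     (\<forall>x\<in>S. \<exists>W L. open W \<and> x \<in> W \<and> 0 \<le> L \<and>
        (\<forall>y\<in>W \<inter> S. \<forall>z\<in>W \<inter> S.
           multi_onorm m k (\<lambda>vs. iter_deriv m k g y vs - iter_deriv m k g z vs)
             \<le> ennreal (L * dist y z)))"

definition Ck1_norm ::
    "nat \<Rightarrow> nat \<Rightarrow> ('m::{finite,linorder}) eucl_space set \<Rightarrow> ('m eucl_space \<Rightarrow> ('n::finite) eucl_space) \<Rightarrow> ennreal" where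
  "Ck1_norm m k K g =
     max (SUP j\<in>{..k}. SUP x\<in>K. multi_onorm m j (iter_deriv m j g x))
         (SUP x\<in>K. SUP y\<in>K - {x}.
            multi_onorm m k (\<lambda>vs. iter_deriv m k g y vs - iter_deriv m k g x vs)
              / ennreal (norm (x - y)))"


section \<open>Smooth manifolds with boundary\<close>

type_synonym ('a, 'm) chart = "'m eucl_space set \<times> ('m eucl_space \<Rightarrow> 'a)"

record ('a, 'm::finite) manifold =
  points :: "'a topology"
  dimension :: nat
  atlas :: "('a, 'm) chart set"

definition topological_chart :: "('a, 'm::{finite,linorder}) manifold \<Rightarrow> ('a, 'm) chart \<Rightarrow> bool" where
  "topological_chart M = (\<lambda>(U, \<phi>).
     openin (top_of_set (half_space (dimension M))) U \<and>
     openin (points M) (\<phi> ` U) \<and>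
     homeomorphic_map (top_of_set U) (subtopology (points M) (\<phi> ` U)) \<phi>)"

definition smooth_transition ::
    "('a, 'm::{finite,linorder}) manifold \<Rightarrow> ('a, 'm) chart \<Rightarrow> ('a, 'm) chart \<Rightarrow> bool" where
  "smooth_transition M = (\<lambda>(U, \<phi>) (V, \<psi>).
     \<forall>k. Ck_on (dimension M) k (\<lambda>x. inv_into V \<psi> (\<phi> x)) {x \<in> U. \<phi> x \<in> \<psi> ` V})"

definition smooth_manifold :: "('a, 'm::{finite,linorder}) manifold \<Rightarrow> bool" where
  "smooth_manifold M \<longleftrightarrow>
     (dimension M = 0 \<or> dimension M = CARD('m)) \<and>
     Hausdorff_space (points M) \<and>
     (\<exists>\<B>. countable \<B> \<and> openin (points M) = arbitrary union_of (\<lambda>B. B \<in> \<B>)) \<and>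
     (\<forall>c\<in>atlas M. topological_chart M c) \<and>
     (\<Union>(U, \<phi>)\<in>atlas M. \<phi> ` U) = topspace (points M) \<and>
     (\<forall>c\<in>atlas M. \<forall>d\<in>atlas M. smooth_transition M c d)"

text \<open>All charts of the smooth structure, i.e. the maximal atlas containing the given one.\<close>

definition charts :: "('a, 'm::{finite,linorder}) manifold \<Rightarrow> ('a, 'm) chart set" where
  "charts M = {c. topological_chart M c \<and>
                  (\<forall>d\<in>atlas M. smooth_transition M c d \<and> smooth_transition M d c)}"

definition manifold_boundary :: "('a, 'm::{finite,linorder}) manifold \<Rightarrow> 'a set" where
  "manifold_boundary M =
     (\<Union>(U, \<phi>)\<in>charts M. \<phi> ` (U \<inter> half_space_boundary (dimension M)))"


section \<open>Spaces of maps\<close>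

text \<open>Maps between manifolds are extensional functions (undefined outside the domain).\<close>

definition Ck1_maps ::
    "nat \<Rightarrow> ('a, 'm::{finite,linorder}) manifold \<Rightarrow> ('b, 'n::{finite,linorder}) manifold
      \<Rightarrow> ('a \<Rightarrow> 'b) set" where
  "Ck1_maps k M N =
     {f \<in> topspace (points M) \<rightarrow>\<^sub>E topspace (points N).
        continuous_map (points M) (points N) f \<and>
        (\<forall>(U, \<phi>)\<in>charts M. \<forall>(V, \<psi>)\<in>charts N.
           let g = (\<lambda>x. inv_into V \<psi> (f (\<phi> x)));
               S = {x \<in> U. f (\<phi> x) \<in> \<psi> ` V}
           in Ck_on (dimension M) k g S \<and> deriv_locally_Lipschitz_on (dimension M) k g S)}"

definition Ck1_boundary_maps ::
    "nat \<Rightarrow> ('a, 'm::{finite,linorder}) manifold \<Rightarrow> ('b, 'n::{finite,linorder}) manifold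
      \<Rightarrow> ('a \<Rightarrow> 'b) set" where
  "Ck1_boundary_maps k M N =
     {f \<in> Ck1_maps k M N. f ` manifold_boundary M \<subseteq> manifold_boundary N}"

definition Ck1_diffeos ::
    "nat \<Rightarrow> ('a, 'm::{finite,linorder}) manifold \<Rightarrow> ('b, 'n::{finite,linorder}) manifold
      \<Rightarrow> ('a \<Rightarrow> 'b) set" where
  "Ck1_diffeos k M N =
     {f \<in> Ck1_maps k M N. \<exists>g\<in>Ck1_maps k N M.
        (\<forall>x\<in>topspace (points M). g (f x) = x) \<and> (\<forall>y\<in>topspace (points N). f (g y) = y)}"


section \<open>The strong topology\<close>

definition elementary_nbhd ::
    "nat \<Rightarrow> ('a, 'm::{finite,linorder}) manifold \<Rightarrow> ('b, 'n::{finite,linorder}) manifold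
      \<Rightarrow> ('a \<Rightarrow> 'b) \<Rightarrow> 'm eucl_space set \<times> ('a, 'm) chart \<times> ('b, 'n) chart \<times> ennreal
      \<Rightarrow> ('a \<Rightarrow> 'b) set" where
  "elementary_nbhd k M N f = (\<lambda>(K, (U, \<phi>), (V, \<psi>), \<epsilon>).
     {h \<in> Ck1_maps k M N. (h \<circ> \<phi>) ` K \<subseteq> \<psi> ` V \<and>
        Ck1_norm (dimension M) k K
          (\<lambda>x. inv_into V \<psi> (h (\<phi> x)) - inv_into V \<psi> (f (\<phi> x))) < \<epsilon>})"

definition elementary_data ::
    "('a, 'm::{finite,linorder}) manifold \<Rightarrow> ('b, 'n::{finite,linorder}) manifold \<Rightarrow> ('a \<Rightarrow> 'b)
      \<Rightarrow> ('m eucl_space set \<times> ('a, 'm) chart \<times> ('b, 'n) chart \<times> ennreal) set" where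
  "elementary_data M N f =
     {(K, (U, \<phi>), (V, \<psi>), \<epsilon>). (U, \<phi>) \<in> charts M \<and> (V, \<psi>) \<in> charts N \<and>
        compact K \<and> K \<subseteq> U \<and> (f \<circ> \<phi>) ` K \<subseteq> \<psi> ` V \<and> 0 < \<epsilon>}"

text \<open>
  The index set \<open>I\<close> of a family of elementary neighbourhoods is taken to be the set of its
  data \<open>(K\<^sub>i, (U\<^sub>i, \<phi>\<^sub>i), (V\<^sub>i, \<psi>\<^sub>i), \<epsilon>\<^sub>i)\<close>, since repeated members do not
  affect the intersection. Local finiteness is that of the family of the \<open>\<phi>\<^sub>i ` K\<^sub>i\<close> indexed by
  \<open>I\<close>, not merely of the set of these images. The empty family gives the whole space.
\<close>

definition locally_finite_data ::
    "('a, 'm::{finite,linorder}) manifold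
      \<Rightarrow> ('m eucl_space set \<times> ('a, 'm) chart \<times> ('b, 'n::finite) chart \<times> ennreal) set \<Rightarrow> bool" where
  "locally_finite_data M I \<longleftrightarrow>
     (\<forall>p\<in>topspace (points M). \<exists>W. openin (points M) W \<and> p \<in> W \<and>
        finite {i \<in> I. case i of (K, (U, \<phi>), _) \<Rightarrow> \<phi> ` K \<inter> W \<noteq> {}})"

definition strong_basis ::
    "nat \<Rightarrow> ('a, 'm::{finite,linorder}) manifold \<Rightarrow> ('b, 'n::{finite,linorder}) manifold
      \<Rightarrow> ('a \<Rightarrow> 'b) set set" where
  "strong_basis k M N =
     {Ck1_maps k M N \<inter> (\<Inter>i\<in>I. elementary_nbhd k M N f i) | f I.
        f \<in> Ck1_maps k M N \<and> I \<subseteq> elementary_data M N f \<and> locally_finite_data M I}"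

text \<open>
  By the triangle inequality each member of an intersection of two sets in \<open>strong_basis\<close>
  has a set of \<open>strong_basis\<close> around it inside the intersection; so these sets are a basis,
  and the topology they generate consists of their unions.
\<close>

definition strong_topology ::
    "nat \<Rightarrow> ('a, 'm::{finite,linorder}) manifold \<Rightarrow> ('b, 'n::{finite,linorder}) manifold
      \<Rightarrow> ('a \<Rightarrow> 'b) topology" where
  "strong_topology k M N = topology_generated_by (strong_basis k M N)"

end

theory Submission
  imports Defs
begin

text \<open>
  In charts, a map \<open>h\<close> near a diffeomorphism \<open>f\<close> is a perturbation of a bi-Lipschitz homeomorphism between
  open subsets of half-spaces that is small in the \<open>C\<^sup>0\<^sup>,\<^sup>1\<close> norm; this is all that is used of its closeness, for
  every \<open>k\<close>. On compact convex sets such an \<open>h\<close> is bi-Lipschitz, and a contraction argument shows that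
  its image covers the \<open>f\<close>-image of a smaller set; at boundary points this needs that \<open>h\<close> preserves the boundary.
  Along a locally finite cover of \<open>M\<close> by such sets this makes \<open>h\<close> surjective, and it makes \<open>h\<close> injective once
  finitely many compact-open conditions per set force points with the same image into a common set of the cover.
  The inverse is then locally Lipschitz, and differentiating \<open>h\<^sup>-\<^sup>1 \<circ> h = id\<close> repeatedly shows that
  it is as regular as \<open>h\<close>. Diffeomorphisms preserve the boundary by invariance of domain.
\<close>

section \<open>Locally Lipschitz maps\<close>

text \<open>The order of choices matters. Radii, lower slope and a first tolerance of a patch depend
  on \<open>f\<close> and not on the other patches, and stay valid when the tolerance is lowered.
  The locally finite cover comes next. Only then is each tolerance lowered, since the finitely many
  patches to be kept apart from a given one are known only after the cover. For non-compact
  \<open>M\<close> no uniform tolerance need exist; the strong topology permits one per patch.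

  One inequality governs the local step: if the inverse of \<open>f\<close> in charts has Lipschitz
  constant L, a perturbation with Lipschitz constant e, where e * L \<le> 1/2, keeps half of the
  lower slope 1/L and makes the fixed point map a contraction with factor 1/2.

  Regularity of the inverse needs no smallness of derivatives: the Lipschitz bound on the inverse
  makes Dh injective, hence invertible, as the dimensions agree. Dimension 0 is treated apart,
  because derivatives within a one-point space are not unique.\<close>

definition locally_lipschitz_on :: "'a::metric_space set \<Rightarrow> ('a \<Rightarrow> 'b::metric_space) \<Rightarrow> bool" where
  "locally_lipschitz_on S g \<longleftrightarrow> (\<forall>x\<in>S. \<exists>e>0. \<exists>L. L-lipschitz_on (S \<inter> ball x e) g)"

lemma locally_lipschitz_onE:
  assumes "locally_lipschitz_on S g" "x \<in> S"
  obtains e L where "e > 0" "L > 0" "L-lipschitz_on (S \<inter> ball x e) g"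
proof -
  obtain e L where "e > 0" "L-lipschitz_on (S \<inter> ball x e) g"
    using assms unfolding locally_lipschitz_on_def by blast
  then have "(max L 1)-lipschitz_on (S \<inter> ball x e) g"
    by (auto intro: lipschitz_on_mono)
  with \<open>e > 0\<close> show ?thesis by (intro that[of e "max L 1"]) auto
qed

lemma locally_lipschitz_on_imp_continuous_on:
  assumes "locally_lipschitz_on S g"
  shows "continuous_on S g"
  unfolding continuous_on_eq_continuous_within
proof
  fix x assume x: "x \<in> S"
  obtain e L where e: "e > 0" "L-lipschitz_on (S \<inter> ball x e) g"
    using locally_lipschitz_onE[OF assms x] by metis
  then have "continuous (at x within S \<inter> ball x e) g"
    using x by (intro lipschitz_on_continuous_within) auto
  moreover have "at x within S \<inter> ball x e = at x within S"
    by (rule at_within_nhd[of x "ball x e"]) (use e in auto)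
  ultimately show "continuous (at x within S) g" by (simp add: continuous_within)
qed

lemma locally_lipschitz_on_cong:
  assumes "\<And>x. x \<in> S \<Longrightarrow> f x = g x"
  shows "locally_lipschitz_on S f \<longleftrightarrow> locally_lipschitz_on S g"
  unfolding locally_lipschitz_on_def
  by (intro ball_cong refl ex_cong conj_cong) (auto simp: lipschitz_on_def assms)

lemma locally_lipschitz_on_subset:
  assumes "locally_lipschitz_on S f" "T \<subseteq> S"
  shows "locally_lipschitz_on T f"
  using assms unfolding locally_lipschitz_on_def
  by (meson Int_mono lipschitz_on_subset order_refl subsetD)

lemma locally_lipschitz_on_compose:
  assumes f: "locally_lipschitz_on S f" and g: "locally_lipschitz_on T g" and gT: "g ` T \<subseteq> S"
  shows "locally_lipschitz_on T (\<lambda>x. f (g x))"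
  unfolding locally_lipschitz_on_def
proof
  fix x assume x: "x \<in> T"
  obtain e L where e: "e > 0" "L > 0" "L-lipschitz_on (T \<inter> ball x e) g"
    using locally_lipschitz_onE[OF g x] by metis
  obtain e' L' where e': "e' > 0" "L' > 0" "L'-lipschitz_on (S \<inter> ball (g x) e') f"
    using locally_lipschitz_onE[OF f, of "g x"] gT x by blast
  have "continuous_on T g" using g by (rule locally_lipschitz_on_imp_continuous_on)
  then obtain d where d: "d > 0" "\<And>y. y \<in> T \<Longrightarrow> dist y x < d \<Longrightarrow> dist (g y) (g x) < e'"
    using x \<open>e' > 0\<close> unfolding continuous_on_iff by blast
  have "(L' * L)-lipschitz_on (T \<inter> ball x (min d e)) (\<lambda>y. f (g y))"
  proof (rule lipschitz_on_compose2[where f=g and g=f])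
    show "L-lipschitz_on (T \<inter> ball x (min d e)) g" using e(3) by (rule lipschitz_on_subset) auto
    show "L'-lipschitz_on (g ` (T \<inter> ball x (min d e))) f"
      using e'(3) by (rule lipschitz_on_subset) (use d gT in \<open>auto simp: dist_commute\<close>)
  qed
  then show "\<exists>e>0. \<exists>L. L-lipschitz_on (T \<inter> ball x e) (\<lambda>x. f (g x))"
    using d e by (intro exI[of _ "min d e"]) auto
qed

text \<open>A Lipschitz map is bounded on a small ball, so the splitting
  \<open>pr (f y) (g y - g z) + pr (f y - f z) (g z)\<close> bounds differences of products.\<close>

lemma locally_lipschitz_on_prod:
  assumes "bounded_bilinear pr" and f: "locally_lipschitz_on S f" and g: "locally_lipschitz_on S g"
  shows "locally_lipschitz_on S (\<lambda>x. pr (f x) (g x))"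
  unfolding locally_lipschitz_on_def
proof
  interpret bounded_bilinear pr by fact
  fix x assume x: "x \<in> S"
  obtain e L where e: "e > 0" "L > 0" "L-lipschitz_on (S \<inter> ball x e) f"
    using locally_lipschitz_onE[OF f x] by metis
  obtain e' L' where e': "e' > 0" "L' > 0" "L'-lipschitz_on (S \<inter> ball x e') g"
    using locally_lipschitz_onE[OF g x] by metis
  obtain K where K: "K > 0" "\<And>a b. norm (pr a b) \<le> norm a * norm b * K"
    using pos_bounded by blast
  \<comment> \<open>Radius at most 1 turns the Lipschitz estimates at \<open>x\<close> into the
    plain bounds \<open>A\<close> and \<open>B\<close>.\<close>
  define d where "d = min 1 (min e e')"
  have d: "d > 0" "d \<le> 1" "d \<le> e" "d \<le> e'" using e e' by (auto simp: d_def)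
  define A where "A = norm (f x) + L"
  define B where "B = norm (g x) + L'"
  have A: "norm (f y) \<le> A" if "y \<in> S \<inter> ball x d" for y
  proof -
    have "dist (f y) (f x) \<le> L * dist y x" using lipschitz_onD[OF e(3), of y x] that x d e(1) by auto
    also have "\<dots> \<le> L" using that d e by (auto simp: dist_commute)
    finally have "norm (f y - f x) \<le> L" by (simp add: dist_norm)
    then show ?thesis unfolding A_def using norm_triangle_sub[of "f y" "f x"] by linarith
  qed
  have B: "norm (g y) \<le> B" if "y \<in> S \<inter> ball x d" for y
  proof -
    have "dist (g y) (g x) \<le> L' * dist y x" using lipschitz_onD[OF e'(3), of y x] that x d e'(1) by auto
    also have "\<dots> \<le> L'" using that d e' by (auto simp: dist_commute)
    finally have "norm (g y - g x) \<le> L'" by (simp add: dist_norm)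
    then show ?thesis unfolding B_def using norm_triangle_sub[of "g y" "g x"] by linarith
  qed
  have pos: "A \<ge> 0" "B \<ge> 0" using e e' by (auto simp: A_def B_def add_nonneg_nonneg)
  have "((A * L' + L * B) * K)-lipschitz_on (S \<inter> ball x d) (\<lambda>x. pr (f x) (g x))"
  proof (rule lipschitz_onI)
    show "(A * L' + L * B) * K \<ge> 0" using pos e e' K by (simp add: add_nonneg_nonneg)
    fix y z assume yz: "y \<in> S \<inter> ball x d" "z \<in> S \<inter> ball x d"
    have f: "norm (f y - f z) \<le> L * dist y z"
      using lipschitz_onD[OF e(3), of y z] yz d by (auto simp: dist_norm)
    have g: "norm (g y - g z) \<le> L' * dist y z"
      using lipschitz_onD[OF e'(3), of y z] yz d by (auto simp: dist_norm)
    have "pr (f y) (g y) - pr (f z) (g z) = pr (f y) (g y - g z) + pr (f y - f z) (g z)"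
      by (simp add: diff_left diff_right)
    then have "dist (pr (f y) (g y)) (pr (f z) (g z))
        \<le> norm (pr (f y) (g y - g z)) + norm (pr (f y - f z) (g z))"
      by (simp add: dist_norm norm_triangle_ineq)
    also have "\<dots> \<le> norm (f y) * norm (g y - g z) * K + norm (f y - f z) * norm (g z) * K"
      by (intro add_mono K)
    also have "\<dots> \<le> A * (L' * dist y z) * K + (L * dist y z) * B * K"
      using A[OF yz(1)] B[OF yz(2)] f g pos e e' K
      by (intro add_mono mult_right_mono mult_mono) auto
    also have "\<dots> = (A * L' + L * B) * K * dist y z" by (simp add: algebra_simps)
    finally show "dist (pr (f y) (g y)) (pr (f z) (g z)) \<le> (A * L' + L * B) * K * dist y z" .
  qed
  then show "\<exists>e>0. \<exists>L. L-lipschitz_on (S \<inter> ball x e) (\<lambda>x. pr (f x) (g x))"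
    using d by blast
qed

lemma locally_lipschitz_on_const: "locally_lipschitz_on S (\<lambda>x. c)"
  unfolding locally_lipschitz_on_def
  by (intro ballI exI[of _ 1] exI[of _ 0] conjI lipschitz_on_constant) simp

lemma locally_lipschitz_on_linear:
  assumes "bounded_linear L" "locally_lipschitz_on S g"
  shows "locally_lipschitz_on S (\<lambda>x. L (g x))"
proof (rule locally_lipschitz_on_compose[OF _ assms(2)])
  obtain B where B: "0 \<le> B" "\<And>x y. norm (L (x - y)) \<le> B * norm (x - y)"
    by (metis assms(1) bounded_linear.nonneg_bounded mult.commute)
  then have "B-lipschitz_on UNIV L"
    by (intro lipschitz_onI)
      (auto simp: dist_norm linear_diff[OF bounded_linear.linear[OF assms(1)], symmetric])
  then show "locally_lipschitz_on UNIV L"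
    unfolding locally_lipschitz_on_def by (meson Int_lower1 lipschitz_on_subset zero_less_one)
qed auto

lemma locally_lipschitz_on_add:
  fixes f g :: "'a::metric_space \<Rightarrow> 'b::real_normed_vector"
  assumes f: "locally_lipschitz_on S f" and g: "locally_lipschitz_on S g"
  shows "locally_lipschitz_on S (\<lambda>x. f x + g x)"
  unfolding locally_lipschitz_on_def
proof
  fix x assume x: "x \<in> S"
  obtain e L where e: "e > 0" "L > 0" "L-lipschitz_on (S \<inter> ball x e) f"
    using locally_lipschitz_onE[OF f x] by metis
  obtain e' L' where e': "e' > 0" "L' > 0" "L'-lipschitz_on (S \<inter> ball x e') g"
    using locally_lipschitz_onE[OF g x] by metis
  have "(L + L')-lipschitz_on (S \<inter> ball x (min e e')) (\<lambda>x. f x + g x)"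
    by (intro lipschitz_on_add lipschitz_on_subset[OF e(3)] lipschitz_on_subset[OF e'(3)]) auto
  then show "\<exists>e>0. \<exists>L. L-lipschitz_on (S \<inter> ball x e) (\<lambda>x. f x + g x)"
    using e e' by (intro exI[of _ "min e e'"]) auto
qed

section \<open>Calculus on the half-space\<close>

abbreviation HS :: "('m::{finite,linorder}) eucl_space set" where
  "HS \<equiv> half_space CARD('m)"

abbreviation deriv_HS ::
    "(('m::{finite,linorder}) eucl_space \<Rightarrow> 'b::real_normed_vector) \<Rightarrow> 'm eucl_space \<Rightarrow> 'm eucl_space \<Rightarrow> 'b" where
  "deriv_HS g x \<equiv> frechet_derivative g (at x within HS)"

lemma HS_eq: "(HS :: ('m::{finite,linorder}) eucl_space set) = {x. 0 \<le> x $ Min UNIV}"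
  by (simp add: half_space_def)

lemma convex_half_space: "convex (half_space m)"
  unfolding half_space_def
  by (auto simp: convex_def)

lemma closed_half_space: "closed (half_space m)"
  unfolding half_space_def by (auto intro!: closed_Collect_le continuous_intros)

text \<open>A positive step along a basis vector stays in the half-space, from boundary points as
  well. This is the criterion for uniqueness of derivatives within a set.\<close>

lemma HS_basis_step:
  fixes x :: "('m::{finite,linorder}) eucl_space"
  assumes "x \<in> HS" "i \<in> Basis" "e > 0"
  shows "\<exists>d. 0 < \<bar>d\<bar> \<and> \<bar>d\<bar> < e \<and> x + d *\<^sub>R i \<in> HS"
  using assms by (intro exI[of _ "e/2"]) (auto simp: HS_eq Basis_vec_def axis_def)

lemma deriv_HS_eqI:
  assumes "(g has_derivative g') (at x within HS)" "x \<in> HS"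
  shows "deriv_HS g x = g'"
proof -
  have "(g has_derivative deriv_HS g x) (at x within HS)"
    using assms(1) differentiable_def frechet_derivative_works by blast
  from frechet_derivative_unique_within[OF this assms(1) HS_basis_step[OF assms(2)]]
  show ?thesis by blast
qed

lemma deriv_HS_works:
  "g differentiable (at x within HS) \<Longrightarrow> (g has_derivative deriv_HS g x) (at x within HS)"
  using frechet_derivative_works by blast

text \<open>Lets derivatives within the half-space be computed on the relatively open domain of a
  map.\<close>

lemma at_within_openin:
  assumes "openin (top_of_set H) S" "x \<in> S"
  shows "at x within S = at x within H"
proof -
  obtain O' where "open O'" "S = H \<inter> O'" using assms(1) by (auto simp: openin_open)
  with assms(2) show ?thesis by (intro at_within_nhd[of x O']) auto
qed

lemma has_derivative_openin_cong:
  assumes "openin (top_of_set H) S" "x \<in> S" "\<And>y. y \<in> S \<Longrightarrow> f y = g y"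
  shows "(f has_derivative f') (at x within H) \<longleftrightarrow> (g has_derivative f') (at x within H)"
  unfolding at_within_openin[OF assms(1,2), symmetric]
  using has_derivative_transform[of x S g f f'] has_derivative_transform[of x S f g f'] assms(2,3)
  by metis

lemma frechet_derivative_openin_cong:
  assumes "openin (top_of_set H) S" "x \<in> S" "\<And>y. y \<in> S \<Longrightarrow> f y = g y"
  shows "frechet_derivative f (at x within H) = frechet_derivative g (at x within H)"
    and "f differentiable (at x within H) \<longleftrightarrow> g differentiable (at x within H)"
  unfolding frechet_derivative_def differentiable_def
  using has_derivative_openin_cong[OF assms] by auto

lemma deriv_HS_expand:
  assumes "g differentiable (at x within HS)"
  shows "deriv_HS g x v = (\<Sum>i\<in>Basis. (v \<bullet> i) *\<^sub>R deriv_HS g x i)"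
proof -
  have lin: "linear (deriv_HS g x)"
    using assms by (rule linear_frechet_derivative)
  have "deriv_HS g x v = deriv_HS g x (\<Sum>i\<in>Basis. (v \<bullet> i) *\<^sub>R i)"
    by (simp add: euclidean_representation)
  then show ?thesis by (simp add: linear_sum[OF lin] linear_scale[OF lin])
qed

lemma openin_convex_ball:
  fixes H :: "'a::real_normed_vector set"
  assumes "openin (top_of_set H) S" "x \<in> S" "convex H"
  obtains e where "e > 0" "H \<inter> ball x e \<subseteq> S" "S \<inter> ball x e = H \<inter> ball x e" "convex (H \<inter> ball x e)"
proof -
  obtain e where "e > 0" "ball x e \<inter> H \<subseteq> S" using assms(1,2)
    by (auto simp: openin_contains_ball)
  moreover have "S \<subseteq> H" using assms(1) openin_imp_subset by blast
  ultimately show ?thesis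
    by (intro that[of e]) (use assms(3) in \<open>auto intro!: convex_Int convex_ball\<close>)
qed

text \<open>Continuity bounds each of the finitely many partial derivatives near \<open>x\<close>;
  the sum bounds the operator norm, and the mean value inequality applies because a half-space meets
  a ball in a convex set.\<close>

lemma locally_lipschitz_on_C1:
  fixes g :: "('m::{finite,linorder}) eucl_space \<Rightarrow> 'b::real_normed_vector"
  assumes S: "openin (top_of_set HS) S"
    and diff: "\<And>x. x \<in> S \<Longrightarrow> g differentiable (at x within HS)"
    and cont: "\<And>i. i \<in> Basis \<Longrightarrow> continuous_on S (\<lambda>x. deriv_HS g x i)"
  shows "locally_lipschitz_on S g"
  unfolding locally_lipschitz_on_def
proof
  fix x assume x: "x \<in> S"
  have SH: "S \<subseteq> HS" using S openin_imp_subset by blast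
  obtain e where e: "e > 0" "S \<inter> ball x e = HS \<inter> ball x e" "convex (HS \<inter> ball x e)"
    using openin_convex_ball[OF S x convex_half_space] by metis
  have "\<exists>d>0. \<forall>y\<in>S. dist y x < d \<longrightarrow> norm (deriv_HS g y i) \<le> norm (deriv_HS g x i) + 1" if i: "i \<in> Basis" for i
  proof -
    obtain d where d: "d > 0" "\<And>y. y \<in> S \<Longrightarrow> dist y x < d \<Longrightarrow> dist (deriv_HS g y i) (deriv_HS g x i) < 1"
      using cont[OF i] x unfolding continuous_on_iff by (meson zero_less_one)
    have "norm (deriv_HS g y i) \<le> norm (deriv_HS g x i) + 1" if "y \<in> S" "dist y x < d" for y
      using d(2)[OF that] norm_triangle_sub[of "deriv_HS g y i" "deriv_HS g x i"]
      by (simp add: dist_norm)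
    with d(1) show ?thesis by blast
  qed
  then obtain d where d: "\<And>i. i \<in> Basis \<Longrightarrow> d i > 0"
      "\<And>i y. i \<in> Basis \<Longrightarrow> y \<in> S \<Longrightarrow> dist y x < d i \<Longrightarrow> norm (deriv_HS g y i) \<le> norm (deriv_HS g x i) + 1"
    by metis
  \<comment> \<open>Below \<open>e\<close> the domain is a convex piece of the half-space; below
    every \<open>d i\<close> the derivative bounds hold.\<close>
  define r where "r = min e (Min (d ` Basis))"
  have r: "r > 0" "r \<le> e" "\<And>i. i \<in> Basis \<Longrightarrow> r \<le> d i"
  proof -
    have "Min (d ` Basis) > 0" using d(1) by (subst Min_gr_iff) auto
    then show "r > 0" "r \<le> e" using e by (auto simp: r_def)
    show "r \<le> d i" if "i \<in> Basis" for i
      unfolding r_def using Min_le[of "d ` Basis" "d i"] that by (meson finite_Basis finite_imageI imageI min.coboundedI2)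
  qed
  define B where "B = (\<Sum>i\<in>Basis. norm (deriv_HS g x i) + 1)"
  have eq: "S \<inter> ball x r = HS \<inter> ball x r"
  proof -
    have "ball x r \<subseteq> ball x e" using r(2) by (rule subset_ball)
    then show ?thesis using e(2) by blast
  qed
  have "B-lipschitz_on (S \<inter> ball x r) g"
  proof (rule lipschitz_onI)
    show "B \<ge> 0" unfolding B_def by (intro sum_nonneg) auto
    fix y z assume yz: "y \<in> S \<inter> ball x r" "z \<in> S \<inter> ball x r"
    have "norm (g y - g z) \<le> B * norm (y - z)"
    proof (rule differentiable_bound[of "S \<inter> ball x r"])
      show "convex (S \<inter> ball x r)" unfolding eq by (intro convex_Int convex_half_space convex_ball)
      show "(g has_derivative deriv_HS g w) (at w within S \<inter> ball x r)" if "w \<in> S \<inter> ball x r" for w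
        using deriv_HS_works[OF diff, of w] that SH by (auto intro: has_derivative_subset)
      show "onorm (deriv_HS g w) \<le> B" if w: "w \<in> S \<inter> ball x r" for w
      proof (rule onorm_le)
        fix v
        have "norm (deriv_HS g w v) = norm (\<Sum>i\<in>Basis. (v \<bullet> i) *\<^sub>R deriv_HS g w i)"
          by (subst deriv_HS_expand) (use diff w in auto)
        also have "\<dots> \<le> (\<Sum>i\<in>Basis. norm v * (norm (deriv_HS g x i) + 1))"
        proof (rule sum_norm_le)
          fix i :: "'m eucl_space" assume i: "i \<in> Basis"
          have "norm (deriv_HS g w i) \<le> norm (deriv_HS g x i) + 1"
            using d(2)[OF i, of w] w r(3)[OF i] by (auto simp: dist_commute)
          then show "norm ((v \<bullet> i) *\<^sub>R deriv_HS g w i) \<le> norm v * (norm (deriv_HS g x i) + 1)"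
            using Basis_le_norm[OF i, of v] by (auto intro!: mult_mono)
        qed
        finally show "norm (deriv_HS g w v) \<le> B * norm v"
          by (simp add: B_def sum_distrib_left[symmetric] mult.commute)
      qed
    qed (use yz in auto)
    then show "dist (g y) (g z) \<le> B * dist y z" by (simp add: dist_norm)
  qed
  then show "\<exists>e>0. \<exists>L. L-lipschitz_on (S \<inter> ball x e) g" using r by blast
qed

subsection \<open>The class of maps with locally Lipschitz derivatives\<close>

text \<open>In contrast to \<^const>\<open>iter_deriv\<close>, which differentiates the highest derivative once more,
  the recursion goes through the first derivative; this suits the chain rule.\<close>

primrec Ck1_class ::
    "nat \<Rightarrow> ('m::{finite,linorder}) eucl_space set \<Rightarrow> ('m eucl_space \<Rightarrow> 'b::real_normed_vector) \<Rightarrow> bool" where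
  "Ck1_class 0 S g \<longleftrightarrow> locally_lipschitz_on S g"
| "Ck1_class (Suc k) S g \<longleftrightarrow> (\<forall>x\<in>S. g differentiable (at x within HS)) \<and>
     (\<forall>i\<in>Basis. Ck1_class k S (\<lambda>x. deriv_HS g x i))"

lemma Ck1_class_cong:
  assumes S: "openin (top_of_set HS) S" and eq: "\<And>x. x \<in> S \<Longrightarrow> f x = g x"
  shows "Ck1_class k S f \<longleftrightarrow> Ck1_class k S g"
  using eq
proof (induction k arbitrary: f g)
  case 0
  then show ?case using locally_lipschitz_on_cong[of S f g] by simp
next
  case (Suc k)
  have "Ck1_class k S (\<lambda>x. deriv_HS f x i) \<longleftrightarrow> Ck1_class k S (\<lambda>x. deriv_HS g x i)" for i
    by (rule Suc.IH) (simp add: frechet_derivative_openin_cong(1)[OF S _ Suc.prems])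
  moreover have "f differentiable (at x within HS) \<longleftrightarrow> g differentiable (at x within HS)" if "x \<in> S" for x
    using frechet_derivative_openin_cong(2)[OF S that Suc.prems] .
  ultimately show ?case by simp
qed

text \<open>The base case carries the content: locally Lipschitz partial derivatives are continuous,
  so the mean value inequality applies to the map itself.\<close>

lemma Ck1_class_SucD: "openin (top_of_set HS) S \<Longrightarrow> Ck1_class (Suc k) S g \<Longrightarrow> Ck1_class k S g"
proof (induction k arbitrary: g)
  case 0
  have "continuous_on S (\<lambda>x. deriv_HS g x i)" if "i \<in> Basis" for i
    using 0 that by (intro locally_lipschitz_on_imp_continuous_on) simp
  with 0 show ?case by (simp add: locally_lipschitz_on_C1)
next
  case (Suc k)
  have "Ck1_class k S (\<lambda>x. deriv_HS g x i)" if "i \<in> Basis" for i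
    using Suc.prems(2) that by (intro Suc.IH[OF Suc.prems(1)]) (simp only: Ck1_class.simps, blast)
  moreover have "\<forall>x\<in>S. g differentiable (at x within HS)"
    using Suc.prems(2) by simp
  ultimately show ?case by simp
qed

lemma Ck1_class_mono:
  assumes S: "openin (top_of_set HS) S" and "j \<le> k" "Ck1_class k S g"
  shows "Ck1_class j S g"
  using assms(2,3)
proof (induction k rule: dec_induct)
  case (step i)
  from Ck1_class_SucD[OF S step.prems] show ?case by (rule step.IH)
qed

lemma Ck1_class_lipschitz:
  assumes "openin (top_of_set HS) S" "Ck1_class k S g"
  shows "locally_lipschitz_on S g"
  using Ck1_class_mono[OF assms(1) _ assms(2), of 0] by simp

lemma Ck1_class_const:
  assumes S: "openin (top_of_set HS) S"
  shows "Ck1_class k S (\<lambda>x. c)"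
proof (induction k arbitrary: c)
  case 0
  then show ?case by (simp add: locally_lipschitz_on_const)
next
  case (Suc k)
  have "Ck1_class k S (\<lambda>x. deriv_HS (\<lambda>x. c) x i)" for i
  proof (subst Ck1_class_cong[OF S])
    show "deriv_HS (\<lambda>x. c) x i = 0" if "x \<in> S" for x
      using deriv_HS_eqI[of "\<lambda>x. c" "\<lambda>v. 0" x] that openin_imp_subset[OF S] by auto
  qed (rule Suc.IH)
  then show ?case by simp
qed

lemma Ck1_class_add:
  assumes S: "openin (top_of_set HS) S" and "Ck1_class k S f" "Ck1_class k S g"
  shows "Ck1_class k S (\<lambda>x. f x + g x)"
  using assms(2,3)
proof (induction k arbitrary: f g)
  case 0
  then show ?case by (simp add: locally_lipschitz_on_add)
next
  case (Suc k)
  have der: "((\<lambda>x. f x + g x) has_derivative (\<lambda>v. deriv_HS f x v + deriv_HS g x v)) (at x within HS)"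
    if "x \<in> S" for x
    using Suc.prems that by (intro has_derivative_add deriv_HS_works) auto
  have "Ck1_class k S (\<lambda>x. deriv_HS (\<lambda>x. f x + g x) x i)" if "i \<in> Basis" for i
  proof (subst Ck1_class_cong[OF S])
    show "deriv_HS (\<lambda>x. f x + g x) x i = deriv_HS f x i + deriv_HS g x i" if "x \<in> S" for x
      using deriv_HS_eqI[OF der] that openin_imp_subset[OF S] by auto
    show "Ck1_class k S (\<lambda>x. deriv_HS f x i + deriv_HS g x i)"
      using Suc.prems that by (intro Suc.IH) auto
  qed
  moreover have "\<forall>x\<in>S. (\<lambda>x. f x + g x) differentiable (at x within HS)"
    using der differentiable_def by blast
  ultimately show ?case by simp
qed

lemma Ck1_class_sum:
  assumes S: "openin (top_of_set HS) S" and "\<And>i. i \<in> I \<Longrightarrow> Ck1_class k S (f i)"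
  shows "Ck1_class k S (\<lambda>x. \<Sum>i\<in>I. f i x)"
  using assms(2)
  by (induction I rule: infinite_finite_induct)
    (auto intro: Ck1_class_add[OF S] Ck1_class_const[OF S])

text \<open>Leibniz' rule leaves one factor undifferentiated, which is of class \<open>k\<close> by
  \<open>Ck1_class_SucD\<close>. A general bilinear map covers scaling and composition of operators
  alike.\<close>

lemma Ck1_class_prod:
  fixes pr :: "'b::real_normed_vector \<Rightarrow> 'c::real_normed_vector \<Rightarrow> 'd::real_normed_vector"
  assumes S: "openin (top_of_set HS) S" and bil: "bounded_bilinear pr"
    and "Ck1_class k S f" "Ck1_class k S g"
  shows "Ck1_class k S (\<lambda>x. pr (f x) (g x))"
  using assms(3,4)
proof (induction k arbitrary: f g)
  case 0
  then show ?case by (simp add: locally_lipschitz_on_prod[OF bil])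
next
  case (Suc k)
  have der: "((\<lambda>x. pr (f x) (g x)) has_derivative
      (\<lambda>v. pr (f x) (deriv_HS g x v) + pr (deriv_HS f x v) (g x))) (at x within HS)"
    if "x \<in> S" for x
    using Suc.prems that by (intro bounded_bilinear.FDERIV[OF bil] deriv_HS_works) auto
  have "Ck1_class k S (\<lambda>x. deriv_HS (\<lambda>x. pr (f x) (g x)) x i)" if "i \<in> Basis" for i
  proof (subst Ck1_class_cong[OF S])
    show "deriv_HS (\<lambda>x. pr (f x) (g x)) x i
        = pr (f x) (deriv_HS g x i) + pr (deriv_HS f x i) (g x)" if "x \<in> S" for x
      using deriv_HS_eqI[OF der] that openin_imp_subset[OF S] by auto
    show "Ck1_class k S (\<lambda>x. pr (f x) (deriv_HS g x i) + pr (deriv_HS f x i) (g x))"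
      using Suc.prems that Ck1_class_SucD[OF S Suc.prems(1)] Ck1_class_SucD[OF S Suc.prems(2)]
      by (intro Ck1_class_add[OF S] Suc.IH) auto
  qed
  moreover have "\<forall>x\<in>S. (\<lambda>x. pr (f x) (g x)) differentiable (at x within HS)"
    using der differentiable_def by blast
  ultimately show ?case by simp
qed

lemma Ck1_class_linear:
  assumes S: "openin (top_of_set HS) S" and lin: "bounded_linear L" and "Ck1_class k S g"
  shows "Ck1_class k S (\<lambda>x. L (g x))"
  using assms(3)
proof (induction k arbitrary: g)
  case 0
  then show ?case by (simp add: locally_lipschitz_on_linear[OF lin])
next
  case (Suc k)
  have der: "((\<lambda>x. L (g x)) has_derivative (\<lambda>v. L (deriv_HS g x v))) (at x within HS)"
    if "x \<in> S" for x
    using Suc.prems that by (intro bounded_linear.has_derivative[OF lin] deriv_HS_works) auto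
  have "Ck1_class k S (\<lambda>x. deriv_HS (\<lambda>x. L (g x)) x i)" if "i \<in> Basis" for i
  proof (subst Ck1_class_cong[OF S])
    show "deriv_HS (\<lambda>x. L (g x)) x i = L (deriv_HS g x i)" if "x \<in> S" for x
      using deriv_HS_eqI[OF der] that openin_imp_subset[OF S] by auto
  qed (use Suc that in auto)
  moreover have "\<forall>x\<in>S. (\<lambda>x. L (g x)) differentiable (at x within HS)"
    using der differentiable_def by blast
  ultimately show ?case by simp
qed

text \<open>The chain rule in coordinates is a sum of components of Dg times partial derivatives of
  \<open>f\<close> along \<open>g\<close>. The induction varies only \<open>f\<close>: the
  hypothesis is applied to its partial derivatives with the same \<open>g\<close>, taken one class
  lower.\<close>

lemma Ck1_class_compose:
  fixes f :: "('m::{finite,linorder}) eucl_space \<Rightarrow> 'b::real_normed_vector"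
    and g :: "('n::{finite,linorder}) eucl_space \<Rightarrow> 'm eucl_space"
  assumes S: "openin (top_of_set HS) S" and T: "openin (top_of_set HS) T" and gT: "g ` T \<subseteq> S"
    and "Ck1_class k S f" "Ck1_class k T g"
  shows "Ck1_class k T (\<lambda>x. f (g x))"
  using assms(4,5)
proof (induction k arbitrary: f)
  case 0
  then show ?case using gT by (simp add: locally_lipschitz_on_compose)
next
  case (Suc k)
  have SH: "S \<subseteq> HS" "T \<subseteq> HS" using S T openin_imp_subset by blast+
  have der: "((\<lambda>x. f (g x)) has_derivative (\<lambda>v. deriv_HS f (g x) (deriv_HS g x v))) (at x within HS)"
    if "x \<in> T" for x
  proof -
    have "(g has_derivative deriv_HS g x) (at x within T)"
      unfolding at_within_openin[OF T that] using Suc.prems that by (intro deriv_HS_works) auto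
    moreover have "(f has_derivative deriv_HS f (g x)) (at (g x) within g ` T)"
    proof (rule has_derivative_subset)
      show "(f has_derivative deriv_HS f (g x)) (at (g x) within HS)"
        using Suc.prems that gT by (intro deriv_HS_works) auto
    qed (use gT SH in auto)
    ultimately show ?thesis
      unfolding at_within_openin[OF T that, symmetric] by (auto dest: diff_chain_within simp: o_def)
  qed
  have "Ck1_class k T (\<lambda>x. deriv_HS (\<lambda>x. f (g x)) x j)" if j: "j \<in> Basis" for j
  proof (subst Ck1_class_cong[OF T])
    show "deriv_HS (\<lambda>x. f (g x)) x j = (\<Sum>i\<in>Basis. (deriv_HS g x j \<bullet> i) *\<^sub>R deriv_HS f (g x) i)"
      if "x \<in> T" for x
    proof -
      have "deriv_HS (\<lambda>x. f (g x)) x j = deriv_HS f (g x) (deriv_HS g x j)"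
        using deriv_HS_eqI[OF der] that SH by auto
      also have "\<dots> = (\<Sum>i\<in>Basis. (deriv_HS g x j \<bullet> i) *\<^sub>R deriv_HS f (g x) i)"
        using Suc.prems that gT by (intro deriv_HS_expand) auto
      finally show ?thesis .
    qed
    have gk: "Ck1_class k T g" using Ck1_class_SucD[OF T Suc.prems(2)] .
    show "Ck1_class k T (\<lambda>x. \<Sum>i\<in>Basis. (deriv_HS g x j \<bullet> i) *\<^sub>R deriv_HS f (g x) i)"
      using Suc.prems j
      by (intro Ck1_class_sum[OF T] Ck1_class_prod[OF T bounded_bilinear_scaleR] Suc.IH gk
          Ck1_class_linear[OF T bounded_linear_inner_left, of k "\<lambda>x. deriv_HS g x j"]) auto
  qed
  moreover have "\<forall>x\<in>T. (\<lambda>x. f (g x)) differentiable (at x within HS)"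
    using der differentiable_def by blast
  ultimately show ?case by simp
qed

subsection \<open>Inversion\<close>

text \<open>The resolvent identity: expand \<open>a = a o\<^sub>L b' o\<^sub>L a'\<close> and
  \<open>a' = a o\<^sub>L b o\<^sub>L a'\<close>. Being linear in \<open>b - b'\<close>, it carries
  regularity from a family of operators to its inverses.\<close>

lemma blinfun_inverse_diff:
  assumes "a o\<^sub>L b = id_blinfun" "b' o\<^sub>L a' = id_blinfun"
  shows "a - a' = - (a o\<^sub>L ((b - b') o\<^sub>L a'))"
proof (rule blinfun_eqI)
  fix v
  have "a (b w) = w" for w
    using assms(1) by (metis blinfun_apply_blinfun_compose blinfun_apply_id_blinfun id_apply)
  moreover have "b' (a' w) = w" for w
    using assms(2) by (metis blinfun_apply_blinfun_compose blinfun_apply_id_blinfun id_apply)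
  ultimately show "blinfun_apply (a - a') v = blinfun_apply (- (a o\<^sub>L ((b - b') o\<^sub>L a'))) v"
    by (simp add: blinfun.bilinear_simps)
qed

text \<open>In the resolvent identity the outer factors are locally bounded and the middle one is
  Lipschitz. In the application the bound on \<open>A\<close> comes from a lower bound for
  \<open>B\<close>.\<close>

lemma locally_lipschitz_on_blinfun_inverse:
  fixes A :: "'x::metric_space \<Rightarrow> ('b::real_normed_vector \<Rightarrow>\<^sub>L 'c::real_normed_vector)"
  assumes id: "\<And>y z. y \<in> S \<Longrightarrow> z \<in> S \<Longrightarrow> A y - A z = - (A y o\<^sub>L ((B y - B z) o\<^sub>L A z))"
    and bounded: "\<And>y. y \<in> S \<Longrightarrow> \<exists>e>0. \<exists>C. \<forall>z\<in>S \<inter> ball y e. norm (A z) \<le> C"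
    and B: "locally_lipschitz_on S B"
  shows "locally_lipschitz_on S A"
  unfolding locally_lipschitz_on_def
proof
  fix x assume x: "x \<in> S"
  obtain e L where e: "e > 0" "L > 0" "L-lipschitz_on (S \<inter> ball x e) B"
    using locally_lipschitz_onE[OF B x] by metis
  obtain d C where d: "d > 0" "\<And>z. z \<in> S \<inter> ball x d \<Longrightarrow> norm (A z) \<le> C"
    using bounded[OF x] by blast
  have C: "C \<ge> 0" using d(2)[of x] d(1) x norm_ge_zero[of "A x"] by (auto intro: order_trans[OF norm_ge_zero])
  have "(C * (L * C))-lipschitz_on (S \<inter> ball x (min d e)) A"
  proof (rule lipschitz_onI)
    show "C * (L * C) \<ge> 0" using C e by simp
    fix y z assume yz: "y \<in> S \<inter> ball x (min d e)" "z \<in> S \<inter> ball x (min d e)"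
    have "norm (A y - A z) = norm (A y o\<^sub>L ((B y - B z) o\<^sub>L A z))"
      using id[of y z] yz by simp
    also have "\<dots> \<le> norm (A y) * (norm (B y - B z) * norm (A z))"
      by (intro order_trans[OF norm_blinfun_compose] mult_left_mono norm_blinfun_compose) auto
    also have "\<dots> \<le> C * ((L * dist y z) * C)"
      using d(2)[of y] d(2)[of z] lipschitz_onD[OF e(3), of y z] yz C e
      by (intro mult_mono) (auto simp: dist_norm)
    finally show "dist (A y) (A z) \<le> C * (L * C) * dist y z" by (simp add: dist_norm mult_ac)
  qed
  then show "\<exists>e>0. \<exists>L. L-lipschitz_on (S \<inter> ball x e) A"
    using d e by (intro exI[of _ "min d e"]) auto
qed

text \<open>The identity expresses the increment with \<open>A y\<close> on the left; continuity of
  \<open>A\<close> at \<open>z\<close> allows replacing it by \<open>A z\<close>.\<close>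

lemma has_derivative_blinfun_inverse:
  fixes A :: "'x::real_normed_vector \<Rightarrow> ('b::real_normed_vector \<Rightarrow>\<^sub>L 'c::real_normed_vector)"
  assumes id: "\<And>y z. y \<in> S \<Longrightarrow> z \<in> S \<Longrightarrow> A y - A z = - (A y o\<^sub>L ((B y - B z) o\<^sub>L A z))"
    and A: "continuous (at z within S) A" and B: "(B has_derivative B') (at z within S)" and z: "z \<in> S"
  shows "(A has_derivative (\<lambda>v. - (A z o\<^sub>L (B' v o\<^sub>L A z)))) (at z within S)"
  unfolding has_derivative_within_alt
proof (intro conjI allI impI)
  have blB: "bounded_linear B'" using B by (rule has_derivative_bounded_linear)
  have bl: "bounded_linear (\<lambda>v. A z o\<^sub>L (B' v o\<^sub>L A z))"
    by (intro bounded_linear_compose[OF bounded_bilinear.bounded_linear_right[OF bounded_bilinear_blinfun_compose]]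
        bounded_linear_compose[OF bounded_bilinear.bounded_linear_left[OF bounded_bilinear_blinfun_compose] blB])
  then show "bounded_linear (\<lambda>v. - (A z o\<^sub>L (B' v o\<^sub>L A z)))" by (rule bounded_linear_minus)
  obtain K where K: "K > 0" "\<And>v. norm (B' v) \<le> norm v * K"
    using bounded_linear.pos_bounded[OF blB] by blast
  define a where "a = norm (A z) + 1"
  have a: "a > 0" "norm (A z) \<le> a" by (auto simp: a_def add_nonneg_pos)
  fix e :: real assume e: "e > 0"
  \<comment> \<open>Each of the two constants makes one remainder term at most half of
    \<open>e * norm (y - z)\<close>. The bound 1 in \<open>e2\<close> gives \<open>B\<close> the
    slope \<open>K + 1\<close> at \<open>z\<close>.\<close>
  define e1 where "e1 = e / (2 * a * (K + 1))"
  define e2 where "e2 = min 1 (e / (2 * a * a))"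
  have pos: "e1 > 0" "e2 > 0" using e a K by (auto simp: e1_def e2_def)
  obtain d1 where d1: "d1 > 0" "\<And>y. y \<in> S \<Longrightarrow> norm (y - z) < d1 \<Longrightarrow> norm (A y - A z) < e1"
    using A pos unfolding continuous_within_eps_delta dist_norm by meson
  obtain d2 where d2: "d2 > 0"
      "\<And>y. y \<in> S \<Longrightarrow> norm (y - z) < d2 \<Longrightarrow> norm (B y - B z - B' (y - z)) \<le> e2 * norm (y - z)"
    using B pos unfolding has_derivative_within_alt by meson
  show "\<exists>d>0. \<forall>y\<in>S. norm (y - z) < d \<longrightarrow>
      norm (A y - A z - - (A z o\<^sub>L (B' (y - z) o\<^sub>L A z))) \<le> e * norm (y - z)"
  proof (intro exI[of _ "min d1 d2"] conjI ballI impI)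
    show "min d1 d2 > 0" using d1 d2 by simp
    fix y assume y: "y \<in> S" "norm (y - z) < min d1 d2"
    let ?n = "norm (y - z)"
    have Bd: "norm (B y - B z - B' (y - z)) \<le> e2 * ?n" using d2 y by auto
    have "norm (B y - B z) \<le> norm (B y - B z - B' (y - z)) + norm (B' (y - z))"
      using norm_triangle_ineq[of "B y - B z - B' (y - z)" "B' (y - z)"] by simp
    also have "\<dots> \<le> 1 * ?n + ?n * K"
    proof (intro add_mono K(2) order_trans[OF Bd] mult_right_mono)
      show "e2 \<le> 1" by (simp add: e2_def)
    qed simp
    finally have By: "norm (B y - B z) \<le> (K + 1) * ?n" by (simp add: algebra_simps)
    have "A y - A z - - (A z o\<^sub>L (B' (y - z) o\<^sub>L A z))
       = - ((A y - A z) o\<^sub>L ((B y - B z) o\<^sub>L A z)) - (A z o\<^sub>L ((B y - B z - B' (y - z)) o\<^sub>L A z))"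
    proof -
      have "A y - A z - - (A z o\<^sub>L (B' (y - z) o\<^sub>L A z))
          = - (A y o\<^sub>L ((B y - B z) o\<^sub>L A z)) - - (A z o\<^sub>L (B' (y - z) o\<^sub>L A z))"
        by (simp only: id[OF y(1) z])
      also have "\<dots> = - ((A y - A z) o\<^sub>L ((B y - B z) o\<^sub>L A z))
          - (A z o\<^sub>L ((B y - B z - B' (y - z)) o\<^sub>L A z))"
        by (intro blinfun_eqI) (simp add: blinfun.bilinear_simps)
      finally show ?thesis .
    qed
    then have "norm (A y - A z - - (A z o\<^sub>L (B' (y - z) o\<^sub>L A z)))
       \<le> norm ((A y - A z) o\<^sub>L ((B y - B z) o\<^sub>L A z)) + norm (A z o\<^sub>L ((B y - B z - B' (y - z)) o\<^sub>L A z))"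
      by (metis norm_minus_cancel norm_triangle_ineq4)
    also have "\<dots> \<le> norm (A y - A z) * (norm (B y - B z) * norm (A z))
        + norm (A z) * (norm (B y - B z - B' (y - z)) * norm (A z))"
      by (intro add_mono order_trans[OF norm_blinfun_compose] mult_left_mono norm_blinfun_compose) auto
    also have "\<dots> \<le> e1 * (((K + 1) * ?n) * a) + a * ((e2 * ?n) * a)"
      using d1(2)[OF y(1)] y(2) a By Bd K pos by (intro add_mono mult_mono) auto
    also have "\<dots> = (e1 * (K + 1) * a + a * e2 * a) * ?n" by (simp add: algebra_simps)
    also have "\<dots> \<le> e * ?n"
    proof (rule mult_right_mono)
      have "e / (2 * a * c) * c * a = e / 2" if "c > 0" for c :: real
        using a that by (simp add: field_simps)
      from this[of "K + 1"] have "e1 * (K + 1) * a = e / 2" using K by (simp add: e1_def)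
      moreover have "a * e2 * a \<le> a * (e / (2 * a * a)) * a"
        using a e by (intro mult_mono) (auto simp: e2_def)
      moreover have "a * (e / (2 * a * a)) * a = e / 2" using a by (simp add: field_simps)
      ultimately show "e1 * (K + 1) * a + a * e2 * a \<le> e" by simp
    qed simp
    finally show "norm (A y - A z - - (A z o\<^sub>L (B' (y - z) o\<^sub>L A z))) \<le> e * norm (y - z)" .
  qed
qed

text \<open>Bootstrapping with DA = - A (DB) A: if \<open>A\<close> is of class \<open>k\<close> and
  \<open>B\<close> of class \<open>Suc k\<close>, then DA is of class \<open>k\<close>.\<close>

lemma Ck1_class_blinfun_inverse:
  fixes A :: "('m::{finite,linorder}) eucl_space \<Rightarrow> ('b::real_normed_vector \<Rightarrow>\<^sub>L 'c::real_normed_vector)"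
  assumes S: "openin (top_of_set HS) S"
    and inverse: "\<And>y. y \<in> S \<Longrightarrow> A y o\<^sub>L B y = id_blinfun" "\<And>y. y \<in> S \<Longrightarrow> B y o\<^sub>L A y = id_blinfun"
    and bounded: "\<And>y. y \<in> S \<Longrightarrow> \<exists>e>0. \<exists>C. \<forall>z\<in>S \<inter> ball y e. norm (A z) \<le> C"
    and "Ck1_class k S B"
  shows "Ck1_class k S A"
  using assms(5)
proof (induction k)
  case 0
  then show ?case
    using locally_lipschitz_on_blinfun_inverse[of S A B, OF blinfun_inverse_diff bounded] inverse by simp
next
  case (Suc k)
  have Ak: "Ck1_class k S A" using Suc.IH Ck1_class_SucD[OF S Suc.prems] by blast
  have contA: "continuous_on S A"
    using Ck1_class_lipschitz[OF S Ak] by (rule locally_lipschitz_on_imp_continuous_on)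
  have der: "(A has_derivative (\<lambda>v. - (A z o\<^sub>L (deriv_HS B z v o\<^sub>L A z)))) (at z within HS)" if z: "z \<in> S" for z
  proof -
    have "(B has_derivative deriv_HS B z) (at z within S)"
      unfolding at_within_openin[OF S z] using Suc.prems z by (intro deriv_HS_works) auto
    moreover have "continuous (at z within S) A"
      using contA z by (simp add: continuous_on_eq_continuous_within)
    ultimately show ?thesis
      using has_derivative_blinfun_inverse[of S A B z, OF blinfun_inverse_diff _ _ z] inverse unfolding at_within_openin[OF S z] by blast
  qed
  have "Ck1_class k S (\<lambda>x. deriv_HS A x i)" if i: "i \<in> Basis" for i
  proof (subst Ck1_class_cong[OF S])
    show "deriv_HS A x i = - (A x o\<^sub>L (deriv_HS B x i o\<^sub>L A x))" if "x \<in> S" for x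
      using deriv_HS_eqI[OF der] that openin_imp_subset[OF S] by auto
    show "Ck1_class k S (\<lambda>x. - (A x o\<^sub>L (deriv_HS B x i o\<^sub>L A x)))"
    proof (rule Ck1_class_linear[OF S bounded_linear_minus[OF bounded_linear_ident]])
      have "Ck1_class k S (\<lambda>x. deriv_HS B x i)" using Suc.prems i by simp
      then have "Ck1_class k S (\<lambda>x. deriv_HS B x i o\<^sub>L A x)"
        by (rule Ck1_class_prod[OF S bounded_bilinear_blinfun_compose _ Ak])
      then show "Ck1_class k S (\<lambda>x. A x o\<^sub>L (deriv_HS B x i o\<^sub>L A x))"
        by (rule Ck1_class_prod[OF S bounded_bilinear_blinfun_compose Ak])
    qed
  qed
  moreover have "\<forall>x\<in>S. A differentiable (at x within HS)"
    using der differentiable_def by blast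
  ultimately show ?case by simp
qed

text \<open>The operator sends v to \<open>(v \<bullet> i) *\<^sub>R w\<close>. Its linearity in
  \<open>w\<close> makes a Jacobian a sum of bounded linear images of its columns.\<close>

lemma bounded_linear_rank_one: "bounded_linear (\<lambda>w. blinfun_scaleR_left w o\<^sub>L blinfun_inner_left i)"
  by (rule bounded_linear_compose[OF
      bounded_bilinear.bounded_linear_left[OF bounded_bilinear_blinfun_compose] bounded_linear_blinfun_scaleR_left])

lemma Blinfun_deriv_HS:
  assumes "g differentiable (at x within HS)"
  shows "Blinfun (deriv_HS g x) = (\<Sum>i\<in>Basis. blinfun_scaleR_left (deriv_HS g x i) o\<^sub>L blinfun_inner_left i)"
proof (rule blinfun_eqI)
  fix v
  have "bounded_linear (deriv_HS g x)" using deriv_HS_works[OF assms] by (rule has_derivative_bounded_linear)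
  then show "blinfun_apply (Blinfun (deriv_HS g x)) v
      = blinfun_apply (\<Sum>i\<in>Basis. blinfun_scaleR_left (deriv_HS g x i) o\<^sub>L blinfun_inner_left i) v"
    using deriv_HS_expand[OF assms, of v] by (simp add: bounded_linear_Blinfun_apply blinfun.sum_left)
qed

text \<open>As \<open>g\<close> inverts \<open>h\<close>, nearby points satisfy
  \<open>dist y x \<le> L * dist (h y) (h x)\<close>. The first-order error of \<open>h\<close> is
  kept below \<open>1 / (2 * L) * norm (y - x)\<close>, which absorbs half of this; hence the factor
  2.\<close>

lemma deriv_HS_lower_bound:
  fixes h :: "('m::{finite,linorder}) eucl_space \<Rightarrow> 'b::real_normed_vector"
  assumes S: "openin (top_of_set HS) S" and x: "x \<in> S"
    and h: "h differentiable (at x within HS)" and T: "openin (top_of_set (h ` S)) T" "h x \<in> T"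
    and L: "L-lipschitz_on T g" "L > 0" and gh: "\<And>y. y \<in> S \<Longrightarrow> g (h y) = y"
  shows "norm v \<le> 2 * L * norm (deriv_HS h x v)"
proof -
  have SH: "S \<subseteq> HS" using S openin_imp_subset by blast
  have der: "(h has_derivative deriv_HS h x) (at x within HS)" using h by (rule deriv_HS_works)
  have lin: "linear (deriv_HS h x)" using h by (rule linear_frechet_derivative)
  obtain d1 where d1: "d1 > 0" "ball x d1 \<inter> HS \<subseteq> S" using S x by (auto simp: openin_contains_ball)
  obtain O' where O': "open O'" "T = h ` S \<inter> O'" using T(1) by (auto simp: openin_open)
  have "continuous (at x within HS) h" using der by (rule has_derivative_continuous)
  moreover obtain r where r: "r > 0" "ball (h x) r \<subseteq> O'" using O' T(2) by (meson IntD2 open_contains_ball)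
  ultimately obtain d2 where d2: "d2 > 0" "\<And>y. y \<in> HS \<Longrightarrow> dist y x < d2 \<Longrightarrow> dist (h y) (h x) < r"
    unfolding continuous_within_eps_delta by meson
  obtain d3 where d3: "d3 > 0" "\<And>y. y \<in> HS \<Longrightarrow> norm (y - x) < d3 \<Longrightarrow>
      norm (h y - h x - deriv_HS h x (y - x)) \<le> 1 / (2 * L) * norm (y - x)"
    using der L(2) unfolding has_derivative_within_alt
    by (metis divide_pos_pos mult_pos_pos zero_less_numeral zero_less_one)
  define d where "d = min d1 (min d2 d3)"
  have d: "d > 0" "d \<le> d1" "d \<le> d2" "d \<le> d3" using d1 d2 d3 by (auto simp: d_def)
  \<comment> \<open>A direction in the half-space can be followed from \<open>x\<close> without
    leaving it; any other vector is the negative of such a direction.\<close>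
  have pos: "norm v \<le> 2 * L * norm (deriv_HS h x v)" if v: "v \<in> HS" for v
  proof -
    \<comment> \<open>The summand 1 covers \<open>v = 0\<close> and makes the step strictly shorter
      than \<open>d\<close>.\<close>
    define t where "t = d / (norm v + 1)"
    have t: "t > 0" "t * norm v < d"
      using d(1) by (auto simp: t_def field_simps add_nonneg_pos add_pos_nonneg)
    define y where "y = x + t *\<^sub>R v"
    have yx: "y - x = t *\<^sub>R v" "norm (y - x) < d" using t by (auto simp: y_def)
    have yH: "y \<in> HS" using v t SH x by (auto simp: y_def HS_eq)
    have yx': "dist y x < d" unfolding dist_norm by (rule yx(2))
    then have yS: "y \<in> S" using yH d1(2) d(2) by (auto simp: dist_commute)
    have hy: "h y \<in> T" using d2(2)[OF yH] yx' d(3) r yS unfolding O'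
      by (auto simp: dist_commute)
    have "t * norm v = dist (g (h y)) (g (h x))" using gh yS x yx t by (simp add: dist_norm)
    also have "\<dots> \<le> L * norm (h y - h x)" using lipschitz_onD[OF L(1) hy T(2)] by (simp add: dist_norm)
    also have "norm (h y - h x) \<le> norm (h y - h x - deriv_HS h x (y - x)) + norm (deriv_HS h x (y - x))"
      using norm_triangle_ineq[of "h y - h x - deriv_HS h x (y - x)" "deriv_HS h x (y - x)"] by simp
    also have "\<dots> \<le> 1 / (2 * L) * norm (y - x) + norm (deriv_HS h x (y - x))"
      using d3(2)[OF yH] yx d by simp
    also have "\<dots> = t * (1 / (2 * L) * norm v + norm (deriv_HS h x v))"
      using t by (simp add: yx linear_scale[OF lin] algebra_simps)
    finally have "t * norm v \<le> t * (L * (1 / (2 * L) * norm v + norm (deriv_HS h x v)))"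
      using L(2) by (simp add: mult_left_mono mult.left_commute)
    then have "norm v \<le> L * (1 / (2 * L) * norm v + norm (deriv_HS h x v))" using t by simp
    then show ?thesis using L(2) by (simp add: field_simps)
  qed
  show ?thesis
  proof (cases "v \<in> HS")
    case False
    then have "- v \<in> HS" by (auto simp: HS_eq)
    from pos[OF this] show ?thesis by (simp add: linear_neg[OF lin])
  qed (rule pos)
qed

text \<open>The inverse inherits all derivatives by differentiating $Dg(y) = (Dh(g(y)))^{-1}$; the lower
  bound that makes \<open>Dh\<close> invertible comes from the Lipschitz property of \<open>g\<close>.\<close>

lemma Ck1_class_inverse:
  fixes h :: "('m::{finite,linorder}) eucl_space \<Rightarrow> ('n::{finite,linorder}) eucl_space"
  assumes dims: "CARD('m) = CARD('n)"
    and S: "openin (top_of_set HS) S" and T: "openin (top_of_set HS) T"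
    and hS: "h ` S = T" and gh: "\<And>x. x \<in> S \<Longrightarrow> g (h x) = x"
    and hk: "Ck1_class k S h" and g: "locally_lipschitz_on T g"
  shows "Ck1_class k T g"
proof -
  have TH: "T \<subseteq> HS" using T openin_imp_subset by blast
  have SH: "S \<subseteq> HS" using S openin_imp_subset by blast
  have gT: "g ` T = S" using hS gh by force
  have hg: "h (g y) = y" if "y \<in> T" for y using that hS gh by auto
  have "Ck1_class j T g" if "j \<le> k" for j
    using that
  proof (induction j)
    case 0
    then show ?case using g by simp
  next
    case (Suc j)
    \<comment> \<open>One class is gained per round: \<open>g\<close> of class \<open>j\<close>
      makes Dh along \<open>g\<close> of class \<open>j\<close>, hence also its inverse, which is
      Dg.\<close>
    have gj: "Ck1_class j T g" using Suc by simp
    have h1: "Ck1_class (Suc j) S h" using Ck1_class_mono[OF S _ hk] Suc.prems by blast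
    have hd: "h differentiable (at (g y) within HS)" if "y \<in> T" for y
      using h1 that gT by auto
    define B where "B y = Blinfun (deriv_HS h (g y))" for y
    have BB: "blinfun_apply (B y) = deriv_HS h (g y)" if "y \<in> T" for y
      unfolding B_def using deriv_HS_works[OF hd[OF that]]
      by (intro bounded_linear_Blinfun_apply has_derivative_bounded_linear)
    have lower: "\<exists>e>0. \<exists>C>0. \<forall>z\<in>T \<inter> ball y e. \<forall>v. norm v \<le> C * norm (B z v)" if y: "y \<in> T" for y
    proof -
      obtain e L where e: "e > 0" "L > 0" "L-lipschitz_on (T \<inter> ball y e) g"
        using locally_lipschitz_onE[OF g y] by metis
      have "norm v \<le> 2 * L * norm (B z v)" if z: "z \<in> T \<inter> ball y e" for z v
        using deriv_HS_lower_bound[OF S _ hd _ _ e(3,2) gh, of z v] z gT hg BB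
        by (auto simp: hS openin_open_Int)
      with e show ?thesis by (intro exI[of _ e] conjI exI[of _ "2 * L"]) auto
    qed
    \<comment> \<open>The lower bound gives injectivity, and equality of the dimensions turns it
      into bijectivity.\<close>
    have bij: "bij (blinfun_apply (B y))" if y: "y \<in> T" for y
    proof -
      obtain C where C: "\<And>v. norm v \<le> C * norm (B y v)"
        using lower[OF y] y by (metis IntI centre_in_ball)
      have lin: "linear (blinfun_apply (B y))"
        using blinfun.bounded_linear_right bounded_linear.linear by blast
      have "inj (blinfun_apply (B y))"
        unfolding linear_injective_0[OF lin] using C by (metis mult_zero_right norm_le_zero_iff norm_zero)
      moreover from this have "surj (blinfun_apply (B y))"
        by (intro linear_injective_imp_surjective[OF lin]) (simp_all add: dims)
      ultimately show ?thesis by (rule bijI)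
    qed
    define A where "A y = Blinfun (inv (blinfun_apply (B y)))" for y
    have AA: "blinfun_apply (A y) = inv (blinfun_apply (B y))" if y: "y \<in> T" for y
    proof -
      have sj: "blinfun_apply (B y) (inv (blinfun_apply (B y)) v) = v" for v
        using bij[OF y] by (simp add: bij_is_surj surj_f_inv_f)
      have ij: "inv (blinfun_apply (B y)) (blinfun_apply (B y) v) = v" for v
        using bij[OF y] by (simp add: bij_is_inj)
      have "linear (inv (blinfun_apply (B y)))"
      proof (rule linearI)
        fix v w c
        show "inv (blinfun_apply (B y)) (v + w) = inv (blinfun_apply (B y)) v + inv (blinfun_apply (B y)) w"
          by (metis ij sj blinfun.add_right)
        show "inv (blinfun_apply (B y)) (c *\<^sub>R v) = c *\<^sub>R inv (blinfun_apply (B y)) v"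
          by (metis ij sj blinfun.scaleR_right)
      qed
      then show ?thesis
        unfolding A_def by (intro bounded_linear_Blinfun_apply) (simp add: linear_conv_bounded_linear)
    qed
    have BA: "B y o\<^sub>L A y = id_blinfun" "A y o\<^sub>L B y = id_blinfun" if "y \<in> T" for y
      using bij[OF that] AA[OF that] unfolding bij_def
      by (auto intro!: blinfun_eqI simp: surj_f_inv_f)
    have bounded: "\<exists>e>0. \<exists>C. \<forall>z\<in>T \<inter> ball y e. norm (A z) \<le> C" if y: "y \<in> T" for y
    proof -
      obtain e C where e: "e > 0" "C > 0" "\<And>z v. z \<in> T \<inter> ball y e \<Longrightarrow> norm v \<le> C * norm (B z v)"
        using lower[OF y] by metis
      have "norm (A z) \<le> C" if z: "z \<in> T \<inter> ball y e" for z
      proof (rule norm_blinfun_bound)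
        fix v
        have "B z (A z v) = v" using BA(1)[of z] z by (metis IntD1 blinfun_apply_blinfun_compose blinfun_apply_id_blinfun id_apply)
        then show "norm (A z v) \<le> C * norm v" using e(3)[OF z, of "A z v"] by simp
      qed (use e in simp)
      with e show ?thesis by blast
    qed
    have Bj: "Ck1_class j T B"
    proof (subst Ck1_class_cong[OF T])
      show "B y = (\<Sum>i\<in>Basis. blinfun_scaleR_left (deriv_HS h (g y) i) o\<^sub>L blinfun_inner_left i)" if "y \<in> T" for y
        unfolding B_def by (rule Blinfun_deriv_HS[OF hd[OF that]])
      show "Ck1_class j T (\<lambda>y. \<Sum>i\<in>Basis. blinfun_scaleR_left (deriv_HS h (g y) i) o\<^sub>L blinfun_inner_left i)"
      proof (rule Ck1_class_sum[OF T], rule Ck1_class_linear[OF T bounded_linear_rank_one])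
        fix i :: "'m eucl_space" assume "i \<in> Basis"
        then show "Ck1_class j T (\<lambda>y. deriv_HS h (g y) i)"
          using h1 by (intro Ck1_class_compose[OF S T _ _ gj, where f="\<lambda>x. deriv_HS h x i"]) (auto simp: gT)
      qed
    qed
    have Aj: "Ck1_class j T A"
      by (rule Ck1_class_blinfun_inverse[OF T BA(2) BA(1) bounded Bj])
    \<comment> \<open>Applying \<open>A y\<close> to the first-order expansion of \<open>h\<close>
      at \<open>g y\<close> gives that of \<open>g\<close> at \<open>y\<close>, since
      \<open>h (g z) = z\<close>. The Lipschitz bound on \<open>g\<close> converts the error from
      \<open>g z - g y\<close> to \<open>z - y\<close>.\<close>
    have der: "(g has_derivative blinfun_apply (A y)) (at y within HS)" if y: "y \<in> T" for y
      unfolding at_within_openin[OF T y, symmetric] has_derivative_within_alt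
    proof (intro conjI allI impI)
      show "bounded_linear (blinfun_apply (A y))" by (rule blinfun.bounded_linear_right)
      fix e :: real assume e: "e > 0"
      obtain d1 L where d1: "d1 > 0" "L > 0" "L-lipschitz_on (T \<inter> ball y d1) g"
        using locally_lipschitz_onE[OF g y] by metis
      \<comment> \<open>Cancels the factor \<open>norm (A y) + 1\<close> from applying
        \<open>A y\<close> and the factor \<open>L\<close> from the Lipschitz bound.\<close>
      define e1 where "e1 = e / ((norm (A y) + 1) * L)"
      have e1: "e1 > 0" using e d1 by (auto simp: e1_def add_nonneg_pos)
      obtain d2 where d2: "d2 > 0" "\<And>x. x \<in> HS \<Longrightarrow> norm (x - g y) < d2 \<Longrightarrow>
          norm (h x - h (g y) - B y (x - g y)) \<le> e1 * norm (x - g y)"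
        using deriv_HS_works[OF hd[OF y]] e1 unfolding BB[OF y] has_derivative_within_alt by meson
      define d where "d = min d1 (d2 / L)"
      show "\<exists>d>0. \<forall>z\<in>T. norm (z - y) < d \<longrightarrow> norm (g z - g y - A y (z - y)) \<le> e * norm (z - y)"
      proof (intro exI[of _ d] conjI ballI impI)
        show "d > 0" using d1 d2 by (simp add: d_def)
        fix z assume z: "z \<in> T" "norm (z - y) < d"
        have lip: "norm (g z - g y) \<le> L * norm (z - y)"
          using lipschitz_onD[OF d1(3), of z y] z y d1 by (auto simp: dist_norm d_def norm_minus_commute)
        also have "\<dots> < d2" using z(2) d1 by (auto simp: d_def field_simps)
        finally have "norm (h (g z) - h (g y) - B y (g z - g y)) \<le> e1 * norm (g z - g y)"
          using z gT SH by (intro d2) auto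
        then have *: "norm (z - y - B y (g z - g y)) \<le> e1 * (L * norm (z - y))"
          unfolding hg[OF z(1)] hg[OF y] using lip e1 by (elim order_trans) (simp add: mult_left_mono)
        have "A y (B y w) = w" for w using BA(2)[OF y] by (metis blinfun_apply_blinfun_compose blinfun_apply_id_blinfun id_apply)
        then have "g z - g y - A y (z - y) = - A y (z - y - B y (g z - g y))"
          by (simp add: blinfun.bilinear_simps)
        then have "norm (g z - g y - A y (z - y)) \<le> norm (A y) * norm (z - y - B y (g z - g y))"
          by (simp add: norm_blinfun)
        also have "\<dots> \<le> (norm (A y) + 1) * (e1 * (L * norm (z - y)))"
          using * by (intro mult_mono) auto
        also have "\<dots> = e * norm (z - y)"
          using d1 norm_ge_zero[of "A y"] by (simp add: e1_def field_simps add_nonneg_eq_0_iff)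
        finally show "norm (g z - g y - A y (z - y)) \<le> e * norm (z - y)" .
      qed
    qed
    have "Ck1_class j T (\<lambda>y. deriv_HS g y i)" for i
    proof (subst Ck1_class_cong[OF T])
      show "deriv_HS g y i = A y i" if "y \<in> T" for y
        using deriv_HS_eqI[OF der] that TH by auto
      show "Ck1_class j T (\<lambda>y. blinfun_apply (A y) i)"
        by (rule Ck1_class_linear[OF T _ Aj]) (rule blinfun.bounded_linear_left)
    qed
    moreover have "\<forall>x\<in>T. g differentiable (at x within HS)"
      using der differentiable_def by blast
    ultimately show ?case by simp
  qed
  then show ?thesis by blast
qed

subsection \<open>Comparison with iterated derivatives\<close>

lemma span_HS: "span (HS :: ('m::{finite,linorder}) eucl_space set) = UNIV"
proof -
  have "(Basis :: 'm eucl_space set) \<subseteq> HS" by (auto simp: HS_eq Basis_vec_def axis_def)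
  then have "span Basis \<subseteq> span (HS :: 'm eucl_space set)" by (rule span_mono)
  then show ?thesis by auto
qed

lemma vector_tuples_full:
  "vector_tuples CARD('m) j = {vs :: ('m::{finite,linorder}) eucl_space list. length vs = j}"
  by (simp add: vector_tuples_def span_HS)

lemma vector_tuples_0: "vector_tuples m 0 = {[]}"
  by (auto simp: vector_tuples_def)

lemma multi_onorm_leD:
  assumes "multi_onorm m j A \<le> ennreal B" "B \<ge> 0" "vs \<in> vector_tuples m j" "\<And>v. v \<in> set vs \<Longrightarrow> norm v \<le> 1"
  shows "norm (A vs) \<le> B"
proof -
  have "ennreal (norm (A vs)) \<le> multi_onorm m j A"
    unfolding multi_onorm_def using assms(3,4) by (intro SUP_upper) auto
  with assms(1) have "ennreal (norm (A vs)) \<le> ennreal B" by (rule order_trans[rotated])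
  then show ?thesis using assms(2) by (simp add: ennreal_le_iff)
qed

lemma multi_onorm_leI:
  assumes "\<And>vs. vs \<in> vector_tuples m j \<Longrightarrow> (\<And>v. v \<in> set vs \<Longrightarrow> norm v \<le> 1) \<Longrightarrow> norm (A vs) \<le> B"
  shows "multi_onorm m j A \<le> ennreal B"
  unfolding multi_onorm_def by (intro SUP_least ennreal_leI) (use assms in auto)

text \<open>\<open>iter_deriv\<close> uses the head of the list in its last differentiation, so the
  final entry belongs to the first one. Splitting that off passes to the recursion of
  \<open>Ck1_class\<close>.\<close>

lemma iter_deriv_snoc:
  "length vs = j \<Longrightarrow> iter_deriv m (Suc j) g x (vs @ [v])
     = iter_deriv m j (\<lambda>y. frechet_derivative g (at y within half_space m) v) x vs"
proof (induction j arbitrary: x vs)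
  case (Suc j)
  then obtain w ws where vs: "vs = w # ws" by (metis length_Suc_conv)
  have "iter_deriv m (Suc j) g y (ws @ [v])
     = iter_deriv m j (\<lambda>y. frechet_derivative g (at y within half_space m) v) y ws" for y
    using Suc by (simp only: vs) simp
  then have "(\<lambda>y. iter_deriv m (Suc j) g y (ws @ [v]))
     = (\<lambda>y. iter_deriv m j (\<lambda>y. frechet_derivative g (at y within half_space m) v) y ws)" ..
  then show ?case unfolding iter_deriv.simps(2)[of m "Suc j"] vs by simp
qed simp

text \<open>A condition on \<open>D\<^sup>j\<close> of the \<open>i\<close>-th partial derivative is
  the condition on the next derivative of \<open>g\<close> for tuples extended by the unit vector
  \<open>i\<close>.\<close>

lemma Ck1_classI:
  fixes g :: "('m::{finite,linorder}) eucl_space \<Rightarrow> ('n::finite) eucl_space"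
  assumes "Ck_on CARD('m) k g S" "deriv_locally_Lipschitz_on CARD('m) k g S"
  shows "Ck1_class k S g"
  using assms
proof (induction k arbitrary: g)
  case 0
  have "locally_lipschitz_on S g"
    unfolding locally_lipschitz_on_def
  proof
    fix x assume "x \<in> S"
    then obtain W L where W: "open W" "x \<in> W" "0 \<le> L"
      and *: "\<And>y z. y \<in> W \<inter> S \<Longrightarrow> z \<in> W \<inter> S \<Longrightarrow>
         multi_onorm CARD('m) 0 (\<lambda>vs. iter_deriv CARD('m) 0 g y vs - iter_deriv CARD('m) 0 g z vs) \<le> ennreal (L * dist y z)"
      using 0(2) unfolding deriv_locally_Lipschitz_on_def by meson
    obtain e where e: "e > 0" "ball x e \<subseteq> W" using W open_contains_ball by blast
    have "L-lipschitz_on (S \<inter> ball x e) g"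
    proof (rule lipschitz_onI)
      fix y z assume "y \<in> S \<inter> ball x e" "z \<in> S \<inter> ball x e"
      with e have "y \<in> W \<inter> S" "z \<in> W \<inter> S" by blast+
      then show "dist (g y) (g z) \<le> L * dist y z"
        using multi_onorm_leD[OF *, of y z "[]"] W by (auto simp: dist_norm vector_tuples_0)
    qed (rule W)
    with e show "\<exists>e>0. \<exists>L. L-lipschitz_on (S \<inter> ball x e) g" by blast
  qed
  then show ?case by simp
next
  case (Suc k)
  have "g differentiable (at x within HS)" if "x \<in> S" for x
  proof -
    have "(\<lambda>y. iter_deriv CARD('m) 0 g y []) differentiable (at x within HS)"
      using Suc.prems(1) that vector_tuples_0 unfolding Ck_on_def by blast
    then show ?thesis by simp
  qed
  moreover have "Ck1_class k S (\<lambda>x. deriv_HS g x i)" if i: "i \<in> Basis" for i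
  proof (rule Suc.IH)
    have snoc: "iter_deriv CARD('m) j (\<lambda>x. deriv_HS g x i) y vs = iter_deriv CARD('m) (Suc j) g y (vs @ [i])"
      if "vs \<in> vector_tuples CARD('m) j" for j y and vs :: "'m eucl_space list"
      using that iter_deriv_snoc[of vs j "CARD('m)" g y i] by (simp add: vector_tuples_full)
    show "Ck_on CARD('m) k (\<lambda>x. deriv_HS g x i) S"
      unfolding Ck_on_def
    proof (intro conjI allI impI ballI)
      fix j x and vs :: "'m eucl_space list"
      assume *: "j < k" "vs \<in> vector_tuples CARD('m) j" "x \<in> S"
      then have "(\<lambda>y. iter_deriv CARD('m) (Suc j) g y (vs @ [i])) differentiable (at x within HS)"
        using Suc.prems(1) unfolding Ck_on_def
        by (auto simp: vector_tuples_full simp del: iter_deriv.simps)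
      then show "(\<lambda>y. iter_deriv CARD('m) j (\<lambda>x. deriv_HS g x i) y vs) differentiable (at x within HS)"
        using snoc[OF *(2)] by simp
    next
      fix j and vs :: "'m eucl_space list"
      assume *: "j \<le> k" "vs \<in> vector_tuples CARD('m) j"
      then have "continuous_on S (\<lambda>y. iter_deriv CARD('m) (Suc j) g y (vs @ [i]))"
        using Suc.prems(1) unfolding Ck_on_def
        by (auto simp: vector_tuples_full simp del: iter_deriv.simps)
      then show "continuous_on S (\<lambda>y. iter_deriv CARD('m) j (\<lambda>x. deriv_HS g x i) y vs)"
        using snoc[OF *(2)] by simp
    qed
    show "deriv_locally_Lipschitz_on CARD('m) k (\<lambda>x. deriv_HS g x i) S"
      unfolding deriv_locally_Lipschitz_on_def
    proof
      fix x assume "x \<in> S"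
      then obtain W L where W: "open W" "x \<in> W" "0 \<le> L"
        and *: "\<And>y z. y \<in> W \<inter> S \<Longrightarrow> z \<in> W \<inter> S \<Longrightarrow>
           multi_onorm CARD('m) (Suc k) (\<lambda>vs. iter_deriv CARD('m) (Suc k) g y vs - iter_deriv CARD('m) (Suc k) g z vs)
             \<le> ennreal (L * dist y z)"
        using Suc.prems(2) unfolding deriv_locally_Lipschitz_on_def by meson
      show "\<exists>W L. open W \<and> x \<in> W \<and> 0 \<le> L \<and> (\<forall>y\<in>W \<inter> S. \<forall>z\<in>W \<inter> S.
          multi_onorm CARD('m) k (\<lambda>vs. iter_deriv CARD('m) k (\<lambda>x. deriv_HS g x i) y vs
            - iter_deriv CARD('m) k (\<lambda>x. deriv_HS g x i) z vs) \<le> ennreal (L * dist y z))"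
      proof (intro exI conjI ballI)
        fix y z assume yz: "y \<in> W \<inter> S" "z \<in> W \<inter> S"
        show "multi_onorm CARD('m) k (\<lambda>vs. iter_deriv CARD('m) k (\<lambda>x. deriv_HS g x i) y vs
            - iter_deriv CARD('m) k (\<lambda>x. deriv_HS g x i) z vs) \<le> ennreal (L * dist y z)"
        proof (rule multi_onorm_leI)
          fix vs :: "'m eucl_space list" assume vs: "vs \<in> vector_tuples CARD('m) k" "\<And>v. v \<in> set vs \<Longrightarrow> norm v \<le> 1"
          have "norm (iter_deriv CARD('m) (Suc k) g y (vs @ [i]) - iter_deriv CARD('m) (Suc k) g z (vs @ [i])) \<le> L * dist y z"
            by (rule multi_onorm_leD[OF *[OF yz]]) (use vs W i in \<open>auto simp: vector_tuples_full\<close>)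
          then show "norm (iter_deriv CARD('m) k (\<lambda>x. deriv_HS g x i) y vs
              - iter_deriv CARD('m) k (\<lambda>x. deriv_HS g x i) z vs) \<le> L * dist y z"
            by (simp only: snoc[OF vs(1)])
        qed
      qed (use W in auto)
    qed
  qed
  ultimately show ?case by simp
qed

lemma Ck1_class_deriv_HS:
  assumes S: "openin (top_of_set HS) S" and g: "Ck1_class (Suc k) S g"
  shows "Ck1_class k S (\<lambda>x. deriv_HS g x v)"
proof (subst Ck1_class_cong[OF S])
  show "deriv_HS g x v = (\<Sum>i\<in>Basis. (v \<bullet> i) *\<^sub>R deriv_HS g x i)" if "x \<in> S" for x
    using g that by (intro deriv_HS_expand) auto
  show "Ck1_class k S (\<lambda>x. \<Sum>i\<in>Basis. (v \<bullet> i) *\<^sub>R deriv_HS g x i)"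
  proof (rule Ck1_class_sum[OF S])
    fix i :: "'a eucl_space" assume "i \<in> Basis"
    then have "Ck1_class k S (\<lambda>x. deriv_HS g x i)" using g by simp
    then show "Ck1_class k S (\<lambda>x. (v \<bullet> i) *\<^sub>R deriv_HS g x i)"
      by (rule Ck1_class_linear[OF S bounded_linear_scaleR_right])
  qed
qed

lemma Ck1_class_iter_deriv:
  fixes g :: "('m::{finite,linorder}) eucl_space \<Rightarrow> ('n::finite) eucl_space"
  assumes S: "openin (top_of_set HS) S" and "Ck1_class (j + k) S g" "length vs = j"
  shows "Ck1_class k S (\<lambda>x. iter_deriv CARD('m) j g x vs)"
  using assms(2,3)
proof (induction j arbitrary: g vs)
  case (Suc j)
  then obtain ws v where vs: "vs = ws @ [v]" "length ws = j" by (metis length_Suc_conv_rev)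
  have "Ck1_class (j + k) S (\<lambda>x. deriv_HS g x v)"
    using Suc.prems(1) by (intro Ck1_class_deriv_HS[OF S]) simp
  from Suc.IH[OF this vs(2)] show ?case
    unfolding vs(1) iter_deriv_snoc[OF vs(2)] .
qed simp

lemma iter_deriv_openin_cong:
  assumes S: "openin (top_of_set (half_space m)) S" and "\<And>x. x \<in> S \<Longrightarrow> f x = g x" "x \<in> S"
  shows "iter_deriv m j f x vs = iter_deriv m j g x vs"
  using assms(2,3)
proof (induction j arbitrary: x vs)
  case (Suc j)
  have "frechet_derivative (\<lambda>y. iter_deriv m j f y (tl vs)) (at x within half_space m)
      = frechet_derivative (\<lambda>y. iter_deriv m j g y (tl vs)) (at x within half_space m)"
    by (rule frechet_derivative_openin_cong(1)[OF S Suc.prems(2)]) (use Suc in blast)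
  then show ?case by simp
qed simp

text \<open>\<open>frechet_derivative\<close> is linear in the map only where the map is
  differentiable; class \<open>k\<close> ensures this for all derivatives below order
  \<open>k\<close>. Serves to expand the direction of the first differentiation in the
  basis.\<close>

lemma iter_deriv_linear_combination:
  fixes f :: "'i \<Rightarrow> ('m::{finite,linorder}) eucl_space \<Rightarrow> ('n::finite) eucl_space"
  assumes S: "openin (top_of_set HS) S" and f: "\<And>i. i \<in> I \<Longrightarrow> Ck1_class k S (f i)"
    and "j \<le> k" "length vs = j" "x \<in> S"
  shows "iter_deriv CARD('m) j (\<lambda>y. \<Sum>i\<in>I. c i *\<^sub>R f i y) x vs = (\<Sum>i\<in>I. c i *\<^sub>R iter_deriv CARD('m) j (f i) x vs)"
  using assms(3-5)
proof (induction j arbitrary: x vs)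
  case (Suc j)
  have l: "length (tl vs) = j" using Suc.prems by simp
  have "frechet_derivative (\<lambda>y. iter_deriv CARD('m) j (\<lambda>y. \<Sum>i\<in>I. c i *\<^sub>R f i y) y (tl vs)) (at x within HS)
    = deriv_HS (\<lambda>y. \<Sum>i\<in>I. c i *\<^sub>R iter_deriv CARD('m) j (f i) y (tl vs)) x"
    by (rule frechet_derivative_openin_cong(1)[OF S Suc.prems(3)]) (use Suc l in auto)
  also have "\<dots> = (\<lambda>v. \<Sum>i\<in>I. c i *\<^sub>R deriv_HS (\<lambda>y. iter_deriv CARD('m) j (f i) y (tl vs)) x v)"
  proof (rule deriv_HS_eqI)
    show "((\<lambda>y. \<Sum>i\<in>I. c i *\<^sub>R iter_deriv CARD('m) j (f i) y (tl vs)) has_derivative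
       (\<lambda>v. \<Sum>i\<in>I. c i *\<^sub>R deriv_HS (\<lambda>y. iter_deriv CARD('m) j (f i) y (tl vs)) x v)) (at x within HS)"
    proof (intro has_derivative_sum has_derivative_scaleR_right deriv_HS_works)
      fix i assume "i \<in> I"
      then have "Ck1_class (j + 1) S (f i)" using Ck1_class_mono[OF S Suc.prems(1) f] by (simp only: Suc_eq_plus1)
      from Ck1_class_iter_deriv[OF S this l] Suc.prems(3)
      show "(\<lambda>y. iter_deriv CARD('m) j (f i) y (tl vs)) differentiable (at x within HS)" by simp
    qed
    show "x \<in> HS" using Suc.prems(3) openin_imp_subset[OF S] by blast
  qed
  finally show ?case by simp
qed simp

lemma Ck1_class_imp_Ck_on:
  fixes g :: "('m::{finite,linorder}) eucl_space \<Rightarrow> ('n::finite) eucl_space"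
  assumes S: "openin (top_of_set HS) S" and g: "Ck1_class k S g"
  shows "Ck_on CARD('m) k g S"
  unfolding Ck_on_def
proof (intro conjI allI impI ballI)
  fix j and vs :: "'m eucl_space list" and x assume *: "j < k" "vs \<in> vector_tuples CARD('m) j" "x \<in> S"
  then obtain l where l: "k = j + Suc l" by (metis less_iff_Suc_add add_Suc_right)
  from Ck1_class_iter_deriv[OF S g[unfolded l]] * show "(\<lambda>y. iter_deriv CARD('m) j g y vs) differentiable (at x within HS)"
    by (auto simp: vector_tuples_full)
next
  fix j and vs :: "'m eucl_space list" assume *: "j \<le> k" "vs \<in> vector_tuples CARD('m) j"
  then obtain l where l: "k = j + l" using le_Suc_ex by blast
  from Ck1_class_iter_deriv[OF S g[unfolded l]] * show "continuous_on S (\<lambda>y. iter_deriv CARD('m) j g y vs)"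
    by (intro locally_lipschitz_on_imp_continuous_on Ck1_class_lipschitz[OF S]) (auto simp: vector_tuples_full)
qed

text \<open>The operator norm demands one radius and one constant for all tuples of vectors in the
  unit ball. Expanding the last vector in the basis reduces this to finitely many partial
  derivatives: least radius, sum of the constants.\<close>

lemma Ck1_class_uniformly_lipschitz:
  fixes g :: "('m::{finite,linorder}) eucl_space \<Rightarrow> ('n::finite) eucl_space"
  assumes S: "openin (top_of_set HS) S" and "Ck1_class k S g" and x: "x \<in> S"
  shows "\<exists>e>0. \<exists>L\<ge>0. \<forall>vs. length vs = k \<longrightarrow> (\<forall>v\<in>set vs. norm v \<le> 1) \<longrightarrow>
     L-lipschitz_on (S \<inter> ball x e) (\<lambda>y. iter_deriv CARD('m) k g y vs)"
  using assms(2)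
proof (induction k arbitrary: g)
  case 0
  then show ?case using locally_lipschitz_onE[of S g x] x by (auto simp: less_imp_le) (metis less_imp_le)
next
  case (Suc k)
  have "\<exists>e>0. \<exists>L\<ge>0. \<forall>vs. length vs = k \<longrightarrow> (\<forall>v\<in>set vs. norm v \<le> 1) \<longrightarrow>
     L-lipschitz_on (S \<inter> ball x e) (\<lambda>y. iter_deriv CARD('m) k (\<lambda>x. deriv_HS g x i) y vs)" if "i \<in> Basis" for i
    using Suc.prems that by (intro Suc.IH) auto
  then obtain e L where eL: "\<And>i. i \<in> Basis \<Longrightarrow> e i > 0" "\<And>i. i \<in> Basis \<Longrightarrow> L i \<ge> 0"
    "\<And>i vs. i \<in> Basis \<Longrightarrow> length vs = k \<Longrightarrow> (\<And>v. v \<in> set vs \<Longrightarrow> norm v \<le> 1) \<Longrightarrow>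
     (L i)-lipschitz_on (S \<inter> ball x (e i)) (\<lambda>y. iter_deriv CARD('m) k (\<lambda>x. deriv_HS g x i) y vs)"
    by metis
  define r where "r = Min (e ` Basis)"
  have r: "r > 0" unfolding r_def using eL(1) by (subst Min_gr_iff) auto
  have re: "r \<le> e i" if "i \<in> Basis" for i unfolding r_def using that by simp
  have "(\<Sum>i\<in>Basis. L i)-lipschitz_on (S \<inter> ball x r) (\<lambda>y. iter_deriv CARD('m) (Suc k) g y vs)"
    if vs: "length vs = Suc k" "\<And>v. v \<in> set vs \<Longrightarrow> norm v \<le> 1" for vs :: "'m eucl_space list"
  proof (rule lipschitz_onI)
    show "(\<Sum>i\<in>Basis. L i) \<ge> 0" using eL(2) by (rule sum_nonneg)
    obtain ws v where ws: "vs = ws @ [v]" "length ws = k" using vs(1) by (metis length_Suc_conv_rev)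
    have v: "norm v \<le> 1" and ws1: "\<And>v. v \<in> set ws \<Longrightarrow> norm v \<le> 1" using vs(2) by (auto simp: ws(1))
    let ?D = "\<lambda>i y. iter_deriv CARD('m) k (\<lambda>x. deriv_HS g x i) y ws"
    have eq: "iter_deriv CARD('m) (Suc k) g y vs = (\<Sum>i\<in>Basis. (v \<bullet> i) *\<^sub>R ?D i y)" if y: "y \<in> S" for y
    proof -
      have "iter_deriv CARD('m) (Suc k) g y vs = iter_deriv CARD('m) k (\<lambda>x. deriv_HS g x v) y ws"
        unfolding ws(1) iter_deriv_snoc[OF ws(2)] ..
      also have "\<dots> = iter_deriv CARD('m) k (\<lambda>x. \<Sum>i\<in>Basis. (v \<bullet> i) *\<^sub>R deriv_HS g x i) y ws"
        using Suc.prems y by (intro iter_deriv_openin_cong[OF S] deriv_HS_expand) auto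
      also have "\<dots> = (\<Sum>i\<in>Basis. (v \<bullet> i) *\<^sub>R ?D i y)"
        using Suc.prems y ws(2) by (intro iter_deriv_linear_combination[OF S]) auto
      finally show ?thesis .
    qed
    fix y z assume yz: "y \<in> S \<inter> ball x r" "z \<in> S \<inter> ball x r"
    have "dist (iter_deriv CARD('m) (Suc k) g y vs) (iter_deriv CARD('m) (Suc k) g z vs)
       = norm (\<Sum>i\<in>Basis. (v \<bullet> i) *\<^sub>R (?D i y - ?D i z))"
      using yz eq by (simp add: dist_norm sum_subtractf scaleR_diff_right del: iter_deriv.simps)
    also have "\<dots> \<le> (\<Sum>i\<in>Basis. L i * dist y z)"
    proof (rule sum_norm_le)
      fix i :: "'m eucl_space" assume i: "i \<in> Basis"
      have "norm (?D i y - ?D i z) \<le> L i * dist y z"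
        using lipschitz_onD[OF eL(3)[OF i ws(2) ws1], of y z] yz re[OF i] by (auto simp: dist_norm)
      moreover have "\<bar>v \<bullet> i\<bar> \<le> 1" using Basis_le_norm[OF i, of v] v by linarith
      ultimately show "norm ((v \<bullet> i) *\<^sub>R (?D i y - ?D i z)) \<le> L i * dist y z"
        using mult_mono[of "\<bar>v \<bullet> i\<bar>" 1 "norm (?D i y - ?D i z)" "L i * dist y z"] by simp
    qed
    finally show "dist (iter_deriv CARD('m) (Suc k) g y vs) (iter_deriv CARD('m) (Suc k) g z vs) \<le> (\<Sum>i\<in>Basis. L i) * dist y z"
      by (simp add: sum_distrib_right)
  qed
  then show ?case using r eL(2) by (intro exI[of _ r] conjI exI[of _ "\<Sum>i\<in>Basis. L i"]) (auto intro: sum_nonneg)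
qed

lemma Ck1_class_imp_deriv_locally_Lipschitz_on:
  fixes g :: "('m::{finite,linorder}) eucl_space \<Rightarrow> ('n::finite) eucl_space"
  assumes S: "openin (top_of_set HS) S" and g: "Ck1_class k S g"
  shows "deriv_locally_Lipschitz_on CARD('m) k g S"
  unfolding deriv_locally_Lipschitz_on_def
proof
  fix x assume x: "x \<in> S"
  obtain e L where e: "e > 0" "L \<ge> 0" "\<And>vs. length vs = k \<Longrightarrow> (\<And>v. v \<in> set vs \<Longrightarrow> norm v \<le> 1) \<Longrightarrow>
     L-lipschitz_on (S \<inter> ball x e) (\<lambda>y. iter_deriv CARD('m) k g y vs)"
    using Ck1_class_uniformly_lipschitz[OF S g x] by metis
  show "\<exists>W L. open W \<and> x \<in> W \<and> 0 \<le> L \<and> (\<forall>y\<in>W \<inter> S. \<forall>z\<in>W \<inter> S.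
      multi_onorm CARD('m) k (\<lambda>vs. iter_deriv CARD('m) k g y vs - iter_deriv CARD('m) k g z vs) \<le> ennreal (L * dist y z))"
  proof (intro exI[of _ "ball x e"] exI[of _ L] conjI ballI multi_onorm_leI)
    fix y z and vs :: "'m eucl_space list"
    assume "y \<in> ball x e \<inter> S" "z \<in> ball x e \<inter> S" "vs \<in> vector_tuples CARD('m) k" "\<And>v. v \<in> set vs \<Longrightarrow> norm v \<le> 1"
    then show "norm (iter_deriv CARD('m) k g y vs - iter_deriv CARD('m) k g z vs) \<le> L * dist y z"
      using lipschitz_onD[OF e(3), of vs y z] by (auto simp: vector_tuples_full dist_norm)
  qed (use e in auto)
qed

subsection \<open>Model spaces of arbitrary dimension\<close>

text \<open>At the only point the filter is trivial, so every map is continuous and every bounded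
  linear map is a derivative.\<close>

lemma Ck_on_dim_0:
  assumes "S \<subseteq> half_space 0" shows "Ck_on 0 k g S"
proof -
  have "at x within half_space 0 = bot" "at x within S = bot" if "x \<in> S" for x
    using assms that by (auto simp: half_space_def at_within_eq_bot_iff subset_singleton_iff)
  then show ?thesis
    unfolding Ck_on_def continuous_on_def differentiable_def has_derivative_def
    by (auto intro!: exI[of _ "\<lambda>_. 0"])
qed

lemma deriv_locally_Lipschitz_on_dim_0:
  assumes "S \<subseteq> half_space 0" shows "deriv_locally_Lipschitz_on 0 k g S"
proof -
  have "multi_onorm 0 k (\<lambda>vs. iter_deriv 0 k g y vs - iter_deriv 0 k g z vs) \<le> ennreal (0 * dist y z)"
    if "y \<in> S" "z \<in> S" for y z
    by (rule multi_onorm_leI) (use assms that in \<open>auto simp: half_space_def\<close>)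
  then show ?thesis unfolding deriv_locally_Lipschitz_on_def
    by (intro ballI exI[of _ UNIV] exI[of _ "0::real"] conjI) auto
qed

lemma locally_lipschitz_on_dim_0:
  assumes "S \<subseteq> half_space 0" shows "locally_lipschitz_on S g"
proof -
  have "0-lipschitz_on (S \<inter> ball x 1) g" for x
    using assms by (auto simp: half_space_def lipschitz_on_def)
  then show ?thesis unfolding locally_lipschitz_on_def by (metis zero_less_one)
qed

lemma locally_lipschitz_on_Ck1:
  fixes g :: "('m::{finite,linorder}) eucl_space \<Rightarrow> ('n::finite) eucl_space"
  assumes m: "m = 0 \<or> m = CARD('m)" and S: "openin (top_of_set (half_space m)) S"
    and g: "Ck_on m k g S" "deriv_locally_Lipschitz_on m k g S"
  shows "locally_lipschitz_on S g"
  using m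
proof
  assume "m = 0"
  then show ?thesis using S openin_imp_subset by (intro locally_lipschitz_on_dim_0) blast
next
  assume [simp]: "m = CARD('m)"
  show ?thesis using Ck1_class_lipschitz[of S k g] Ck1_classI[of k g S] S g by simp
qed

lemma Ck_on_mono: "Ck_on m k g S \<Longrightarrow> j \<le> k \<Longrightarrow> Ck_on m j g S"
  by (auto simp: Ck_on_def)

lemma Ck_on_Suc_differentiable:
  assumes "Ck_on m (Suc k) g S" "x \<in> S"
  shows "g differentiable (at x within half_space m)"
proof -
  have "(\<lambda>y. iter_deriv m 0 g y []) differentiable (at x within half_space m)"
    using assms vector_tuples_0 unfolding Ck_on_def by blast
  then show ?thesis by simp
qed

lemma locally_lipschitz_on_Ck_on_Suc:
  fixes g :: "('m::{finite,linorder}) eucl_space \<Rightarrow> ('n::finite) eucl_space"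
  assumes m: "m = 0 \<or> m = CARD('m)" and S: "openin (top_of_set (half_space m)) S" and g: "Ck_on m (Suc k) g S"
  shows "locally_lipschitz_on S g"
  using m
proof
  assume "m = 0"
  then show ?thesis using S openin_imp_subset by (intro locally_lipschitz_on_dim_0) blast
next
  assume m: "m = CARD('m)"
  show ?thesis
  proof (rule locally_lipschitz_on_C1)
    show "g differentiable (at x within HS)" if "x \<in> S" for x
      using Ck_on_Suc_differentiable[OF g that] by (simp add: m)
    fix i :: "'m eucl_space"
    have "[i] \<in> vector_tuples CARD('m) 1" by (simp add: vector_tuples_full)
    moreover have "Ck_on m 1 g S" using g by (rule Ck_on_mono) simp
    ultimately have "continuous_on S (\<lambda>x. iter_deriv m 1 g x [i])" unfolding Ck_on_def m by blast
    then show "continuous_on S (\<lambda>x. deriv_HS g x i)" by (simp add: m)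
  qed (use S m in simp)
qed

text \<open>In dimension 0 even the zero map has an arbitrarily chosen linear map as derivative. The
  value is still 0, because the tuples are taken from the span of the origin.\<close>

lemma iter_deriv_zero:
  fixes x :: "('m::{finite,linorder}) eucl_space"
  assumes m: "m = 0 \<or> m = CARD('m)" and "x \<in> half_space m" "vs \<in> vector_tuples m j"
  shows "iter_deriv m j (\<lambda>_. 0 :: ('n::finite) eucl_space) x vs = 0"
  using assms(2,3)
proof (induction j arbitrary: x vs)
  case (Suc j)
  obtain v ws where vs: "vs = v # ws" using Suc.prems(2) by (auto simp: vector_tuples_def length_Suc_conv)
  have ws: "ws \<in> vector_tuples m j" "v \<in> span (half_space m)" using Suc.prems(2) by (auto simp: vector_tuples_def vs)
  let ?g = "\<lambda>y. iter_deriv m j (\<lambda>_. 0 :: 'n eucl_space) y ws"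
  have der: "(?g has_derivative (\<lambda>_. 0)) (at x within half_space m)"
    by (rule has_derivative_transform[OF Suc.prems(1) _ has_derivative_const[of 0]]) (rule Suc.IH[OF _ ws(1)])
  have "frechet_derivative ?g (at x within half_space m) v = 0"
    using m
  proof
    assume m: "m = 0"
    have "linear (frechet_derivative ?g (at x within half_space m))"
      using der by (intro linear_frechet_derivative) (auto simp: differentiable_def)
    moreover have "v = 0" using ws(2) by (simp add: m half_space_def)
    ultimately show ?thesis by (simp add: linear_0)
  next
    assume m: "m = CARD('m)"
    show ?thesis using deriv_HS_eqI[of ?g "\<lambda>_. 0" x] der Suc.prems(1) by (simp add: m)
  qed
  then show ?case by (simp add: vs)
qed simp

text \<open>Places \<open>f\<close> in its own elementary neighbourhoods.\<close>

lemma Ck1_norm_zero: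
  assumes m: "m = 0 \<or> m = CARD('m)" and K: "K \<subseteq> half_space m"
  shows "Ck1_norm m k K (\<lambda>x :: ('m::{finite,linorder}) eucl_space. 0 :: ('n::finite) eucl_space) = 0"
proof -
  let ?d = "\<lambda>j. iter_deriv m j (\<lambda>_ :: 'm eucl_space. 0 :: 'n eucl_space)"
  have 0: "?d j x vs = 0" if "x \<in> K" "vs \<in> vector_tuples m j" for x vs j
    using iter_deriv_zero[OF m] that K by blast
  have 1: "multi_onorm m j (?d j x) \<le> ennreal 0" if "x \<in> K" for j x
    by (rule multi_onorm_leI) (simp add: 0 that)
  have 2: "multi_onorm m k (\<lambda>vs. ?d k y vs - ?d k x vs) \<le> ennreal 0" if "x \<in> K" "y \<in> K" for x y
    by (rule multi_onorm_leI) (simp add: 0 that)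
  have "Ck1_norm m k K (\<lambda>x :: 'm eucl_space. 0 :: 'n eucl_space) \<le> 0"
    unfolding Ck1_norm_def using 1 2 by (intro max.boundedI SUP_least) auto
  then show ?thesis by simp
qed

text \<open>A bound on the \<open>C\<^sup>k\<^sup>,\<^sup>1\<close> norm controls the \<open>C\<^sup>0\<^sup>,\<^sup>1\<close> norm for every \<open>k\<close>: for positive \<open>k\<close> by the mean
  value inequality, which requires \<open>K\<close> to be convex.\<close>

lemma Ck1_norm_less_imp:
  fixes f h :: "('m::{finite,linorder}) eucl_space \<Rightarrow> ('n::finite) eucl_space"
  assumes m: "m = 0 \<or> m = CARD('m)" and K: "convex K" "K \<subseteq> half_space m"
    and f: "Ck_on m k f S" and h: "Ck_on m k h T" and KS: "K \<subseteq> S" "K \<subseteq> T"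
    and less: "Ck1_norm m k K (\<lambda>x. h x - f x) < ennreal e"
  shows "\<And>x. x \<in> K \<Longrightarrow> norm (h x - f x) \<le> e" "e-lipschitz_on K (\<lambda>x. h x - f x)"
proof -
  have e: "e > 0" using less by (metis ennreal_neg linorder_not_less not_gr_zero zero_order(3) linorder_linear)
  let ?u = "\<lambda>x. h x - f x"
  have le1: "multi_onorm m j (iter_deriv m j ?u x) \<le> ennreal e" if "x \<in> K" "j \<le> k" for x j
  proof -
    have "multi_onorm m j (iter_deriv m j ?u x) \<le> Ck1_norm m k K ?u"
      unfolding Ck1_norm_def
      by (intro max.coboundedI1 order_trans[OF _ SUP_upper[of j]] SUP_upper) (use that in auto)
    with less show ?thesis by simp
  qed
  show "norm (?u x) \<le> e" if "x \<in> K" for x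
    using multi_onorm_leD[OF le1[OF that, of 0], of "[]"] e by (simp add: vector_tuples_0)
  show "e-lipschitz_on K ?u"
  proof (rule lipschitz_onI)
    show "e \<ge> 0" using e by simp
    fix x y assume xy: "x \<in> K" "y \<in> K"
    show "dist (?u x) (?u y) \<le> e * dist x y"
    proof (cases "x = y")
      case False
      show ?thesis
      proof (cases k)
        case 0
        have "multi_onorm m k (\<lambda>vs. iter_deriv m k ?u y vs - iter_deriv m k ?u x vs) / ennreal (norm (x - y))
            \<le> Ck1_norm m k K ?u"
          unfolding Ck1_norm_def
          by (intro max.coboundedI2 order_trans[OF _ SUP_upper[of x]] SUP_upper[of y]) (use xy False in auto)
        with less have le: "multi_onorm m k (\<lambda>vs. iter_deriv m k ?u y vs - iter_deriv m k ?u x vs) / ennreal (norm (x - y)) \<le> ennreal e"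
          by simp
        then have "multi_onorm m k (\<lambda>vs. iter_deriv m k ?u y vs - iter_deriv m k ?u x vs) \<le> ennreal e * ennreal (norm (x - y))"
          using False mult_right_mono[OF le, of "ennreal (norm (x - y))"] by (simp add: ennreal_divide_times)
        then have "multi_onorm m k (\<lambda>vs. iter_deriv m k ?u y vs - iter_deriv m k ?u x vs) \<le> ennreal (e * norm (x - y))"
          using e by (simp add: ennreal_mult)
        from multi_onorm_leD[OF this, of "[]"] e show ?thesis
          by (simp add: 0 vector_tuples_0 dist_norm norm_minus_commute)
      next
        case (Suc l)
        \<comment> \<open>Two distinct points of \<open>K\<close> rule out dimension 0.\<close>
        have m: "m = CARD('m)" using m K(2) xy False by (auto simp: half_space_def subset_singleton_iff)
        have der: "(?u has_derivative deriv_HS ?u z) (at z within HS)" if "z \<in> K" for z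
          using Ck_on_Suc_differentiable[of m l f S z] Ck_on_Suc_differentiable[of m l h T z] f h KS that
          by (intro deriv_HS_works differentiable_diff) (auto simp: m Suc)
        have "norm (?u x - ?u y) \<le> e * norm (x - y)"
        proof (rule differentiable_bound[OF K(1) _ _ xy])
          show "(?u has_derivative deriv_HS ?u z) (at z within K)" if "z \<in> K" for z
            using der[OF that] K(2) unfolding m by (rule has_derivative_subset)
          show "onorm (deriv_HS ?u z) \<le> e" if z: "z \<in> K" for z
          proof (rule onorm_le)
            fix v
            have lin: "linear (deriv_HS ?u z)" using der[OF z] has_derivative_linear by blast
            show "norm (deriv_HS ?u z v) \<le> e * norm v"
            proof (cases "v = 0")
              case False
              \<comment> \<open>\<open>multi_onorm\<close> tests only vectors of norm at most
                1.\<close>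
              define w where "w = (1 / norm v) *\<^sub>R v"
              have w: "norm w = 1" "v = norm v *\<^sub>R w" using False by (auto simp: w_def)
              have "norm (iter_deriv m 1 ?u z [w]) \<le> e"
                by (rule multi_onorm_leD[OF le1[OF z]]) (use Suc e w m in \<open>auto simp: vector_tuples_full\<close>)
              then have "norm (deriv_HS ?u z w) \<le> e" by (simp add: m)
              moreover have "deriv_HS ?u z v = norm v *\<^sub>R deriv_HS ?u z w"
                by (subst w(2)) (rule linear_scale[OF lin])
              ultimately show ?thesis by (simp add: mult_left_mono mult.commute[of e])
            qed (simp add: linear_0[OF lin])
          qed
        qed
        then show ?thesis by (simp add: dist_norm)
      qed
    qed simp
  qed
qed

section \<open>Locally finite covers\<close>

text \<open>\<open>X\<close> is exhausted by compact sets, and each compact shell is covered by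
  finitely many cores whose supports avoid the compact set two stages back. The two set functions
  separate the sets that must cover from those that must be locally finite.\<close>

lemma locally_finite_refinement:
  fixes X :: "'a topology" and core supp :: "'d \<Rightarrow> 'a set"
  assumes X: "locally_compact_space X" "Hausdorff_space X" "second_countable X"
    and ex: "\<And>p W. openin X W \<Longrightarrow> p \<in> W \<Longrightarrow> \<exists>d. P d \<and> p \<in> core d \<and> openin X (core d) \<and> supp d \<subseteq> W"
  shows "\<exists>I. (\<forall>d\<in>I. P d) \<and> topspace X \<subseteq> (\<Union>d\<in>I. core d) \<and>
    (\<forall>p\<in>topspace X. \<exists>W. openin X W \<and> p \<in> W \<and> finite {d \<in> I. supp d \<inter> W \<noteq> {}})"
proof (cases "topspace X = {}")
  case False
  define \<U> where "\<U> = {U. openin X U \<and> (\<exists>K. compactin X K \<and> U \<subseteq> K)}"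
  have "\<Union>\<U> = topspace X"
    using X(1) openin_subset unfolding \<U>_def locally_compact_space_def by fast
  moreover have "Lindelof_space X" using X(3) by (rule second_countable_imp_Lindelof_space)
  ultimately obtain \<V> where \<V>: "countable \<V>" "\<V> \<subseteq> \<U>" "\<Union>\<V> = topspace X"
    unfolding Lindelof_space_def \<U>_def by (metis (no_types, lifting) mem_Collect_eq)
  then have ne: "\<V> \<noteq> {}" using False by (metis Sup_empty)
  define U where "U = from_nat_into \<V>"
  have rU: "range U = \<V>" unfolding U_def using ne \<V>(1) by (rule range_from_nat_into)
  have U: "openin X (U i)" "\<exists>K. compactin X K \<and> U i \<subseteq> K" for i
    using \<V>(2) rU unfolding \<U>_def by blast+
  have cover: "(\<Union>i. U i) = topspace X" using rU \<V>(3) by simp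
  obtain K where K: "\<And>i. compactin X (K i)" "\<And>i. U i \<subseteq> K i" using U(2) by metis
  have "\<exists>m. C \<subseteq> (\<Union>i<m. U i)" if C: "compactin X C" for C
  proof -
    have "C \<subseteq> \<Union>(range U)" using C compactin_subset_topspace cover by blast
    moreover have "\<forall>V\<in>range U. openin X V" using U(1) by blast
    ultimately obtain \<F> where \<F>: "finite \<F>" "\<F> \<subseteq> range U" "C \<subseteq> \<Union>\<F>"
      using C unfolding compactin_def by meson
    obtain J where J: "finite J" "\<F> = U ` J" using finite_subset_image[OF \<F>(1,2)] by blast
    obtain m where "J \<subseteq> {..<m}" using J(1) finite_nat_iff_bounded by blast
    then have "\<Union>(U ` J) \<subseteq> (\<Union>i<m. U i)" by (intro Union_mono image_mono)
    with \<F>(3) have "C \<subseteq> (\<Union>i<m. U i)" unfolding J(2) by (rule order_trans)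
    then show ?thesis ..
  qed
  then obtain m where m: "\<And>C. compactin X C \<Longrightarrow> C \<subseteq> (\<Union>i<m C. U i)" by metis
  \<comment> \<open>\<open>Suc n\<close> makes the stages exhaust the space; \<open>m C\<close>
    makes the next open stage contain the compact set \<open>C\<close>.\<close>
  define stage where "stage n C = max (Suc n) (m C)" for n C
  define E where "E = rec_nat {} (\<lambda>n C. \<Union>i<stage n C. K i)"
  have E: "E 0 = {}" "\<And>n. E (Suc n) = (\<Union>i<stage n (E n). K i)" by (simp_all add: E_def)
  have cE: "compactin X (E n)" for n
    by (cases n) (auto simp: E intro!: compactin_Union K(1))
  define O' where "O' n = (\<Union>i<stage n (E n). U i)" for n
  have O': "openin X (O' n)" "E n \<subseteq> O' n" "O' n \<subseteq> E (Suc n)" for n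
  proof -
    show "openin X (O' n)" unfolding O'_def by (intro openin_Union) (use U(1) in auto)
    have "{..<m (E n)} \<subseteq> {..<stage n (E n)}" by (auto simp: stage_def)
    then show "E n \<subseteq> O' n" unfolding O'_def by (intro order_trans[OF m[OF cE]] UN_mono order_refl)
    show "O' n \<subseteq> E (Suc n)" unfolding O'_def E(2) using K(2) by (intro UN_mono order_refl)
  qed
  have monoE: "E i \<subseteq> E j" if "i \<le> j" for i j
    using that by (induction j rule: dec_induct) (use O' in blast)+
  have ptO: "\<exists>n. p \<in> O' n" if "p \<in> topspace X" for p
  proof -
    obtain i where "p \<in> U i" using \<open>p \<in> topspace X\<close> cover by blast
    then have "p \<in> O' i" unfolding O'_def stage_def by (intro UN_I[of i]) auto
    then show ?thesis ..
  qed
  define Q where "Q n = (\<Union>i<n. O' i)" for n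
  define A where "A n = E (Suc n) - Q n" for n
  \<comment> \<open>Truncated subtraction is harmless: for \<open>n = 0\<close> the removed set is
    \<open>E 0 = {}\<close>.\<close>
  define W where "W n = topspace X - E (n - 1)" for n
  have cA: "compactin X (A n)" for n
  proof -
    have "openin X (Q n)" unfolding Q_def using O'(1) by (intro openin_Union) auto
    then have "compactin X (E (Suc n) \<inter> (topspace X - Q n))"
      by (intro compact_Int_closedin cE) auto
    moreover have "E (Suc n) \<inter> (topspace X - Q n) = A n"
      unfolding A_def using compactin_subset_topspace[OF cE] by blast
    ultimately show ?thesis by simp
  qed
  have W: "openin X (W n)" for n
    unfolding W_def using compactin_imp_closedin[OF X(2) cE] by (simp add: openin_diff)
  have AW: "A n \<subseteq> W n" for n
  proof -
    have "E (n - 1) \<subseteq> Q n"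
      by (cases n) (use E(1) O'(2) in \<open>auto simp: Q_def\<close>)
    then show ?thesis unfolding A_def W_def using compactin_subset_topspace[OF cE] by blast
  qed
  define D where "D n q = (SOME d. P d \<and> q \<in> core d \<and> openin X (core d) \<and> supp d \<subseteq> W n)" for n q
  have D: "P (D n q) \<and> q \<in> core (D n q) \<and> openin X (core (D n q)) \<and> supp (D n q) \<subseteq> W n" if "q \<in> A n" for n q
    unfolding D_def by (rule someI_ex[OF ex[OF W]]) (use AW that in blast)
  have "\<exists>F. finite F \<and> F \<subseteq> A n \<and> A n \<subseteq> (\<Union>q\<in>F. core (D n q))" for n
  proof -
    have "A n \<subseteq> \<Union>((\<lambda>q. core (D n q)) ` A n)" "\<And>V. V \<in> (\<lambda>q. core (D n q)) ` A n \<Longrightarrow> openin X V"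
      using D by auto
    then obtain \<F> where \<F>: "finite \<F>" "\<F> \<subseteq> (\<lambda>q. core (D n q)) ` A n" "A n \<subseteq> \<Union>\<F>"
      using cA[of n] unfolding compactin_def by meson
    obtain F where "F \<subseteq> A n" "finite F" "\<F> = (\<lambda>q. core (D n q)) ` F"
      using finite_subset_image[OF \<F>(1,2)] by blast
    with \<F>(3) show ?thesis by blast
  qed
  then obtain F where F: "\<And>n. finite (F n)" "\<And>n. F n \<subseteq> A n" "\<And>n. A n \<subseteq> (\<Union>q\<in>F n. core (D n q))"
    by metis
  define I where "I = (\<Union>n. D n ` F n)"
  show ?thesis
  proof (intro exI[of _ I] conjI ballI subsetI)
    fix d assume "d \<in> I"
    then obtain n q where "q \<in> F n" "d = D n q" unfolding I_def by (auto elim!: UN_E imageE)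
    then show "P d" using D[of q n] F(2)[of n] by auto
  next
    fix p assume p: "p \<in> topspace X"
    then have "\<exists>n. p \<in> E (Suc n)" using ptO O'(3) by blast
    \<comment> \<open>Minimality keeps \<open>p\<close> out of the earlier sets \<open>O' i\<close>,
      hence in the shell \<open>A n\<close>.\<close>
    define n where "n = (LEAST n. p \<in> E (Suc n))"
    have "p \<in> E (Suc n)" unfolding n_def by (rule LeastI_ex) fact
    moreover have "p \<notin> O' i" if "i < n" for i
      using not_less_Least[of i "\<lambda>n. p \<in> E (Suc n)"] that O'(3)[of i] unfolding n_def by blast
    ultimately have "p \<in> A n" unfolding A_def Q_def by auto
    with F(3)[of n] obtain q where q: "q \<in> F n" "p \<in> core (D n q)" by (auto simp: subset_iff)
    then have "D n q \<in> I" unfolding I_def by (intro UN_I[of n] imageI) auto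
    then show "p \<in> (\<Union>d\<in>I. core d)" using q(2) by (rule UN_I)
  next
    fix p assume "p \<in> topspace X"
    then obtain k where k: "p \<in> O' k" using ptO by blast
    \<comment> \<open>\<open>O' k\<close> lies in \<open>E (Suc k)\<close>, which the supports of
      all levels beyond \<open>Suc k\<close> avoid.\<close>
    have "{d \<in> I. supp d \<inter> O' k \<noteq> {}} \<subseteq> (\<Union>n\<in>{..Suc k}. D n ` F n)"
    proof
      fix d assume "d \<in> {d \<in> I. supp d \<inter> O' k \<noteq> {}}"
      then have "d \<in> I" and meets: "supp d \<inter> O' k \<noteq> {}" by auto
      then obtain n q where nq: "q \<in> F n" "d = D n q" unfolding I_def by (auto elim!: UN_E imageE)
      then have "supp d \<subseteq> W n" using D[of q n] F(2)[of n] by auto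
      have "n \<le> Suc k"
      proof (rule ccontr)
        assume "\<not> n \<le> Suc k"
        then have "E (Suc k) \<subseteq> E (n - 1)" by (intro monoE) auto
        with \<open>supp d \<subseteq> W n\<close> O'(3)[of k] have "supp d \<inter> O' k = {}" unfolding W_def by auto
        with meets show False ..
      qed
      with nq show "d \<in> (\<Union>n\<in>{..Suc k}. D n ` F n)" by (intro UN_I[of n]) auto
    qed
    then have "finite {d \<in> I. supp d \<inter> O' k \<noteq> {}}"
      by (rule finite_subset) (use F(1) in auto)
    with k O'(1) show "\<exists>W. openin X W \<and> p \<in> W \<and> finite {d \<in> I. supp d \<inter> W \<noteq> {}}" by blast
  qed
qed auto

section \<open>Homeomorphisms between open subsets of half-spaces\<close>

lemma half_space_boundary_subset: "half_space_boundary m \<subseteq> half_space m"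
  by (auto simp: half_space_def half_space_boundary_def)

text \<open>The part of \<open>S\<close> in the interior of the half-space is open and nonempty, so
  invariance of dimension applies to it. Such a set is never a single point, which excludes
  \<open>m = 0\<close>.\<close>

lemma half_space_embedding_dim:
  fixes G :: "('n::{finite,linorder}) eucl_space \<Rightarrow> ('m::{finite,linorder}) eucl_space"
  assumes S: "openin (top_of_set (half_space n)) S" "S \<noteq> {}" and n: "n = CARD('n)"
    and G: "continuous_on S G" "inj_on G S" "G ` S \<subseteq> half_space m"
  shows "m \<noteq> 0" "CARD('n) \<le> CARD('m)"
proof -
  obtain O' where O': "open O'" "S = half_space n \<inter> O'" using S(1) by (auto simp: openin_open)
  define S' where "S' = O' \<inter> {x. 0 < x $ Min UNIV}"
  have "open {x :: 'n eucl_space. 0 < x $ Min UNIV}" by (intro open_Collect_less continuous_intros)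
  then have oS': "open S'" using O' unfolding S'_def by blast
  have S'S: "S' \<subseteq> S" unfolding S'_def O' n by (auto simp: HS_eq)
  obtain x where x: "x \<in> S" using S(2) by blast
  obtain e where e: "e > 0" "ball x e \<subseteq> O'" using x O' by (meson IntD2 open_contains_ball)
  \<comment> \<open>A small step in the first coordinate moves \<open>x\<close> off the boundary
    without leaving \<open>O'\<close>.\<close>
  define y where "y = x + (e/2) *\<^sub>R axis (Min UNIV) 1"
  have "y \<in> O'" using e by (intro subsetD[OF e(2)]) (auto simp: y_def dist_norm)
  moreover have "y $ Min UNIV > 0" using x e unfolding O' n by (simp add: y_def HS_eq)
  ultimately have ne: "S' \<noteq> {}" unfolding S'_def by blast
  have G': "continuous_on S' G" "inj_on G S'"
    using G S'S by (auto intro: continuous_on_subset inj_on_subset)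
  show "CARD('n) \<le> CARD('m)"
    using invariance_of_dimension[OF G'(1) oS' G'(2) ne] by simp
  show "m \<noteq> 0"
  proof
    assume "m = 0"
    then have "G ` S' \<subseteq> {0}" using G(3) S'S by (auto simp: half_space_def)
    then have "G u = G v" if "u \<in> S'" "v \<in> S'" for u v
      using that by (metis (no_types, lifting) image_subset_iff singletonD)
    then have "S' = {y}" if "y \<in> S'" for y using G'(2) that unfolding inj_on_def by blast
    then show False using ne oS' not_open_singleton by blast
  qed
qed

text \<open>If \<open>y\<close> were an interior point, invariance of domain would put a full ball
  around \<open>G y\<close> into the image; but points just below a boundary point lie outside the
  half-space.\<close>

lemma half_space_embedding_boundary:
  fixes G :: "('n::{finite,linorder}) eucl_space \<Rightarrow> ('m::{finite,linorder}) eucl_space"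
  assumes S: "openin (top_of_set (half_space n)) S" and y: "y \<in> S" "G y \<in> half_space_boundary m"
    and dims: "n = CARD('n)" "m = CARD('m)" "CARD('m) \<le> CARD('n)"
    and G: "continuous_on S G" "inj_on G S" "G ` S \<subseteq> half_space m"
  shows "y \<in> half_space_boundary n"
proof (rule ccontr)
  assume nb: "y \<notin> half_space_boundary n"
  obtain O' where O': "open O'" "S = half_space n \<inter> O'" using S(1) by (auto simp: openin_open)
  define S' where "S' = O' \<inter> {x. 0 < x $ Min UNIV}"
  have "open {x :: 'n eucl_space. 0 < x $ Min UNIV}" by (intro open_Collect_less continuous_intros)
  then have oS': "open S'" using O' unfolding S'_def by blast
  have S'S: "S' \<subseteq> S" unfolding S'_def O' dims by (auto simp: HS_eq)
  have yS': "y \<in> S'"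
    using nb y(1) unfolding S'_def O' dims half_space_boundary_def by (auto simp: HS_eq less_le)
  have "openin (top_of_set (UNIV :: 'm eucl_space set)) (G ` S')"
    by (rule invariance_of_domain_subspaces[of UNIV])
      (use oS' dims G S'S in \<open>auto intro: continuous_on_subset inj_on_subset\<close>)
  then have "open (G ` S')" by simp
  then obtain e where e: "e > 0" "ball (G y) e \<subseteq> G ` S'" using yS' by (meson image_eqI open_contains_ball)
  define z where "z = G y - (e/2) *\<^sub>R axis (Min UNIV) 1"
  have "z \<in> ball (G y) e" using e by (auto simp: z_def dist_norm)
  then have "z \<in> half_space m" using e G(3) S'S by blast
  moreover have "z $ Min UNIV < 0" using y(2) e dims by (simp add: z_def half_space_boundary_def)
  ultimately show False by (simp add: dims HS_eq)
qed

text \<open>Applied to \<open>F\<close> and to \<open>G\<close>, the embedding lemmas give opposite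
  inequalities of dimensions, and their equality admits the boundary argument in both
  directions.\<close>

lemma half_space_homeomorphism:
  fixes F :: "('m::{finite,linorder}) eucl_space \<Rightarrow> ('n::{finite,linorder}) eucl_space"
  assumes m: "m = 0 \<or> m = CARD('m)" and n: "n = 0 \<or> n = CARD('n)"
    and S: "openin (top_of_set (half_space m)) S" and T: "openin (top_of_set (half_space n)) T"
    and FG: "F ` S = T" "\<And>x. x \<in> S \<Longrightarrow> G (F x) = x" "continuous_on S F" "continuous_on T G"
    and x: "x \<in> S"
  shows "m = 0 \<longleftrightarrow> n = 0" and "m \<noteq> 0 \<Longrightarrow> CARD('m) = CARD('n)"
    and "x \<in> half_space_boundary m \<longleftrightarrow> F x \<in> half_space_boundary n"
proof -
  have SH: "S \<subseteq> half_space m" "T \<subseteq> half_space n" using S T openin_imp_subset by blast+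
  have GT: "G ` T = S" using FG by force
  have ne: "S \<noteq> {}" "T \<noteq> {}" using x FG(1) by blast+
  have inj: "inj_on F S" "inj_on G T" using FG by (auto intro: inj_on_inverseI)
  have 1: "n \<noteq> 0 \<and> CARD('m) \<le> CARD('n)" if "m \<noteq> 0"
    using half_space_embedding_dim[OF S ne(1) _ FG(3) inj(1), of n] that m FG(1) SH by blast
  have 2: "m \<noteq> 0 \<and> CARD('n) \<le> CARD('m)" if "n \<noteq> 0"
    using half_space_embedding_dim[OF T ne(2) _ FG(4) inj(2), of m] that n GT SH by blast
  show mn: "m = 0 \<longleftrightarrow> n = 0" and eq: "m \<noteq> 0 \<Longrightarrow> CARD('m) = CARD('n)"
    using 1 2 by auto
  show "x \<in> half_space_boundary m \<longleftrightarrow> F x \<in> half_space_boundary n"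
  proof (cases "m = 0")
    case False
    then have d: "m = CARD('m)" "n = CARD('n)" "CARD('m) = CARD('n)" using m n mn eq by auto
    have "x \<in> half_space_boundary m" if "F x \<in> half_space_boundary n"
      using half_space_embedding_boundary[OF S x that d(1,2) _ FG(3) inj(1)] d(3) FG(1) SH by simp
    moreover have "F x \<in> half_space_boundary n" if "x \<in> half_space_boundary m"
      using half_space_embedding_boundary[OF T _ _ d(2,1) _ FG(4) inj(2), of "F x"] d(3) FG GT SH x that by auto
    ultimately show ?thesis by blast
  qed (simp add: mn half_space_boundary_def)
qed

section \<open>Lipschitz-small perturbations of homeomorphisms of half-spaces\<close>

text \<open>The variational inequality of the projection is tested with the point obtained from
  \<open>?p\<close> by setting its first coordinate to 0.\<close>

lemma closest_point_half_space_boundary: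
  fixes w :: "('n::{finite,linorder}) eucl_space"
  assumes w: "w \<notin> HS"
  shows "closest_point HS w \<in> half_space_boundary CARD('n)"
proof -
  let ?p = "closest_point HS w" and ?e = "axis (Min UNIV) 1 :: 'n eucl_space"
  have ne: "(HS :: 'n eucl_space set) \<noteq> {}" by (auto simp: HS_eq intro!: exI[of _ 0])
  have p: "?p \<in> HS" by (rule closest_point_in_set[OF closed_half_space ne])
  have "?p - (?p $ Min UNIV) *\<^sub>R ?e \<in> HS" by (simp add: HS_eq)
  from closest_point_dot[OF convex_half_space closed_half_space this, of w]
  have "0 \<le> (?p $ Min UNIV) * ((w - ?p) $ Min UNIV)"
    by (simp add: inner_axis)
  moreover have "(w - ?p) $ Min UNIV < 0" using w p by (simp add: HS_eq)
  ultimately have "?p $ Min UNIV \<le> 0" by (simp add: zero_le_mult_iff)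
  with p show ?thesis by (simp add: HS_eq half_space_boundary_def)
qed

text \<open>For \<open>h = F + u\<close> with \<open>u\<close> small in the \<open>C\<^sup>0\<^sup>,\<^sup>1\<close> norm, the equation \<open>h(x) = z\<close> turns, with \<open>x = G(w)\<close>, into the
  fixed point equation \<open>w = z - u(G(w))\<close>. Precomposing with the projection onto the half-space makes this
  a contraction of a full ball. As \<open>h\<close> preserves the boundary, the first coordinate of \<open>u \<circ> G\<close> vanishes on
  the boundary, which forces the fixed point into the half-space.\<close>

lemma half_space_perturbation:
  fixes F :: "('m::{finite,linorder}) eucl_space \<Rightarrow> ('n::{finite,linorder}) eucl_space"
  assumes n: "n = 0 \<or> n = CARD('n)"
    and S: "openin (top_of_set (half_space m)) S" and T: "openin (top_of_set (half_space n)) T"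
    and FG: "F ` S = T" "\<And>x. x \<in> S \<Longrightarrow> G (F x) = x" "continuous_on S F" "locally_lipschitz_on T G"
    and bd: "\<And>y. y \<in> T \<Longrightarrow> y \<in> half_space_boundary n \<Longrightarrow> G y \<in> half_space_boundary m"
    and x: "x \<in> S" and R: "openin (top_of_set (half_space m)) R" "x \<in> R"
  shows "\<exists>r r2 r1 e c. 0 < r1 \<and> r1 < r2 \<and> r2 < r \<and> 0 < e \<and> 0 < c \<and> cball x r \<inter> half_space m \<subseteq> S \<inter> R \<and>
    (\<forall>h. h ` (cball x r \<inter> half_space m) \<subseteq> half_space n \<longrightarrow>
       h ` (cball x r \<inter> half_space_boundary m) \<subseteq> half_space_boundary n \<longrightarrow>
       (\<forall>y\<in>cball x r \<inter> half_space m. norm (h y - F y) \<le> e) \<longrightarrow>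
       e-lipschitz_on (cball x r \<inter> half_space m) (\<lambda>y. h y - F y) \<longrightarrow>
       (\<forall>a\<in>cball x r \<inter> half_space m. \<forall>b\<in>cball x r \<inter> half_space m. c * dist a b \<le> dist (h a) (h b)) \<and>
       F ` (cball x r1 \<inter> half_space m) \<subseteq> h ` (cball x r \<inter> half_space m))"
proof -
  have SH: "S \<subseteq> half_space m" "T \<subseteq> half_space n" using S T openin_imp_subset by blast+
  have GT: "G ` T = S" using FG by force
  have FGy: "F (G y) = y" if "y \<in> T" for y using that FG by auto
  define y0 where "y0 = F x"
  have y0: "y0 \<in> T" "G y0 = x" "y0 \<in> half_space n" using x FG SH by (auto simp: y0_def)
  obtain d L where dL: "d > 0" "L > 0" "L-lipschitz_on (T \<inter> ball y0 d) G"
    using locally_lipschitz_onE[OF FG(4) y0(1)] by metis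
  obtain a1 where a1: "a1 > 0" "\<And>y. y \<in> S \<Longrightarrow> dist y x < a1 \<Longrightarrow> dist (F y) y0 < d"
    using FG(3) x dL(1) unfolding continuous_on_iff y0_def by blast
  have "openin (top_of_set (half_space m)) (S \<inter> R)" using S R(1) by blast
  then obtain a2 where a2: "a2 > 0" "ball x a2 \<inter> half_space m \<subseteq> S \<inter> R"
    using x R(2) by (metis IntI openin_contains_ball)
  \<comment> \<open>Below \<open>a1\<close> images stay where \<open>G\<close> is
    \<open>L\<close>-Lipschitz, below \<open>a2\<close> points stay in \<open>S \<inter> R\<close>;
    halving passes from open to closed balls.\<close>
  define r where "r = min a1 a2 / 2"
  have r: "r > 0" "r < a1" "r < a2" using a1 a2 by (auto simp: r_def)
  let ?K = "cball x r \<inter> half_space m"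
  have "cball x r \<subseteq> ball x a2" using r by auto
  then have KS: "?K \<subseteq> S \<inter> R" using a2 by blast
  have FK: "F y \<in> T \<inter> ball y0 d" if "y \<in> ?K" for y
    using a1(2)[of y] that KS r FG(1) by (auto simp: dist_commute)
  have lowF: "dist a b \<le> L * dist (F a) (F b)" if "a \<in> ?K" "b \<in> ?K" for a b
    using lipschitz_onD[OF dL(3) FK[OF that(1)] FK[OF that(2)]] FG(2) KS that by (auto simp: subset_iff)
  have contG: "continuous_on T G" using FG(4) by (rule locally_lipschitz_on_imp_continuous_on)
  obtain b1 where b1: "b1 > 0" "\<And>y. y \<in> T \<Longrightarrow> dist y y0 < b1 \<Longrightarrow> dist (G y) x < r"
    using contG y0 r(1) unfolding continuous_on_iff by metis
  obtain b2 where b2: "b2 > 0" "ball y0 b2 \<inter> half_space n \<subseteq> T"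
    using T y0(1) by (auto simp: openin_contains_ball)
  define s where "s = min d (min b1 b2) / 2"
  have s: "s > 0" "s < d" "s < b1" "s < b2" using dL b1 b2 by (auto simp: s_def)
  have sT: "y \<in> T" "G y \<in> ?K" if "y \<in> cball y0 s \<inter> half_space n" for y
  proof -
    show yT: "y \<in> T" using that b2 s by (auto simp: subset_iff)
    then show "G y \<in> ?K" using b1(2)[OF yT] that s GT SH by (auto simp: dist_commute)
  qed
  obtain a3 where a3: "a3 > 0" "\<And>y. y \<in> S \<Longrightarrow> dist y x < a3 \<Longrightarrow> dist (F y) y0 < s / 2"
    using FG(3) x half_gt_zero[OF s(1)] unfolding continuous_on_iff y0_def by meson
  \<comment> \<open>Below \<open>a3\<close> the targets \<open>z\<close> lie within
    \<open>s / 2\<close> of \<open>y0\<close>; the quarter leaves room for \<open>r / 2\<close> as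
    the witness for \<open>r2\<close>.\<close>
  define r1 where "r1 = min (r / 4) (a3 / 2)"
  \<comment> \<open>With \<open>z\<close> within \<open>s / 2\<close> of \<open>y0\<close>, the
    bound \<open>s / 2\<close> keeps the fixed point map inside \<open>cball y0 s\<close>. The bound
    \<open>1 / (2 * L)\<close> gives the contraction factor 1/2 and the slope.\<close>
  define e where "e = min (s / 2) (1 / (2 * L))"
  have r1: "r1 > 0" "r1 < r / 2" "r1 < a3" using r a3 by (auto simp: r1_def)
  have e: "e > 0" "e \<le> s / 2" "e * L \<le> 1 / 2" using s dL by (auto simp: e_def min_def field_simps)
  show ?thesis
  proof (rule exI[of _ r], rule exI[of _ "r / 2"], rule exI[of _ r1], rule exI[of _ e],
      rule exI[of _ "1 / (2 * L)"], intro conjI KS allI ballI impI)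
    fix h assume hH: "h ` ?K \<subseteq> half_space n" and hb: "h ` (cball x r \<inter> half_space_boundary m) \<subseteq> half_space_boundary n"
      and he: "\<forall>y\<in>?K. norm (h y - F y) \<le> e" and hl: "e-lipschitz_on ?K (\<lambda>y. h y - F y)"
    show "1 / (2 * L) * dist a b \<le> dist (h a) (h b)" if ab: "a \<in> ?K" "b \<in> ?K" for a b
    proof -
      have "F a - F b = (h a - h b) - ((h a - F a) - (h b - F b))" by simp
      then have "dist (F a) (F b) \<le> dist (h a) (h b) + dist (h a - F a) (h b - F b)"
        unfolding dist_norm by (metis norm_triangle_ineq4)
      also have "dist (h a - F a) (h b - F b) \<le> e * dist a b" using lipschitz_onD[OF hl ab] .
      finally have "L * dist (F a) (F b) \<le> L * (dist (h a) (h b) + e * dist a b)"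
        using dL(2) by simp
      also have "\<dots> = L * dist (h a) (h b) + (e * L) * dist a b" by (simp add: algebra_simps)
      also have "\<dots> \<le> L * dist (h a) (h b) + 1 / 2 * dist a b"
        using e(3) by (intro add_left_mono mult_right_mono) auto
      finally show ?thesis
        using lowF[OF ab] dL(2) by (simp add: field_simps)
    qed
    show "F ` (cball x r1 \<inter> half_space m) \<subseteq> h ` ?K"
    proof
      fix z assume "z \<in> F ` (cball x r1 \<inter> half_space m)"
      then obtain v where v: "v \<in> cball x r1 \<inter> half_space m" "z = F v" by blast
      have vK: "v \<in> ?K" using v(1) r1 r by auto
      then have vS: "v \<in> S" using KS by blast
      have zs: "dist z y0 < s / 2" using a3(2)[OF vS] v r1 by (auto simp: dist_commute)
      have zT: "z \<in> T" using vS v(2) FG(1) by blast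
      define \<pi> where "\<pi> = closest_point (half_space n :: 'n eucl_space set)"
      have neH: "(half_space n :: 'n eucl_space set) \<noteq> {}" using y0 by blast
      have \<pi>H: "\<pi> w \<in> half_space n" for w
        unfolding \<pi>_def by (rule closest_point_in_set[OF closed_half_space neH])
      have \<pi>l: "dist (\<pi> w) (\<pi> w') \<le> dist w w'" for w w'
        unfolding \<pi>_def by (rule closest_point_lipschitz[OF convex_half_space closed_half_space neH])
      have \<pi>s: "\<pi> w = w" if "w \<in> half_space n" for w
        unfolding \<pi>_def by (rule closest_point_self[OF that])
      have \<pi>B: "\<pi> w \<in> cball y0 s \<inter> half_space n" if "w \<in> cball y0 s" for w
        using \<pi>H \<pi>l[of y0 w] \<pi>s[OF y0(3)] that by auto
      define u where "u y = h y - F y" for y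
      define \<Phi> where "\<Phi> w = z - u (G (\<pi> w))" for w
      have "\<exists>!w\<in>cball y0 s. \<Phi> w = w"
      proof (rule Banach_fix[where c="1/2"])
        show "complete (cball y0 s)" by (simp add: compact_imp_complete)
        show "cball y0 s \<noteq> {}" using s by auto
        show "\<Phi> ` cball y0 s \<subseteq> cball y0 s"
        proof
          fix q assume "q \<in> \<Phi> ` cball y0 s"
          then obtain w where w: "w \<in> cball y0 s" "q = \<Phi> w" by blast
          have "norm (u (G (\<pi> w))) \<le> s / 2" using he sT(2)[OF \<pi>B[OF w(1)]] e(2) unfolding u_def by force
          moreover have "norm (y0 - q) \<le> norm (y0 - z) + norm (u (G (\<pi> w)))"
            unfolding w(2) \<Phi>_def using norm_triangle_ineq[of "y0 - z" "u (G (\<pi> w))"] by (simp add: algebra_simps)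
          ultimately show "q \<in> cball y0 s" using zs by (simp add: dist_norm norm_minus_commute)
        qed
        fix w w' assume w: "w \<in> cball y0 s" "w' \<in> cball y0 s"
        have in_dom: "\<pi> v \<in> T \<inter> ball y0 d" if "v \<in> cball y0 s" for v
          using \<pi>B[OF that] sT(1) s by auto
        have "dist (\<Phi> w) (\<Phi> w') = dist (u (G (\<pi> w))) (u (G (\<pi> w')))"
          by (simp add: \<Phi>_def dist_norm norm_minus_commute)
        also have "\<dots> \<le> e * dist (G (\<pi> w)) (G (\<pi> w'))"
          unfolding u_def by (intro lipschitz_onD[OF hl] sT(2) \<pi>B w)
        also have "\<dots> \<le> e * (L * dist (\<pi> w) (\<pi> w'))"
          using e by (intro mult_left_mono lipschitz_onD[OF dL(3)] in_dom w) auto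
        also have "\<dots> \<le> e * (L * dist w w')"
          using e dL \<pi>l by (intro mult_left_mono) auto
        also have "\<dots> = (e * L) * dist w w'" by simp
        also have "\<dots> \<le> 1 / 2 * dist w w'" using e by (intro mult_right_mono) auto
        finally show "dist (\<Phi> w) (\<Phi> w') \<le> 1 / 2 * dist w w'" .
      qed auto
      then obtain w where w: "w \<in> cball y0 s" "\<Phi> w = w" by blast
      have GK: "G (\<pi> w) \<in> ?K" "\<pi> w \<in> T" using sT \<pi>B[OF w(1)] by blast+
      have w_eq: "w = z - (h (G (\<pi> w)) - \<pi> w)" using w(2) FGy[OF GK(2)] by (simp add: \<Phi>_def u_def)
      have zH: "z \<in> half_space n" using zT SH by blast
      have hH': "h (G (\<pi> w)) \<in> half_space n" using hH GK by blast
      have "w \<in> half_space n"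
        using n
      proof
        \<comment> \<open>Here \<open>z\<close>, \<open>h (G (\<pi> w))\<close> and
          \<open>\<pi> w\<close> are all the origin.\<close>
        assume "n = 0"
        then show ?thesis using w_eq zH hH' \<pi>H[of w] by (simp add: half_space_def)
      next
        assume n: "n = CARD('n)"
        show ?thesis
        proof (rule ccontr)
          assume "w \<notin> half_space n"
          then have b: "\<pi> w \<in> half_space_boundary n"
            unfolding \<pi>_def n by (rule closest_point_half_space_boundary)
          then have "G (\<pi> w) \<in> half_space_boundary m" using bd GK by blast
          then have "h (G (\<pi> w)) \<in> half_space_boundary n" using hb GK by blast
          with b have "w $ Min UNIV = z $ Min UNIV"
            by (subst w_eq) (simp add: n half_space_boundary_def)
          with zH \<open>w \<notin> half_space n\<close> show False by (simp add: n HS_eq)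
        qed
      qed
      then have "z = h (G w)" using w_eq \<pi>s by simp
      moreover have "G w \<in> ?K" using GK(1) \<pi>s[OF \<open>w \<in> half_space n\<close>] by simp
      ultimately show "z \<in> h ` ?K" by blast
    qed
  qed (use r r1 e dL in auto)
qed

section \<open>Charts and coordinate representations\<close>

abbreviation model :: "('a, 'm::{finite,linorder}) manifold \<Rightarrow> 'm eucl_space set" where
  "model M \<equiv> half_space (dimension M)"

abbreviation coord_map ::
    "('n::finite) eucl_space set \<Rightarrow> ('n eucl_space \<Rightarrow> 'b) \<Rightarrow> ('a \<Rightarrow> 'b) \<Rightarrow> ('m::finite eucl_space \<Rightarrow> 'a)
      \<Rightarrow> 'm eucl_space \<Rightarrow> 'n eucl_space" where
  "coord_map V \<psi> f \<phi> \<equiv> \<lambda>x. inv_into V \<psi> (f (\<phi> x))"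

text \<open>Outside this set \<open>inv_into\<close> returns an unspecified value, so
  \<open>coord_map\<close> has its meaning only here.\<close>

abbreviation coord_dom ::
    "('m::finite) eucl_space set \<Rightarrow> ('m eucl_space \<Rightarrow> 'a) \<Rightarrow> ('n::finite) eucl_space set \<Rightarrow> ('n eucl_space \<Rightarrow> 'b)
      \<Rightarrow> ('a \<Rightarrow> 'b) \<Rightarrow> 'm eucl_space set" where
  "coord_dom U \<phi> V \<psi> f \<equiv> {x \<in> U. f (\<phi> x) \<in> \<psi> ` V}"

lemma topological_chartD:
  assumes "topological_chart M (U, \<phi>)"
  shows "openin (top_of_set (model M)) U" "openin (points M) (\<phi> ` U)" "inj_on \<phi> U" "U \<subseteq> model M"
    "\<phi> ` U \<subseteq> topspace (points M)" "continuous_map (top_of_set U) (points M) \<phi>"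
proof -
  show U: "openin (top_of_set (model M)) U" and \<phi>U: "openin (points M) (\<phi> ` U)"
    using assms by (auto simp: topological_chart_def)
  have hom: "homeomorphic_map (top_of_set U) (subtopology (points M) (\<phi> ` U)) \<phi>"
    using assms by (simp add: topological_chart_def)
  show "inj_on \<phi> U" using homeomorphic_imp_injective_map[OF hom] by simp
  show "continuous_map (top_of_set U) (points M) \<phi>"
    using homeomorphic_imp_continuous_map[OF hom] by (rule continuous_map_into_fulltopology)
  show "U \<subseteq> model M" using U by (rule openin_imp_subset)
  show "\<phi> ` U \<subseteq> topspace (points M)" using \<phi>U by (rule openin_subset)
qed

lemma chart_image_openin:
  assumes c: "topological_chart M (U, \<phi>)" and A: "openin (top_of_set (model M)) A" "A \<subseteq> U"
  shows "openin (points M) (\<phi> ` A)"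
proof -
  have "openin (top_of_set U) A" using A by (metis inf.absorb_iff2 openin_subtopology_Int2 subtopology_subtopology
        topological_chartD(4)[OF c])
  moreover have "homeomorphic_map (top_of_set U) (subtopology (points M) (\<phi> ` U)) \<phi>"
    using c by (simp add: topological_chart_def)
  ultimately have "openin (subtopology (points M) (\<phi> ` U)) (\<phi> ` A)"
    by (simp add: homeomorphic_map_openness_eq)
  then show ?thesis using topological_chartD(2)[OF c] by (simp add: openin_open_subtopology)
qed

lemma chart_preimage_openin:
  assumes c: "topological_chart M (U, \<phi>)" and Q: "openin (points M) Q"
  shows "openin (top_of_set (model M)) {x \<in> U. \<phi> x \<in> Q}"
proof -
  have "openin (top_of_set U) {x \<in> topspace (top_of_set U). \<phi> x \<in> Q}"
    using topological_chartD(6)[OF c] Q by (rule openin_continuous_map_preimage)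
  then show ?thesis using topological_chartD(1)[OF c] by (auto intro: openin_trans)
qed

lemma chart_image_compactin:
  assumes c: "topological_chart M (U, \<phi>)" and K: "compact K" "K \<subseteq> U"
  shows "compactin (points M) (\<phi> ` K)"
  using K by (intro image_compactin[OF _ topological_chartD(6)[OF c]]) (simp add: compactin_subtopology)

lemma coord_map_in:
  assumes "x \<in> coord_dom U \<phi> V \<psi> f"
  shows "coord_map V \<psi> f \<phi> x \<in> V" "\<psi> (coord_map V \<psi> f \<phi> x) = f (\<phi> x)"
  using assms by (auto intro: inv_into_into f_inv_into_f)

lemma coord_dom_openin:
  assumes c: "topological_chart M (U, \<phi>)" and d: "topological_chart N (V, \<psi>)"
    and f: "continuous_map (points M) (points N) f"
  shows "openin (top_of_set (model M)) (coord_dom U \<phi> V \<psi> f)"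
proof -
  have "openin (points M) {p \<in> topspace (points M). f p \<in> \<psi> ` V}"
    using f topological_chartD(2)[OF d] by (rule openin_continuous_map_preimage)
  from chart_preimage_openin[OF c this] show ?thesis
    by (rule back_subst[of "openin _"]) (use topological_chartD(5)[OF c] in auto)
qed

lemma coord_map_continuous_on:
  assumes c: "topological_chart M (U, \<phi>)" and d: "topological_chart N (V, \<psi>)"
    and f: "continuous_map (points M) (points N) f"
  shows "continuous_on (coord_dom U \<phi> V \<psi> f) (coord_map V \<psi> f \<phi>)"
  unfolding continuous_on_open_invariant
proof (intro allI impI)
  fix B :: "'d eucl_space set" assume B: "open B"
  have "openin (top_of_set (model N)) (V \<inter> B)"
    using topological_chartD(1)[OF d] B by (rule openin_Int_open)
  from chart_image_openin[OF d this] have "openin (points N) (\<psi> ` (V \<inter> B))" by simp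
  with f have "openin (points M) {p \<in> topspace (points M). f p \<in> \<psi> ` (V \<inter> B)}"
    by (rule openin_continuous_map_preimage)
  from chart_preimage_openin[OF c this]
  have "openin (top_of_set (model M)) {x \<in> U. \<phi> x \<in> topspace (points M) \<and> f (\<phi> x) \<in> \<psi> ` (V \<inter> B)}" by simp
  then obtain A where A: "open A" "{x \<in> U. \<phi> x \<in> topspace (points M) \<and> f (\<phi> x) \<in> \<psi> ` (V \<inter> B)} = model M \<inter> A"
    by (auto simp: openin_open)
  have "A \<inter> coord_dom U \<phi> V \<psi> f = coord_map V \<psi> f \<phi> -` B \<inter> coord_dom U \<phi> V \<psi> f"
  proof (intro equalityI subsetI)
    fix x assume x: "x \<in> A \<inter> coord_dom U \<phi> V \<psi> f"
    then have "x \<in> model M \<inter> A" using topological_chartD(4)[OF c] by blast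
    then obtain y where y: "y \<in> V \<inter> B" "f (\<phi> x) = \<psi> y" using A(2) by blast
    then have "coord_map V \<psi> f \<phi> x = y" using topological_chartD(3)[OF d] by simp
    with x y show "x \<in> coord_map V \<psi> f \<phi> -` B \<inter> coord_dom U \<phi> V \<psi> f" by simp
  next
    fix x assume x: "x \<in> coord_map V \<psi> f \<phi> -` B \<inter> coord_dom U \<phi> V \<psi> f"
    then have x': "x \<in> coord_dom U \<phi> V \<psi> f" "coord_map V \<psi> f \<phi> x \<in> B" by auto
    have "f (\<phi> x) \<in> \<psi> ` (V \<inter> B)"
      using coord_map_in[where x=x and U=U and \<phi>=\<phi> and V=V and \<psi>=\<psi> and f=f, OF x'(1)] x'(2) by (metis IntI image_eqI)
    then have "x \<in> model M \<inter> A" using x' topological_chartD(5)[OF c] unfolding A(2)[symmetric] by blast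
    with x show "x \<in> A \<inter> coord_dom U \<phi> V \<psi> f" by blast
  qed
  with A(1) show "\<exists>A. open A \<and> A \<inter> coord_dom U \<phi> V \<psi> f = coord_map V \<psi> f \<phi> -` B \<inter> coord_dom U \<phi> V \<psi> f"
    by blast
qed

lemma coord_map_inverse:
  assumes c: "topological_chart M (U, \<phi>)" and d: "topological_chart N (V, \<psi>)"
    and gf: "\<And>p. p \<in> topspace (points M) \<Longrightarrow> g (f p) = p" and fg: "\<And>q. q \<in> topspace (points N) \<Longrightarrow> f (g q) = q"
  shows "coord_map V \<psi> f \<phi> ` coord_dom U \<phi> V \<psi> f = coord_dom V \<psi> U \<phi> g"
    and "\<And>x. x \<in> coord_dom U \<phi> V \<psi> f \<Longrightarrow> coord_map U \<phi> g \<psi> (coord_map V \<psi> f \<phi> x) = x"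
proof -
  have inv: "coord_map U \<phi> g \<psi> (coord_map V \<psi> f \<phi> x) = x"
    and dom: "coord_map V \<psi> f \<phi> x \<in> coord_dom V \<psi> U \<phi> g" if x: "x \<in> coord_dom U \<phi> V \<psi> f" for x
  proof -
    have *: "g (f (\<phi> x)) = \<phi> x" using x topological_chartD(5)[OF c] by (intro gf) auto
    with x coord_map_in[where x=x and U=U and \<phi>=\<phi> and V=V and \<psi>=\<psi> and f=f, OF x] show "coord_map U \<phi> g \<psi> (coord_map V \<psi> f \<phi> x) = x"
      using topological_chartD(3)[OF c] by simp
    show "coord_map V \<psi> f \<phi> x \<in> coord_dom V \<psi> U \<phi> g"
      using x coord_map_in[where x=x and U=U and \<phi>=\<phi> and V=V and \<psi>=\<psi> and f=f, OF x] * by auto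
  qed
  then show "\<And>x. x \<in> coord_dom U \<phi> V \<psi> f \<Longrightarrow> coord_map U \<phi> g \<psi> (coord_map V \<psi> f \<phi> x) = x" by blast
  show "coord_map V \<psi> f \<phi> ` coord_dom U \<phi> V \<psi> f = coord_dom V \<psi> U \<phi> g"
  proof (intro equalityI subsetI)
    fix y assume y: "y \<in> coord_dom V \<psi> U \<phi> g"
    let ?x = "coord_map U \<phi> g \<psi> y"
    have x: "?x \<in> U" "\<phi> ?x = g (\<psi> y)" using coord_map_in[where x=y and U=V and \<phi>=\<psi> and V=U and \<psi>=\<phi> and f=g, OF y] by auto
    have fy: "f (g (\<psi> y)) = \<psi> y" using y topological_chartD(5)[OF d] by (intro fg) auto
    have yV: "y \<in> V" using y by simp
    have "f (\<phi> ?x) = \<psi> y" unfolding x(2) by (rule fy)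
    with x(1) yV topological_chartD(3)[OF d] have "?x \<in> coord_dom U \<phi> V \<psi> f" "y = coord_map V \<psi> f \<phi> ?x"
      by simp_all
    then show "y \<in> coord_map V \<psi> f \<phi> ` coord_dom U \<phi> V \<psi> f" by (rule rev_image_eqI)
  qed (use dom in blast)
qed

lemma smooth_manifoldD:
  assumes "smooth_manifold (M :: ('a, 'm::{finite,linorder}) manifold)"
  shows "dimension M = 0 \<or> dimension M = CARD('m)" "Hausdorff_space (points M)" "second_countable (points M)"
    "atlas M \<subseteq> charts M" "\<And>p. p \<in> topspace (points M) \<Longrightarrow> \<exists>U \<phi>. (U, \<phi>) \<in> atlas M \<and> p \<in> \<phi> ` U"
proof -
  show "dimension M = 0 \<or> dimension M = CARD('m)" "Hausdorff_space (points M)"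
    using assms by (auto simp: smooth_manifold_def)
  obtain \<B> where \<B>: "countable \<B>" "openin (points M) = arbitrary union_of (\<lambda>B. B \<in> \<B>)"
    using assms unfolding smooth_manifold_def by blast
  show "second_countable (points M)"
    unfolding second_countable_def
    by (rule exI[of _ \<B>]) (use \<B>(1) \<B>(2)[unfolded openin_topology_base_unique] in blast)
  show "atlas M \<subseteq> charts M" using assms by (auto simp: smooth_manifold_def charts_def)
  fix p assume "p \<in> topspace (points M)"
  then have "p \<in> (\<Union>(U, \<phi>)\<in>atlas M. \<phi> ` U)" using assms unfolding smooth_manifold_def by simp
  then show "\<exists>U \<phi>. (U, \<phi>) \<in> atlas M \<and> p \<in> \<phi> ` U" by blast
qed

lemma charts_topological: "c \<in> charts M \<Longrightarrow> topological_chart M c"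
  by (simp add: charts_def)

lemma smooth_manifold_locally_compact:
  assumes M: "smooth_manifold M"
  shows "locally_compact_space (points M)"
  unfolding locally_compact_space_def
proof
  fix p assume "p \<in> topspace (points M)"
  then obtain U \<phi> x where c: "(U, \<phi>) \<in> atlas M" "x \<in> U" "p = \<phi> x"
    using smooth_manifoldD(5)[OF M] by blast
  have tc: "topological_chart M (U, \<phi>)" using c(1) smooth_manifoldD(4)[OF M] charts_topological by blast
  obtain e where e: "e > 0" "cball x e \<inter> model M \<subseteq> U"
    using topological_chartD(1)[OF tc] c(2) by (auto simp: openin_contains_cball)
  let ?A = "model M \<inter> ball x e" and ?K = "cball x e \<inter> model M"
  have AU: "?A \<subseteq> U" using e(2) by auto
  have "openin (points M) (\<phi> ` ?A)"
    by (intro chart_image_openin[OF tc _ AU] openin_open_Int open_ball)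
  moreover have "compactin (points M) (\<phi> ` ?K)"
    using e(2) by (intro chart_image_compactin[OF tc]) (auto intro: closed_half_space compact_Int_closed)
  moreover have "p \<in> \<phi> ` ?A" using c e(1) topological_chartD(4)[OF tc] by auto
  moreover have "\<phi> ` ?A \<subseteq> \<phi> ` ?K" by auto
  ultimately show "\<exists>U K. openin (points M) U \<and> compactin (points M) K \<and> p \<in> U \<and> U \<subseteq> K" by blast
qed

section \<open>Invariance of the boundary\<close>

lemma coord_boundary_iff:
  fixes M :: "('a, 'm::{finite,linorder}) manifold" and N :: "('b, 'n::{finite,linorder}) manifold"
  assumes dims: "dimension M = 0 \<or> dimension M = CARD('m)" "dimension N = 0 \<or> dimension N = CARD('n)"
    and c: "topological_chart M (U, \<phi>)" and d: "topological_chart N (V, \<psi>)"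
    and f: "continuous_map (points M) (points N) f" and g: "continuous_map (points N) (points M) g"
    and gf: "\<And>p. p \<in> topspace (points M) \<Longrightarrow> g (f p) = p" and fg: "\<And>q. q \<in> topspace (points N) \<Longrightarrow> f (g q) = q"
    and x: "x \<in> coord_dom U \<phi> V \<psi> f"
  shows "x \<in> half_space_boundary (dimension M) \<longleftrightarrow> coord_map V \<psi> f \<phi> x \<in> half_space_boundary (dimension N)"
    and "dimension M = 0 \<longleftrightarrow> dimension N = 0" and "dimension M \<noteq> 0 \<Longrightarrow> CARD('m) = CARD('n)"
  using half_space_homeomorphism[OF dims coord_dom_openin[OF c d f] coord_dom_openin[OF d c g]
      coord_map_inverse[OF c d gf fg] coord_map_continuous_on[OF c d f] coord_map_continuous_on[OF d c g] x]
  by auto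

text \<open>The definition asks for some chart; \<open>coord_boundary_iff\<close> for the identity
  map carries the condition to any other chart.\<close>

lemma manifold_boundary_coord:
  assumes M: "smooth_manifold M" and c: "(U, \<phi>) \<in> charts M" "x \<in> U" "\<phi> x \<in> manifold_boundary M"
  shows "x \<in> half_space_boundary (dimension M)"
proof -
  obtain V \<psi> y where d: "(V, \<psi>) \<in> charts M" "y \<in> V" "y \<in> half_space_boundary (dimension M)" "\<phi> x = \<psi> y"
    using c(3) unfolding manifold_boundary_def by blast
  note tc = charts_topological[OF c(1)] and td = charts_topological[OF d(1)]
  have x: "x \<in> coord_dom U \<phi> V \<psi> (\<lambda>p. p)" using c d by auto
  have "coord_map V \<psi> (\<lambda>p. p) \<phi> x = y" using d topological_chartD(3)[OF td] by simp
  then show ?thesis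
    using coord_boundary_iff(1)[OF smooth_manifoldD(1)[OF M] smooth_manifoldD(1)[OF M] tc td _ _ _ _ x, of "\<lambda>p. p"] d(3)
    by simp
qed

lemma homeomorphism_manifold_boundary:
  assumes M: "smooth_manifold M" and N: "smooth_manifold N"
    and f: "continuous_map (points M) (points N) f" and g: "continuous_map (points N) (points M) g"
    and gf: "\<And>p. p \<in> topspace (points M) \<Longrightarrow> g (f p) = p" and fg: "\<And>q. q \<in> topspace (points N) \<Longrightarrow> f (g q) = q"
  shows "f ` manifold_boundary M \<subseteq> manifold_boundary N"
proof
  fix q assume "q \<in> f ` manifold_boundary M"
  then obtain U \<phi> x where c: "(U, \<phi>) \<in> charts M" "x \<in> U" "x \<in> half_space_boundary (dimension M)" "q = f (\<phi> x)"
    unfolding manifold_boundary_def by blast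
  note tc = charts_topological[OF c(1)]
  have "f (\<phi> x) \<in> topspace (points N)"
    using c(2) topological_chartD(5)[OF tc] f by (auto simp: continuous_map_def)
  then obtain V \<psi> where d: "(V, \<psi>) \<in> atlas N" "f (\<phi> x) \<in> \<psi> ` V" using smooth_manifoldD(5)[OF N] by blast
  have dc: "(V, \<psi>) \<in> charts N" using d(1) smooth_manifoldD(4)[OF N] by blast
  note td = charts_topological[OF dc]
  have x: "x \<in> coord_dom U \<phi> V \<psi> f" using c d by simp
  let ?y = "coord_map V \<psi> f \<phi> x"
  have "?y \<in> half_space_boundary (dimension N)"
    using coord_boundary_iff(1)[OF smooth_manifoldD(1)[OF M] smooth_manifoldD(1)[OF N] tc td f g gf fg x] c(3) by blast
  with coord_map_in[where x=x and U=U and \<phi>=\<phi> and V=V and \<psi>=\<psi> and f=f, OF x] have "q \<in> \<psi> ` (V \<inter> half_space_boundary (dimension N))"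
    unfolding c(4) by (metis IntI image_eqI)
  with dc show "q \<in> manifold_boundary N" unfolding manifold_boundary_def by blast
qed

section \<open>Maps of class \<open>C\<^sup>k\<^sup>,\<^sup>1\<close> between manifolds\<close>

lemma Ck1_mapsD:
  assumes "f \<in> Ck1_maps k M N"
  shows "f \<in> extensional (topspace (points M))" "continuous_map (points M) (points N) f"
    "(U, \<phi>) \<in> charts M \<Longrightarrow> (V, \<psi>) \<in> charts N \<Longrightarrow>
      Ck_on (dimension M) k (coord_map V \<psi> f \<phi>) (coord_dom U \<phi> V \<psi> f)"
    "(U, \<phi>) \<in> charts M \<Longrightarrow> (V, \<psi>) \<in> charts N \<Longrightarrow>
      deriv_locally_Lipschitz_on (dimension M) k (coord_map V \<psi> f \<phi>) (coord_dom U \<phi> V \<psi> f)"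
  using assms by (auto simp: Ck1_maps_def Let_def PiE_def)

lemma Ck1_maps_locally_lipschitz:
  assumes M: "smooth_manifold M" and f: "f \<in> Ck1_maps k M N" and c: "(U, \<phi>) \<in> charts M" and d: "(V, \<psi>) \<in> charts N"
  shows "locally_lipschitz_on (coord_dom U \<phi> V \<psi> f) (coord_map V \<psi> f \<phi>)"
  by (rule locally_lipschitz_on_Ck1[OF smooth_manifoldD(1)[OF M] coord_dom_openin Ck1_mapsD(3,4)[OF f c d]])
    (use charts_topological c d Ck1_mapsD(2)[OF f] in blast)+

lemma smooth_transition_locally_lipschitz:
  assumes M: "smooth_manifold M" and c: "topological_chart M (U, \<phi>)" and d: "topological_chart M (V, \<psi>)"
    and cd: "smooth_transition M (U, \<phi>) (V, \<psi>)"
  shows "locally_lipschitz_on (coord_dom U \<phi> V \<psi> (\<lambda>p. p)) (coord_map V \<psi> (\<lambda>p. p) \<phi>)"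
proof (rule locally_lipschitz_on_Ck_on_Suc[OF smooth_manifoldD(1)[OF M] coord_dom_openin[OF c d]])
  show "Ck_on (dimension M) (Suc 0) (coord_map V \<psi> (\<lambda>p. p) \<phi>) (coord_dom U \<phi> V \<psi> (\<lambda>p. p))"
    using cd by (simp add: smooth_transition_def)
qed simp

lemma locally_lipschitz_onI_local:
  assumes "\<And>y. y \<in> T \<Longrightarrow> \<exists>T0. openin (top_of_set T) T0 \<and> y \<in> T0 \<and> locally_lipschitz_on T0 g"
  shows "locally_lipschitz_on T g"
  unfolding locally_lipschitz_on_def
proof
  fix y assume "y \<in> T"
  then obtain T0 where T0: "openin (top_of_set T) T0" "y \<in> T0" "locally_lipschitz_on T0 g" using assms by blast
  obtain e L where e: "e > 0" "L-lipschitz_on (T0 \<inter> ball y e) g" using locally_lipschitz_onE[OF T0(3,2)] by metis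
  obtain e' where e': "e' > 0" "ball y e' \<inter> T \<subseteq> T0" using T0 by (metis openin_contains_ball)
  have "L-lipschitz_on (T \<inter> ball y (min e e')) g"
    using e(2) by (rule lipschitz_on_subset) (use e' in auto)
  then show "\<exists>e>0. \<exists>L. L-lipschitz_on (T \<inter> ball y e) g"
    using e(1) e'(1) by (intro exI[of _ "min e e'"]) auto
qed

text \<open>Preimages under \<open>h\<close> are not yet known to be open, so the open set
  \<open>O'\<close> mapped into a chart has to be supplied. On it, continuity follows from the
  Lipschitz property in coordinates.\<close>

lemma continuous_map_locally_lipschitz_coord:
  assumes hN: "h \<in> topspace (points N) \<rightarrow> topspace (points M)"
    and loc: "\<And>q. q \<in> topspace (points N) \<Longrightarrow> \<exists>U \<phi> V \<psi> O'. topological_chart M (U, \<phi>) \<and> topological_chart N (V, \<psi>) \<and>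
      openin (points N) O' \<and> q \<in> O' \<and> O' \<subseteq> \<psi> ` V \<and> h ` O' \<subseteq> \<phi> ` U \<and>
      locally_lipschitz_on {y \<in> V. \<psi> y \<in> O'} (coord_map U \<phi> h \<psi>)"
  shows "continuous_map (points N) (points M) h"
  unfolding continuous_map_def
proof (intro conjI allI impI hN)
  fix Q assume Q: "openin (points M) Q"
  show "openin (points N) {q \<in> topspace (points N). h q \<in> Q}"
  proof (subst openin_subopen, intro ballI)
    fix q assume q: "q \<in> {q \<in> topspace (points N). h q \<in> Q}"
    then have "q \<in> topspace (points N)" by simp
    from loc[OF this] obtain U \<phi> V \<psi> O' where c: "topological_chart M (U, \<phi>)" and d: "topological_chart N (V, \<psi>)"
      and O': "openin (points N) O'" "q \<in> O'" "O' \<subseteq> \<psi> ` V" "h ` O' \<subseteq> \<phi> ` U"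
      and lip: "locally_lipschitz_on {y \<in> V. \<psi> y \<in> O'} (coord_map U \<phi> h \<psi>)"
      by (elim exE conjE) (rule that)
    let ?D = "{y \<in> V. \<psi> y \<in> O'}" and ?g = "coord_map U \<phi> h \<psi>"
    have gD: "?g y \<in> U" "\<phi> (?g y) = h (\<psi> y)" if "y \<in> ?D" for y
      using coord_map_in[where x=y and U=V and \<phi>=\<psi> and V=U and \<psi>=\<phi> and f=h] that O'(4) by auto
    have D: "openin (top_of_set (model N)) ?D" using chart_preimage_openin[OF d O'(1)] .
    have "openin (top_of_set (model M)) {x \<in> U. \<phi> x \<in> Q}" using chart_preimage_openin[OF c Q] .
    moreover have "?g \<in> ?D \<rightarrow> model M" using gD topological_chartD(4)[OF c] by auto
    ultimately have "openin (top_of_set ?D) (?D \<inter> ?g -` {x \<in> U. \<phi> x \<in> Q})"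
      using locally_lipschitz_on_imp_continuous_on[OF lip] by (intro continuous_openin_preimage)
    then have "openin (top_of_set (model N)) (?D \<inter> ?g -` {x \<in> U. \<phi> x \<in> Q})" using D by (rule openin_trans)
    then have "openin (points N) (\<psi> ` (?D \<inter> ?g -` {x \<in> U. \<phi> x \<in> Q}))"
      by (rule chart_image_openin[OF d]) auto
    moreover obtain y where y: "y \<in> V" "q = \<psi> y" using O' by blast
    then have "q \<in> \<psi> ` (?D \<inter> ?g -` {x \<in> U. \<phi> x \<in> Q})"
      using q O'(2) gD[of y] by auto
    moreover have "\<psi> ` (?D \<inter> ?g -` {x \<in> U. \<phi> x \<in> Q}) \<subseteq> {q \<in> topspace (points N). h q \<in> Q}"
      using gD(2) topological_chartD(5)[OF d] by fastforce
    ultimately show "\<exists>T. openin (points N) T \<and> q \<in> T \<and> T \<subseteq> {q \<in> topspace (points N). h q \<in> Q}" by blast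
  qed
qed

text \<open>A Lipschitz bound in one pair of charts near each point suffices: transition maps carry
  it to all charts, and \<open>Ck1_class_inverse\<close> raises it to the regularity of
  \<open>h\<close>. The pairs come from the atlases, since \<open>charts\<close> grants smooth
  transitions to atlas charts by definition.\<close>

lemma Ck1_maps_inverse:
  fixes M :: "('a, 'm::{finite,linorder}) manifold" and N :: "('b, 'n::{finite,linorder}) manifold"
  assumes M: "smooth_manifold M" and N: "smooth_manifold N" and h: "h \<in> Ck1_maps k M N"
    and g: "g \<in> topspace (points N) \<rightarrow>\<^sub>E topspace (points M)"
    and gh: "\<And>p. p \<in> topspace (points M) \<Longrightarrow> g (h p) = p" and hg: "\<And>q. q \<in> topspace (points N) \<Longrightarrow> h (g q) = q"
    and loc: "\<And>q. q \<in> topspace (points N) \<Longrightarrow> \<exists>U \<phi> V \<psi> O'. (U, \<phi>) \<in> atlas M \<and> (V, \<psi>) \<in> atlas N \<and>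
      openin (points N) O' \<and> q \<in> O' \<and> O' \<subseteq> \<psi> ` V \<and> g ` O' \<subseteq> \<phi> ` U \<and>
      locally_lipschitz_on {y \<in> V. \<psi> y \<in> O'} (coord_map U \<phi> g \<psi>)"
  shows "g \<in> Ck1_maps k N M"
proof -
  have atlas_top: "c \<in> atlas M \<Longrightarrow> topological_chart M c" "d \<in> atlas N \<Longrightarrow> topological_chart N d" for c d
    using smooth_manifoldD(4)[OF M] smooth_manifoldD(4)[OF N] charts_topological by blast+
  have hc: "continuous_map (points M) (points N) h" using Ck1_mapsD(2)[OF h] .
  have gc: "continuous_map (points N) (points M) g"
  proof (rule continuous_map_locally_lipschitz_coord)
    fix q assume "q \<in> topspace (points N)"
    from loc[OF this] show "\<exists>U \<phi> V \<psi> O'. topological_chart M (U, \<phi>) \<and> topological_chart N (V, \<psi>) \<and>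
      openin (points N) O' \<and> q \<in> O' \<and> O' \<subseteq> \<psi> ` V \<and> g ` O' \<subseteq> \<phi> ` U \<and>
      locally_lipschitz_on {y \<in> V. \<psi> y \<in> O'} (coord_map U \<phi> g \<psi>)"
      using atlas_top by meson
  qed (use g in auto)
  have "Ck_on (dimension N) k (coord_map U \<phi> g \<psi>) (coord_dom V \<psi> U \<phi> g) \<and>
      deriv_locally_Lipschitz_on (dimension N) k (coord_map U \<phi> g \<psi>) (coord_dom V \<psi> U \<phi> g)"
    if d: "(V, \<psi>) \<in> charts N" and c: "(U, \<phi>) \<in> charts M" for U \<phi> V \<psi>
  proof -
    note tc = charts_topological[OF c] and td = charts_topological[OF d]
    let ?T = "coord_dom V \<psi> U \<phi> g" and ?S = "coord_dom U \<phi> V \<psi> h"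
    let ?g = "coord_map U \<phi> g \<psi>" and ?h = "coord_map V \<psi> h \<phi>"
    have T: "openin (top_of_set (model N)) ?T" by (rule coord_dom_openin[OF td tc gc])
    have S: "openin (top_of_set (model M)) ?S" by (rule coord_dom_openin[OF tc td hc])
    note inv = coord_map_inverse[OF tc td gh hg]
    \<comment> \<open>Near \<open>y\<close> the map factors as a transition of \<open>N\<close>, the
      coordinate map in the supplied charts, and a transition of \<open>M\<close>.\<close>
    have lip: "locally_lipschitz_on ?T ?g"
    proof (rule locally_lipschitz_onI_local)
      fix y assume y: "y \<in> ?T"
      then have "\<psi> y \<in> topspace (points N)" using topological_chartD(5)[OF td] by blast
      from loc[OF this] obtain U' \<phi>' V' \<psi>' O' where c': "(U', \<phi>') \<in> atlas M" and d': "(V', \<psi>') \<in> atlas N"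
        and O': "openin (points N) O'" "\<psi> y \<in> O'" "O' \<subseteq> \<psi>' ` V'" "g ` O' \<subseteq> \<phi>' ` U'"
        and lip': "locally_lipschitz_on {y \<in> V'. \<psi>' y \<in> O'} (coord_map U' \<phi>' g \<psi>')"
        by (elim exE conjE) (rule that)
      have sM: "smooth_transition M (U', \<phi>') (U, \<phi>)" using c c' by (auto simp: charts_def)
      have sN: "smooth_transition N (V, \<psi>) (V', \<psi>')" using d d' by (auto simp: charts_def)
      let ?R = "{y \<in> ?T. \<psi> y \<in> O'}"
      have step1: "coord_map V' \<psi>' (\<lambda>p. p) \<psi> y \<in> V'" "\<psi>' (coord_map V' \<psi>' (\<lambda>p. p) \<psi> y) = \<psi> y" if "y \<in> ?R" for y
        using that O'(3) coord_map_in[where x=y and U=V and \<phi>=\<psi> and V=V' and \<psi>=\<psi>' and f="\<lambda>p. p"] by blast+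
      have step2: "coord_map U' \<phi>' g \<psi>' y \<in> U'" "\<phi>' (coord_map U' \<phi>' g \<psi>' y) = g (\<psi>' y)" if "y \<in> {y \<in> V'. \<psi>' y \<in> O'}" for y
        using that O'(4) coord_map_in[where x=y and U=V' and \<phi>=\<psi>' and V=U' and \<psi>=\<phi>' and f=g] by blast+
      have l1: "locally_lipschitz_on ?R (coord_map V' \<psi>' (\<lambda>p. p) \<psi>)"
        using smooth_transition_locally_lipschitz[OF N td atlas_top(2)[OF d'] sN]
        by (rule locally_lipschitz_on_subset) (use O'(3) in auto)
      have l2: "locally_lipschitz_on ?R (\<lambda>y. coord_map U' \<phi>' g \<psi>' (coord_map V' \<psi>' (\<lambda>p. p) \<psi> y))"
        by (rule locally_lipschitz_on_compose[OF lip' l1]) (use step1 in auto)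
      have "locally_lipschitz_on ?R
         (\<lambda>y. coord_map U \<phi> (\<lambda>p. p) \<phi>' (coord_map U' \<phi>' g \<psi>' (coord_map V' \<psi>' (\<lambda>p. p) \<psi> y)))"
      proof (rule locally_lipschitz_on_compose[OF smooth_transition_locally_lipschitz[OF M atlas_top(1)[OF c'] tc sM] l2])
        show "(\<lambda>y. coord_map U' \<phi>' g \<psi>' (coord_map V' \<psi>' (\<lambda>p. p) \<psi> y)) ` ?R \<subseteq> coord_dom U' \<phi>' U \<phi> (\<lambda>p. p)"
        proof
          fix z assume "z \<in> (\<lambda>y. coord_map U' \<phi>' g \<psi>' (coord_map V' \<psi>' (\<lambda>p. p) \<psi> y)) ` ?R"
          then obtain y where y: "y \<in> ?R" "z = coord_map U' \<phi>' g \<psi>' (coord_map V' \<psi>' (\<lambda>p. p) \<psi> y)" by blast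
          have "coord_map V' \<psi>' (\<lambda>p. p) \<psi> y \<in> {y \<in> V'. \<psi>' y \<in> O'}" using step1[OF y(1)] y(1) by simp
          from step2[OF this] step1(2)[OF y(1)] have "z \<in> U'" "\<phi>' z = g (\<psi> y)" unfolding y(2) by simp_all
          then show "z \<in> coord_dom U' \<phi>' U \<phi> (\<lambda>p. p)" using y(1) by simp
        qed
      qed
      moreover have "coord_map U \<phi> (\<lambda>p. p) \<phi>' (coord_map U' \<phi>' g \<psi>' (coord_map V' \<psi>' (\<lambda>p. p) \<psi> y)) = ?g y"
        if y: "y \<in> ?R" for y
      proof -
        have "coord_map V' \<psi>' (\<lambda>p. p) \<psi> y \<in> {y \<in> V'. \<psi>' y \<in> O'}" using step1[OF y] y by simp
        from step2(2)[OF this] step1(2)[OF y] show ?thesis by simp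
      qed
      ultimately have "locally_lipschitz_on ?R ?g"
        by (subst (asm) locally_lipschitz_on_cong)
      moreover have "openin (top_of_set ?T) ?R"
      proof -
        have "openin (top_of_set (model N)) (?T \<inter> {y \<in> V. \<psi> y \<in> O'})"
          using T chart_preimage_openin[OF td O'(1)] by (rule openin_Int)
        moreover have "?T \<inter> {y \<in> V. \<psi> y \<in> O'} = ?R" by blast
        ultimately show ?thesis using T by (metis (no_types, lifting) inf_le1 openin_imp_subset openin_subset_trans)
      qed
      ultimately show "\<exists>T0. openin (top_of_set ?T) T0 \<and> y \<in> T0 \<and> locally_lipschitz_on T0 ?g"
        using y O'(2) by (intro exI[of _ ?R]) auto
    qed
    show ?thesis
    \<comment> \<open>Equality of the dimensions comes from invariance of domain and needs a point
      of the domain.\<close>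
    proof (cases "dimension N = 0 \<or> ?T = {}")
      case True
      then show ?thesis
      proof
        assume 0: "dimension N = 0"
        then have "?T \<subseteq> half_space 0" using T openin_imp_subset by metis
        then show ?thesis unfolding 0 by (intro conjI Ck_on_dim_0 deriv_locally_Lipschitz_on_dim_0)
      next
        assume "?T = {}"
        show ?thesis unfolding \<open>?T = {}\<close> by (simp add: Ck_on_def deriv_locally_Lipschitz_on_def)
      qed
    next
      case False
      then obtain x where x: "x \<in> ?S" using inv(1) by blast
      note b = coord_boundary_iff[OF smooth_manifoldD(1)[OF M] smooth_manifoldD(1)[OF N] tc td hc gc gh hg x]
      have dM: "dimension M = CARD('m)" and dN: "dimension N = CARD('n)" and eq: "CARD('m) = CARD('n)"
        using False b smooth_manifoldD(1)[OF M] smooth_manifoldD(1)[OF N] by auto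
      have "Ck1_class k ?S ?h"
        using Ck1_mapsD(3,4)[OF h c d] unfolding dM by (rule Ck1_classI)
      then have "Ck1_class k ?T ?g"
        using Ck1_class_inverse[OF eq _ _ inv] S T lip unfolding dM dN by blast
      then show ?thesis
        using Ck1_class_imp_Ck_on[of ?T k ?g] Ck1_class_imp_deriv_locally_Lipschitz_on[of ?T k ?g] T
        unfolding dN by blast
    qed
  qed
  then show ?thesis using g gc by (auto simp: Ck1_maps_def Let_def)
qed

section \<open>Elementary neighbourhoods\<close>

lemma elementary_nbhd_bounds:
  fixes M :: "('a, 'm::{finite,linorder}) manifold" and N :: "('b, 'n::{finite,linorder}) manifold"
  assumes M: "smooth_manifold M"
    and f: "f \<in> Ck1_maps k M N" and c: "(U, \<phi>) \<in> charts M" and d: "(V, \<psi>) \<in> charts N"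
    and K: "convex K" "K \<subseteq> U" and fK: "f ` \<phi> ` K \<subseteq> \<psi> ` V"
    and h: "h \<in> elementary_nbhd k M N f (K, (U, \<phi>), (V, \<psi>), \<epsilon>)" and e: "\<epsilon> \<le> ennreal e"
  shows "h \<in> Ck1_maps k M N" "h ` \<phi> ` K \<subseteq> \<psi> ` V"
    "\<And>x. x \<in> K \<Longrightarrow> norm (coord_map V \<psi> h \<phi> x - coord_map V \<psi> f \<phi> x) \<le> e"
    "e-lipschitz_on K (\<lambda>x. coord_map V \<psi> h \<phi> x - coord_map V \<psi> f \<phi> x)"
proof -
  show hk: "h \<in> Ck1_maps k M N" and hK: "h ` \<phi> ` K \<subseteq> \<psi> ` V"
    using h by (auto simp: elementary_nbhd_def image_comp)
  have less: "Ck1_norm (dimension M) k K (\<lambda>x. coord_map V \<psi> h \<phi> x - coord_map V \<psi> f \<phi> x) < ennreal e"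
    using h e by (auto simp: elementary_nbhd_def)
  have KH: "K \<subseteq> model M" using K(2) topological_chartD(4)[OF charts_topological[OF c]] by blast
  have sub: "K \<subseteq> coord_dom U \<phi> V \<psi> f" "K \<subseteq> coord_dom U \<phi> V \<psi> h" using K(2) fK hK by auto
  note bounds = Ck1_norm_less_imp[OF smooth_manifoldD(1)[OF M] K(1) KH Ck1_mapsD(3)[OF f c d] Ck1_mapsD(3)[OF hk c d] sub less]
  show "norm (coord_map V \<psi> h \<phi> x - coord_map V \<psi> f \<phi> x) \<le> e" if "x \<in> K" for x using bounds(1)[OF that] .
  show "e-lipschitz_on K (\<lambda>x. coord_map V \<psi> h \<phi> x - coord_map V \<psi> f \<phi> x)" using bounds(2) .
qed

text \<open>The coordinate image of \<open>C\<close> is compact, so closed balls of some fixed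
  radius around its points stay in the open set describing \<open>O'\<close>; closeness in
  \<open>C\<^sup>0\<close> then suffices. \<open>C\<close> is an arbitrary compact subset because it
  will be a ball with an open set removed.\<close>

lemma elementary_nbhd_compact_open:
  fixes M :: "('a, 'm::{finite,linorder}) manifold" and N :: "('b, 'n::{finite,linorder}) manifold"
  assumes M: "smooth_manifold M"
    and f: "f \<in> Ck1_maps k M N" and c: "(U, \<phi>) \<in> charts M" and d: "(V, \<psi>) \<in> charts N"
    and K: "convex K" "K \<subseteq> U" and fK: "f ` \<phi> ` K \<subseteq> \<psi> ` V"
    and C: "compact C" "C \<subseteq> K" and O': "openin (points N) O'" "f ` \<phi> ` C \<subseteq> O'"
  shows "\<exists>e>0. \<forall>\<epsilon>\<le>ennreal e. \<forall>h\<in>elementary_nbhd k M N f (K, (U, \<phi>), (V, \<psi>), \<epsilon>). h ` \<phi> ` C \<subseteq> O'"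
proof -
  note tc = charts_topological[OF c] and td = charts_topological[OF d]
  let ?F = "coord_map V \<psi> f \<phi>"
  have Cdom: "C \<subseteq> coord_dom U \<phi> V \<psi> f" using C(2) K(2) fK by blast
  have "continuous_on C ?F"
    using coord_map_continuous_on[OF tc td Ck1_mapsD(2)[OF f]] Cdom by (rule continuous_on_subset)
  then have cF: "compact (?F ` C)" using C(1) by (rule compact_continuous_image)
  have "openin (top_of_set (model N)) {y \<in> V. \<psi> y \<in> O'}" by (rule chart_preimage_openin[OF td O'(1)])
  then obtain B where B: "open B" "{y \<in> V. \<psi> y \<in> O'} = model N \<inter> B" by (auto simp: openin_open)
  have "?F ` C \<subseteq> B"
  proof
    fix y assume "y \<in> ?F ` C"
    then obtain x where x: "x \<in> C" "y = ?F x" by blast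
    then have "y \<in> {y \<in> V. \<psi> y \<in> O'}"
      using coord_map_in[where x=x and U=U and \<phi>=\<phi> and V=V and \<psi>=\<psi> and f=f] Cdom O'(2) by auto
    then show "y \<in> B" unfolding B(2) by blast
  qed
  then obtain e where e: "e > 0" "(\<Union>x\<in>?F ` C. cball x e) \<subseteq> B"
    using compact_subset_open_imp_cball_epsilon_subset[OF cF B(1)] by metis
  have "h ` \<phi> ` C \<subseteq> O'" if h: "h \<in> elementary_nbhd k M N f (K, (U, \<phi>), (V, \<psi>), \<epsilon>)" and \<epsilon>: "\<epsilon> \<le> ennreal e" for \<epsilon> h
  proof -
    note b = elementary_nbhd_bounds[OF M f c d K fK h \<epsilon>]
    have "h (\<phi> x) \<in> O'" if x: "x \<in> C" for x
    proof -
      let ?y = "coord_map V \<psi> h \<phi> x"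
      have xd: "x \<in> coord_dom U \<phi> V \<psi> h" using x C(2) K(2) b(2) by blast
      have y: "?y \<in> V" "\<psi> ?y = h (\<phi> x)" using coord_map_in[where x=x and U=U and \<phi>=\<phi> and V=V and \<psi>=\<psi> and f=h, OF xd] by auto
      have "?y \<in> cball (?F x) e" using b(3)[of x] x C(2) by (auto simp: dist_norm norm_minus_commute)
      then have "?y \<in> B" using e(2) x by blast
      moreover have "?y \<in> model N" using y(1) topological_chartD(4)[OF td] by blast
      ultimately have "?y \<in> {y \<in> V. \<psi> y \<in> O'}" unfolding B(2) by blast
      then show ?thesis using y(2) by simp
    qed
    then show ?thesis by blast
  qed
  with e(1) show ?thesis by blast
qed

lemma self_mem_elementary_nbhd:
  fixes M :: "('a, 'm::{finite,linorder}) manifold" and N :: "('b, 'n::{finite,linorder}) manifold"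
  assumes M: "smooth_manifold M" and f: "f \<in> Ck1_maps k M N" and i: "i \<in> elementary_data M N f"
  shows "f \<in> elementary_nbhd k M N f i"
proof -
  obtain K U \<phi> V \<psi> \<epsilon> where i_eq: "i = (K, (U, \<phi>), (V, \<psi>), \<epsilon>)" by (metis prod.exhaust)
  have *: "(U, \<phi>) \<in> charts M" "K \<subseteq> U" "(f \<circ> \<phi>) ` K \<subseteq> \<psi> ` V" "0 < \<epsilon>"
    using i by (auto simp: elementary_data_def i_eq)
  have "K \<subseteq> model M" using *(2) topological_chartD(4)[OF charts_topological[OF *(1)]] by blast
  then have "Ck1_norm (dimension M) k K (\<lambda>x. coord_map V \<psi> f \<phi> x - coord_map V \<psi> f \<phi> x) = 0"
    using Ck1_norm_zero[OF smooth_manifoldD(1)[OF M]] by simp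
  with * f show ?thesis by (simp add: elementary_nbhd_def i_eq)
qed

section \<open>Patches\<close>

text \<open>
  For \<open>h\<close> close to \<open>f\<close>, the image under \<open>h\<close> of the inner ball lies in the image under \<open>f\<close> of the middle one. If
  \<open>h(p) = h(q)\<close> for \<open>p\<close>, \<open>q\<close> in two inner balls, the middle balls therefore meet, and \<open>patch_size_exists\<close>
  then puts \<open>q\<close> into the outer ball around \<open>p\<close>, on which \<open>h\<close> is injective.
\<close>

record ('a, 'b, 'm, 'n) patch =
  src :: "('a, 'm::finite) chart"
  tgt :: "('b, 'n::finite) chart"
  centre :: "'m eucl_space"
  inner_radius :: real
  middle_radius :: real
  outer_radius :: real
  tolerance :: real
  slope :: real

definition coord_ball :: "('a, 'm::{finite,linorder}) manifold \<Rightarrow> ('a, 'b, 'm, 'n::finite) patch \<Rightarrow> real \<Rightarrow> 'm eucl_space set" where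
  "coord_ball M d r = cball (centre d) r \<inter> model M"

definition closed_patch :: "('a, 'm::{finite,linorder}) manifold \<Rightarrow> ('a, 'b, 'm, 'n::finite) patch \<Rightarrow> real \<Rightarrow> 'a set" where
  "closed_patch M d r = snd (src d) ` coord_ball M d r"

definition open_patch :: "('a, 'm::{finite,linorder}) manifold \<Rightarrow> ('a, 'b, 'm, 'n::finite) patch \<Rightarrow> real \<Rightarrow> 'a set" where
  "open_patch M d r = snd (src d) ` (model M \<inter> ball (centre d) r)"

definition patch_data where
  "patch_data M d \<epsilon> = (coord_ball M d (outer_radius d), src d, tgt d, \<epsilon>)"

text \<open>The last clause ranges over all \<open>\<epsilon>\<close> up to the tolerance, so that
  it survives later lowering. It is restricted to boundary-preserving \<open>h\<close>, because a
  map pushing the boundary inwards need not cover the image under \<open>f\<close>.\<close>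

definition good_patch ::
    "nat \<Rightarrow> ('a, 'm::{finite,linorder}) manifold \<Rightarrow> ('b, 'n::{finite,linorder}) manifold \<Rightarrow> ('a \<Rightarrow> 'b)
      \<Rightarrow> ('a, 'b, 'm, 'n) patch \<Rightarrow> bool" where
  "good_patch k M N f d \<longleftrightarrow> (case (src d, tgt d) of ((U, \<phi>), (V, \<psi>)) \<Rightarrow>
     (U, \<phi>) \<in> atlas M \<and> (V, \<psi>) \<in> atlas N \<and>
     0 < inner_radius d \<and> inner_radius d < middle_radius d \<and> middle_radius d < outer_radius d \<and>
     0 < tolerance d \<and> 0 < slope d \<and>
     coord_ball M d (outer_radius d) \<subseteq> U \<and> f ` closed_patch M d (outer_radius d) \<subseteq> \<psi> ` V \<and>
     (\<forall>h\<in>Ck1_boundary_maps k M N. \<forall>\<epsilon>\<le>ennreal (tolerance d).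
        h \<in> elementary_nbhd k M N f (patch_data M d \<epsilon>) \<longrightarrow>
          (\<forall>a\<in>coord_ball M d (outer_radius d). \<forall>b\<in>coord_ball M d (outer_radius d).
             slope d * dist a b \<le> dist (coord_map V \<psi> h \<phi> a) (coord_map V \<psi> h \<phi> b)) \<and>
          f ` closed_patch M d (inner_radius d) \<subseteq> h ` closed_patch M d (outer_radius d)))"

text \<open>This is \<open>half_space_perturbation\<close> for \<open>f\<close> in coordinates, with
  the preimage of \<open>W\<close> as \<open>R\<close> to keep the outer patch inside
  \<open>W\<close>.\<close>

lemma good_patch_exists:
  fixes M :: "('a, 'm::{finite,linorder}) manifold" and N :: "('b, 'n::{finite,linorder}) manifold"
  assumes M: "smooth_manifold M" and N: "smooth_manifold N"
    and f: "f \<in> Ck1_maps k M N" and g: "g \<in> Ck1_maps k N M"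
    and gf: "\<And>p. p \<in> topspace (points M) \<Longrightarrow> g (f p) = p" and fg: "\<And>q. q \<in> topspace (points N) \<Longrightarrow> f (g q) = q"
    and W: "openin (points M) W" "p \<in> W"
  shows "\<exists>d :: ('a, 'b, 'm, 'n) patch. good_patch k M N f d \<and> p \<in> open_patch M d (inner_radius d) \<and>
    openin (points M) (open_patch M d (inner_radius d)) \<and> closed_patch M d (outer_radius d) \<subseteq> W"
proof -
  have fc: "continuous_map (points M) (points N) f" and gc: "continuous_map (points N) (points M) g"
    using Ck1_mapsD(2) f g by blast+
  have p: "p \<in> topspace (points M)" using W openin_subset by blast
  then have fp: "f p \<in> topspace (points N)" using fc by (auto simp: continuous_map_def)
  obtain U \<phi> x where c: "(U, \<phi>) \<in> atlas M" "x \<in> U" "p = \<phi> x" using smooth_manifoldD(5)[OF M p] by blast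
  obtain V \<psi> where d: "(V, \<psi>) \<in> atlas N" "f p \<in> \<psi> ` V" using smooth_manifoldD(5)[OF N fp] by blast
  have cc: "(U, \<phi>) \<in> charts M" and dc: "(V, \<psi>) \<in> charts N"
    using c d smooth_manifoldD(4)[OF M] smooth_manifoldD(4)[OF N] by blast+
  note tc = charts_topological[OF cc] and td = charts_topological[OF dc]
  note dims = smooth_manifoldD(1)[OF M] smooth_manifoldD(1)[OF N]
  let ?S = "coord_dom U \<phi> V \<psi> f" and ?T = "coord_dom V \<psi> U \<phi> g"
  let ?F = "coord_map V \<psi> f \<phi>" and ?G = "coord_map U \<phi> g \<psi>"
  let ?R = "{x \<in> U. \<phi> x \<in> W}"
  have x: "x \<in> ?S" "x \<in> ?R" using c d W by auto
  have bd: "?G y \<in> half_space_boundary (dimension M)" if "y \<in> ?T" "y \<in> half_space_boundary (dimension N)" for y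
    using coord_boundary_iff(1)[OF dims(2,1) td tc gc fc fg gf that(1)] that(2) by blast
  have "\<exists>r r2 r1 e c. 0 < r1 \<and> r1 < r2 \<and> r2 < r \<and> 0 < e \<and> 0 < c \<and> cball x r \<inter> model M \<subseteq> ?S \<inter> ?R \<and>
    (\<forall>h. h ` (cball x r \<inter> model M) \<subseteq> model N \<longrightarrow>
       h ` (cball x r \<inter> half_space_boundary (dimension M)) \<subseteq> half_space_boundary (dimension N) \<longrightarrow>
       (\<forall>y\<in>cball x r \<inter> model M. norm (h y - ?F y) \<le> e) \<longrightarrow>
       e-lipschitz_on (cball x r \<inter> model M) (\<lambda>y. h y - ?F y) \<longrightarrow>
       (\<forall>a\<in>cball x r \<inter> model M. \<forall>b\<in>cball x r \<inter> model M. c * dist a b \<le> dist (h a) (h b)) \<and>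
       ?F ` (cball x r1 \<inter> model M) \<subseteq> h ` (cball x r \<inter> model M))"
    by (rule half_space_perturbation[OF dims(2) coord_dom_openin[OF tc td fc] coord_dom_openin[OF td tc gc]
      coord_map_inverse[OF tc td gf fg] coord_map_continuous_on[OF tc td fc]
      Ck1_maps_locally_lipschitz[OF N g dc cc] bd x(1) chart_preimage_openin[OF tc W(1)] x(2)])
  then obtain r r2 r1 e c where r: "0 < r1" "r1 < r2" "r2 < r" "0 < e" "0 < c" "cball x r \<inter> model M \<subseteq> ?S \<inter> ?R"
    and *: "\<forall>h. h ` (cball x r \<inter> model M) \<subseteq> model N \<longrightarrow>
       h ` (cball x r \<inter> half_space_boundary (dimension M)) \<subseteq> half_space_boundary (dimension N) \<longrightarrow>
       (\<forall>y\<in>cball x r \<inter> model M. norm (h y - ?F y) \<le> e) \<longrightarrow>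
       e-lipschitz_on (cball x r \<inter> model M) (\<lambda>y. h y - ?F y) \<longrightarrow>
       (\<forall>a\<in>cball x r \<inter> model M. \<forall>b\<in>cball x r \<inter> model M. c * dist a b \<le> dist (h a) (h b)) \<and>
       ?F ` (cball x r1 \<inter> model M) \<subseteq> h ` (cball x r \<inter> model M)"
    by (elim exE conjE) (rule that)
  define D :: "('a, 'b, 'm, 'n) patch" where
    "D = \<lparr>src = (U, \<phi>), tgt = (V, \<psi>), centre = x, inner_radius = r1, middle_radius = r2, outer_radius = r,
      tolerance = e, slope = c\<rparr>"
  have D: "src D = (U, \<phi>)" "tgt D = (V, \<psi>)" "centre D = x" "inner_radius D = r1" "middle_radius D = r2"
    "outer_radius D = r" "tolerance D = e" "slope D = c" by (simp_all add: D_def)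
  let ?K = "cball x r \<inter> model M"
  have K: "convex ?K" "?K \<subseteq> U" "f ` \<phi> ` ?K \<subseteq> \<psi> ` V"
    using r(6) by (auto intro!: convex_Int convex_half_space)
  have main: "(\<forall>a\<in>?K. \<forall>b\<in>?K. c * dist a b \<le> dist (coord_map V \<psi> h \<phi> a) (coord_map V \<psi> h \<phi> b)) \<and>
      f ` \<phi> ` (cball x r1 \<inter> model M) \<subseteq> h ` \<phi> ` ?K"
    if h: "h \<in> Ck1_boundary_maps k M N" and \<epsilon>: "\<epsilon> \<le> ennreal e"
      and hn: "h \<in> elementary_nbhd k M N f (?K, (U, \<phi>), (V, \<psi>), \<epsilon>)" for h \<epsilon>
  proof -
    let ?h = "coord_map V \<psi> h \<phi>"
    note b = elementary_nbhd_bounds[OF M f cc dc K hn \<epsilon>]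
    have hd: "?h y \<in> V" "\<psi> (?h y) = h (\<phi> y)" if "y \<in> ?K" for y
    proof -
      have "y \<in> coord_dom U \<phi> V \<psi> h" using that b(2) K(2) by blast
      from coord_map_in[where x=y and U=U and \<phi>=\<phi> and V=V and \<psi>=\<psi> and f=h, OF this]
      show "?h y \<in> V" "\<psi> (?h y) = h (\<phi> y)" .
    qed
    have "?h ` ?K \<subseteq> model N" using hd(1) topological_chartD(4)[OF td] by blast
    \<comment> \<open>Since the boundary can be read off in any chart, the global boundary condition
      on \<open>h\<close> becomes one on coordinates.\<close>
    moreover have "?h ` (cball x r \<inter> half_space_boundary (dimension M)) \<subseteq> half_space_boundary (dimension N)"
    proof
      fix z assume "z \<in> ?h ` (cball x r \<inter> half_space_boundary (dimension M))"
      then obtain y where y: "y \<in> cball x r" "y \<in> half_space_boundary (dimension M)" "z = ?h y" by blast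
      have yK: "y \<in> ?K" using y half_space_boundary_subset by blast
      then have "y \<in> U \<inter> half_space_boundary (dimension M)" using y(2) K(2) by blast
      then have "\<phi> y \<in> manifold_boundary M" using cc unfolding manifold_boundary_def by blast
      then have "\<psi> (?h y) \<in> manifold_boundary N" using h hd(2)[OF yK] unfolding Ck1_boundary_maps_def by auto
      with manifold_boundary_coord[OF N dc hd(1)[OF yK]] show "z \<in> half_space_boundary (dimension N)"
        using y(3) by blast
    qed
    ultimately have res: "\<forall>a\<in>?K. \<forall>b\<in>?K. c * dist a b \<le> dist (?h a) (?h b)"
        "?F ` (cball x r1 \<inter> model M) \<subseteq> ?h ` ?K"
      using *[rule_format, of ?h] b(3,4) by blast+
    have "f (\<phi> y) \<in> h ` \<phi> ` ?K" if y: "y \<in> cball x r1 \<inter> model M" for y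
    proof -
      have "y \<in> ?K" using y r by auto
      then have "y \<in> ?S" using r(6) by blast
      then have "f (\<phi> y) = \<psi> (?F y)"
        using coord_map_in[where x=y and U=U and \<phi>=\<phi> and V=V and \<psi>=\<psi> and f=f] by simp
      moreover obtain a where "a \<in> ?K" "?F y = ?h a" using res(2) y by blast
      ultimately show ?thesis using hd(2)[of a] by auto
    qed
    with res(1) show ?thesis by blast
  qed
  have "good_patch k M N f D"
    unfolding good_patch_def closed_patch_def coord_ball_def patch_data_def D
    using c(1) d(1) r K main by simp
  moreover have "p \<in> open_patch M D (inner_radius D)"
    unfolding open_patch_def D using c r(1) topological_chartD(4)[OF tc] by auto
  moreover have "openin (points M) (open_patch M D (inner_radius D))"
    unfolding open_patch_def D snd_conv
  proof (intro chart_image_openin[OF tc] openin_open_Int open_ball)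
    have "model M \<inter> ball x r1 \<subseteq> ?K" using r(2,3) by auto
    then show "model M \<inter> ball x r1 \<subseteq> U" using K(2) by (rule order_trans)
  qed
  moreover have "closed_patch M D (outer_radius D) \<subseteq> W"
    unfolding closed_patch_def coord_ball_def D using r(6) by auto
  ultimately show ?thesis by blast
qed

lemma locally_finite_compactin:
  assumes lf: "\<forall>p\<in>topspace X. \<exists>W. openin X W \<and> p \<in> W \<and> finite {d \<in> I. A d \<inter> W \<noteq> {}}"
    and C: "compactin X C"
  shows "finite {d \<in> I. A d \<inter> C \<noteq> {}}"
proof -
  obtain W where W: "\<And>p. p \<in> topspace X \<Longrightarrow> openin X (W p) \<and> p \<in> W p \<and> finite {d \<in> I. A d \<inter> W p \<noteq> {}}"
    using bchoice[OF lf] by blast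
  have CX: "C \<subseteq> topspace X" using C by (rule compactin_subset_topspace)
  have "\<forall>V\<in>W ` C. openin X V" "C \<subseteq> \<Union>(W ` C)" using W CX by blast+
  then obtain \<F> where \<F>: "finite \<F>" "\<F> \<subseteq> W ` C" "C \<subseteq> \<Union>\<F>"
    using C unfolding compactin_def by meson
  have "{d \<in> I. A d \<inter> C \<noteq> {}} \<subseteq> (\<Union>V\<in>\<F>. {d \<in> I. A d \<inter> V \<noteq> {}})" using \<F>(3) by blast
  moreover have "finite (\<Union>V\<in>\<F>. {d \<in> I. A d \<inter> V \<noteq> {}})"
    using \<F>(1,2) W CX by (intro finite_UN_I) auto
  ultimately show ?thesis by (rule finite_subset)
qed


lemma good_patchD:
  assumes M: "smooth_manifold M" and N: "smooth_manifold N" and good: "good_patch k M N f d"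
    and eq: "src d = (U, \<phi>)" "tgt d = (V, \<psi>)"
  shows "(U, \<phi>) \<in> atlas M" "(V, \<psi>) \<in> atlas N" "(U, \<phi>) \<in> charts M" "(V, \<psi>) \<in> charts N"
    "inner_radius d < middle_radius d" "middle_radius d < outer_radius d" "0 < tolerance d" "0 < slope d"
    "coord_ball M d (outer_radius d) \<subseteq> U" "f ` closed_patch M d (outer_radius d) \<subseteq> \<psi> ` V"
    "\<And>r. r \<le> outer_radius d \<Longrightarrow> coord_ball M d r \<subseteq> coord_ball M d (outer_radius d)"
    "\<And>r. closed_patch M d r = \<phi> ` coord_ball M d r"
    "\<And>r. open_patch M d r = \<phi> ` (model M \<inter> ball (centre d) r)"
    "\<And>r. r \<le> outer_radius d \<Longrightarrow> compactin (points M) (closed_patch M d r)"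
    "\<And>r. r \<le> outer_radius d \<Longrightarrow> openin (points M) (open_patch M d r)"
proof -
  show *: "(U, \<phi>) \<in> atlas M" "(V, \<psi>) \<in> atlas N"
    "inner_radius d < middle_radius d" "middle_radius d < outer_radius d" "0 < tolerance d" "0 < slope d"
    "coord_ball M d (outer_radius d) \<subseteq> U" "f ` closed_patch M d (outer_radius d) \<subseteq> \<psi> ` V"
    using good by (auto simp: good_patch_def eq)
  show charts: "(U, \<phi>) \<in> charts M" "(V, \<psi>) \<in> charts N"
    using * smooth_manifoldD(4)[OF M] smooth_manifoldD(4)[OF N] by blast+
  show cl: "closed_patch M d r = \<phi> ` coord_ball M d r" and op: "open_patch M d r = \<phi> ` (model M \<inter> ball (centre d) r)" for r
    by (simp_all add: closed_patch_def open_patch_def eq)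
  show mono: "coord_ball M d r \<subseteq> coord_ball M d (outer_radius d)" if "r \<le> outer_radius d" for r
    using that by (auto simp: coord_ball_def)
  note tc = charts_topological[OF charts(1)]
  show "compactin (points M) (closed_patch M d r)" if "r \<le> outer_radius d" for r
  proof -
    have "compact (coord_ball M d r)" unfolding coord_ball_def by (intro compact_Int_closed closed_half_space) simp
    then show ?thesis unfolding cl using mono[OF that] *(7) by (intro chart_image_compactin[OF tc]) auto
  qed
  show "openin (points M) (open_patch M d r)" if "r \<le> outer_radius d" for r
  proof -
    have "model M \<inter> ball (centre d) r \<subseteq> coord_ball M d r" by (auto simp: coord_ball_def)
    then show ?thesis unfolding op using mono[OF that] *(7)
      by (intro chart_image_openin[OF tc] openin_open_Int open_ball) auto
  qed
qed

lemma good_patch_nbhdD: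
  assumes good: "good_patch k M N f d" and eq: "src d = (U, \<phi>)" "tgt d = (V, \<psi>)"
    and h: "h \<in> Ck1_boundary_maps k M N" "h \<in> elementary_nbhd k M N f (patch_data M d (ennreal e))"
    and e: "e \<le> tolerance d"
  shows "\<And>a b. a \<in> coord_ball M d (outer_radius d) \<Longrightarrow> b \<in> coord_ball M d (outer_radius d) \<Longrightarrow>
      slope d * dist a b \<le> dist (coord_map V \<psi> h \<phi> a) (coord_map V \<psi> h \<phi> b)"
    and "f ` closed_patch M d (inner_radius d) \<subseteq> h ` closed_patch M d (outer_radius d)"
proof -
  have "\<forall>h\<in>Ck1_boundary_maps k M N. \<forall>\<epsilon>\<le>ennreal (tolerance d).
        h \<in> elementary_nbhd k M N f (patch_data M d \<epsilon>) \<longrightarrow>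
          (\<forall>a\<in>coord_ball M d (outer_radius d). \<forall>b\<in>coord_ball M d (outer_radius d).
             slope d * dist a b \<le> dist (coord_map V \<psi> h \<phi> a) (coord_map V \<psi> h \<phi> b)) \<and>
          f ` closed_patch M d (inner_radius d) \<subseteq> h ` closed_patch M d (outer_radius d)"
    using good by (simp add: good_patch_def eq)
  from this[rule_format, OF h(1) ennreal_leI[OF e] h(2)]
  show "\<And>a b. a \<in> coord_ball M d (outer_radius d) \<Longrightarrow> b \<in> coord_ball M d (outer_radius d) \<Longrightarrow>
      slope d * dist a b \<le> dist (coord_map V \<psi> h \<phi> a) (coord_map V \<psi> h \<phi> b)"
    and "f ` closed_patch M d (inner_radius d) \<subseteq> h ` closed_patch M d (outer_radius d)" by blast+
qed

lemma open_patch_subset: "r \<le> s \<Longrightarrow> open_patch M d r \<subseteq> closed_patch M d s"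
  by (auto simp: open_patch_def closed_patch_def coord_ball_def)

lemma closed_patch_subset: "r < s \<Longrightarrow> closed_patch M d r \<subseteq> open_patch M d s"
  by (auto simp: open_patch_def closed_patch_def coord_ball_def)

text \<open>Both conditions are of compact-open type and hold for \<open>f\<close> itself: the
  closed inner patch lies in the open middle one, and an injective \<open>f\<close> keeps points
  outside the open outer patch of \<open>i\<close> away from the image of its closed middle patch.
  Finiteness of \<open>J\<close> keeps the least tolerance positive.\<close>

lemma patch_size_exists:
  fixes M :: "('a, 'm::{finite,linorder}) manifold" and N :: "('b, 'n::{finite,linorder}) manifold"
    and d :: "('a, 'b, 'm, 'n) patch"
  assumes M: "smooth_manifold M" and N: "smooth_manifold N"
    and f: "f \<in> Ck1_maps k M N" and gc: "continuous_map (points N) (points M) g"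
    and gf: "\<And>p. p \<in> topspace (points M) \<Longrightarrow> g (f p) = p" and fg: "\<And>q. q \<in> topspace (points N) \<Longrightarrow> f (g q) = q"
    and good: "good_patch k M N f d" and goodJ: "\<And>i. i \<in> J \<Longrightarrow> good_patch k M N f i" and J: "finite J"
  shows "\<exists>e>0. e \<le> tolerance d \<and> (\<forall>\<epsilon>\<le>ennreal e. \<forall>h\<in>elementary_nbhd k M N f (patch_data M d \<epsilon>).
    h ` closed_patch M d (inner_radius d) \<subseteq> f ` open_patch M d (middle_radius d) \<and>
    (\<forall>i\<in>J. h ` (closed_patch M d (inner_radius d) - open_patch M i (outer_radius i)) \<inter> f ` closed_patch M i (middle_radius i) = {}))"
proof -
  obtain U \<phi> V \<psi> where eq: "src d = (U, \<phi>)" "tgt d = (V, \<psi>)" by (metis prod.exhaust)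
  note d = good_patchD[OF M N good eq]
  note tc = charts_topological[OF d(3)]
  have fc: "continuous_map (points M) (points N) f" using Ck1_mapsD(2)[OF f] .
  have f_open: "openin (points N) (f ` Q)" if "openin (points M) Q" for Q
  proof -
    have "f ` Q = {q \<in> topspace (points N). g q \<in> Q}"
      using openin_subset[OF that] fc gf fg by (auto simp: continuous_map_def Pi_iff) (metis image_eqI)
    then show ?thesis using openin_continuous_map_preimage[OF gc that] by simp
  qed
  have f_closed: "closedin (points N) (f ` C)" if "compactin (points M) C" for C
    using image_compactin[OF that fc] smooth_manifoldD(2)[OF N] by (rule compactin_imp_closedin[rotated])
  have f_inj: "p = q" if "f p = f q" "p \<in> topspace (points M)" "q \<in> topspace (points M)" for p q
    using that gf by metis
  let ?K = "coord_ball M d (outer_radius d)" and ?C = "coord_ball M d (inner_radius d)"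
  have K: "convex ?K" unfolding coord_ball_def by (intro convex_Int convex_half_space convex_cball)
  have fK: "f ` \<phi> ` ?K \<subseteq> \<psi> ` V" using d(10) unfolding d(12) .
  have pd: "patch_data M d \<epsilon> = (?K, (U, \<phi>), (V, \<psi>), \<epsilon>)" for \<epsilon> by (simp add: patch_data_def eq)
  note co = elementary_nbhd_compact_open[OF M f d(3,4) K d(9) fK]
  have C: "compact ?C" unfolding coord_ball_def by (intro compact_Int_closed closed_half_space) simp
  have CK: "?C \<subseteq> ?K" using d(5,6) by (intro d(11)) simp
  have "f ` \<phi> ` ?C \<subseteq> f ` open_patch M d (middle_radius d)"
    unfolding d(12)[symmetric] by (intro image_mono closed_patch_subset d(5))
  from co[OF C CK f_open[OF d(15)] this] d(6) obtain e1 where e1: "e1 > 0"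
    "\<And>\<epsilon> h. \<epsilon> \<le> ennreal e1 \<Longrightarrow> h \<in> elementary_nbhd k M N f (patch_data M d \<epsilon>) \<Longrightarrow>
        h ` closed_patch M d (inner_radius d) \<subseteq> f ` open_patch M d (middle_radius d)"
    unfolding pd d(12) by (meson less_imp_le)
  have "\<exists>e>0. \<forall>\<epsilon>\<le>ennreal e. \<forall>h\<in>elementary_nbhd k M N f (patch_data M d \<epsilon>).
    h ` (closed_patch M d (inner_radius d) - open_patch M i (outer_radius i)) \<inter> f ` closed_patch M i (middle_radius i) = {}"
    if i: "i \<in> J" for i
  proof -
    obtain U' \<phi>' V' \<psi>' where eq': "src i = (U', \<phi>')" "tgt i = (V', \<psi>')" by (metis prod.exhaust)
    note i = good_patchD[OF M N goodJ[OF i] eq']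
    \<comment> \<open>Compact, as the coordinate ball minus an open set.\<close>
    let ?D = "{x \<in> ?C. \<phi> x \<notin> open_patch M i (outer_radius i)}"
    have "openin (top_of_set (model M)) {x \<in> U. \<phi> x \<in> open_patch M i (outer_radius i)}"
      by (rule chart_preimage_openin[OF tc i(15)]) simp
    then obtain B where B: "open B" "{x \<in> U. \<phi> x \<in> open_patch M i (outer_radius i)} = model M \<inter> B" by (auto simp: openin_open)
    have "\<phi> x \<in> open_patch M i (outer_radius i) \<longleftrightarrow> x \<in> B" if "x \<in> ?C" for x
    proof -
      have "x \<in> U" "x \<in> model M" using that CK d(9) by (auto simp: coord_ball_def)
      moreover have "x \<in> {x \<in> U. \<phi> x \<in> open_patch M i (outer_radius i)} \<longleftrightarrow> x \<in> model M \<inter> B" by (simp only: B(2))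
      ultimately show ?thesis by simp
    qed
    then have "?D = ?C - B" by (simp add: set_diff_eq cong: conj_cong)
    then have cD: "compact ?D" using C B(1) by (simp add: compact_diff)
    have im: "\<phi> ` ?D = closed_patch M d (inner_radius d) - open_patch M i (outer_radius i)"
      unfolding d(12) by blast
    have O': "openin (points N) (topspace (points N) - f ` closed_patch M i (middle_radius i))"
      by (intro openin_diff f_closed i(14) openin_topspace) (use i(6) in simp)
    have top: "closed_patch M d (inner_radius d) \<subseteq> topspace (points M)" "closed_patch M i (middle_radius i) \<subseteq> topspace (points M)"
      using d(14) i(14) d(5,6) i(6) by (intro compactin_subset_topspace; simp)+
    have "f ` \<phi> ` ?D \<subseteq> topspace (points N) - f ` closed_patch M i (middle_radius i)"
    proof
      fix q assume "q \<in> f ` \<phi> ` ?D"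
      then obtain p where p: "p \<in> closed_patch M d (inner_radius d)" "p \<notin> open_patch M i (outer_radius i)" "q = f p"
        unfolding im by blast
      have "f p \<notin> f ` closed_patch M i (middle_radius i)"
      proof
        assume "f p \<in> f ` closed_patch M i (middle_radius i)"
        then obtain p' where p': "p' \<in> closed_patch M i (middle_radius i)" "f p = f p'" by blast
        then have "p = p'" using p(1) top by (intro f_inj) auto
        moreover have "p' \<in> open_patch M i (outer_radius i)"
          by (rule subsetD[OF closed_patch_subset[OF i(6)] p'(1)])
        ultimately show False using p(2) by simp
      qed
      moreover have "f p \<in> topspace (points N)"
        using continuous_map_image_subset_topspace[OF fc] p(1) top(1) by (meson image_subset_iff subsetD)
      ultimately show "q \<in> topspace (points N) - f ` closed_patch M i (middle_radius i)" unfolding p(3) by simp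
    qed
    moreover have "?D \<subseteq> ?K" using CK by blast
    ultimately obtain e where "e > 0" and e: "\<And>\<epsilon> h. \<epsilon> \<le> ennreal e \<Longrightarrow>
        h \<in> elementary_nbhd k M N f (patch_data M d \<epsilon>) \<Longrightarrow>
        h ` \<phi> ` ?D \<subseteq> topspace (points N) - f ` closed_patch M i (middle_radius i)"
      unfolding pd using co[OF cD _ O'] by meson
    show ?thesis
    proof (intro exI[of _ e] conjI allI impI ballI)
      fix \<epsilon> h assume "\<epsilon> \<le> ennreal e" "h \<in> elementary_nbhd k M N f (patch_data M d \<epsilon>)"
      from e[OF this] show "h ` (closed_patch M d (inner_radius d) - open_patch M i (outer_radius i)) \<inter>
          f ` closed_patch M i (middle_radius i) = {}" unfolding im by blast
    qed fact
  qed
  then obtain e2 where e2: "\<And>i. i \<in> J \<Longrightarrow> e2 i > 0"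
    "\<And>i \<epsilon> h. i \<in> J \<Longrightarrow> \<epsilon> \<le> ennreal (e2 i) \<Longrightarrow> h \<in> elementary_nbhd k M N f (patch_data M d \<epsilon>) \<Longrightarrow>
      h ` (closed_patch M d (inner_radius d) - open_patch M i (outer_radius i)) \<inter> f ` closed_patch M i (middle_radius i) = {}"
    by metis
  define e where "e = Min (insert (tolerance d) (insert e1 (e2 ` J)))"
  have fin: "finite (insert (tolerance d) (insert e1 (e2 ` J)))" using J by simp
  have e: "e > 0" "e \<le> tolerance d" "e \<le> e1" "\<And>i. i \<in> J \<Longrightarrow> e \<le> e2 i"
    unfolding e_def using fin e1(1) e2(1) d(7) by (auto simp del: Min_insert intro: Min_le)
  show ?thesis
  proof (intro exI[of _ e] conjI allI impI ballI e(1,2))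
    fix \<epsilon> h assume \<epsilon>: "\<epsilon> \<le> ennreal e" and h: "h \<in> elementary_nbhd k M N f (patch_data M d \<epsilon>)"
    show "h ` closed_patch M d (inner_radius d) \<subseteq> f ` open_patch M d (middle_radius d)"
      using e1(2)[OF _ h] \<epsilon> e(3) by (meson ennreal_leI order_trans)
    fix i assume i: "i \<in> J"
    show "h ` (closed_patch M d (inner_radius d) - open_patch M i (outer_radius i)) \<inter> f ` closed_patch M i (middle_radius i) = {}"
      using e2(2)[OF i _ h] \<epsilon> e(4)[OF i] by (meson ennreal_leI order_trans)
  qed
qed

section \<open>Openness of the set of diffeomorphisms\<close>

lemma Ck1_diffeos_subset_boundary_maps:
  assumes M: "smooth_manifold M" and N: "smooth_manifold N"
  shows "Ck1_diffeos k M N \<subseteq> Ck1_boundary_maps k M N"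
proof
  fix f assume "f \<in> Ck1_diffeos k M N"
  then obtain g where fg: "f \<in> Ck1_maps k M N" "g \<in> Ck1_maps k N M" "\<forall>x\<in>topspace (points M). g (f x) = x"
      "\<forall>y\<in>topspace (points N). f (g y) = y" unfolding Ck1_diffeos_def by blast
  with homeomorphism_manifold_boundary[OF M N Ck1_mapsD(2)[OF fg(1)] Ck1_mapsD(2)[OF fg(2)]]
  show "f \<in> Ck1_boundary_maps k M N" unfolding Ck1_boundary_maps_def by blast
qed


lemma Ck1_diffeos_nbhd:
  fixes M :: "('a, 'm::{finite,linorder}) manifold" and N :: "('b, 'n::{finite,linorder}) manifold"
  assumes M: "smooth_manifold M" and N: "smooth_manifold N" and f_diffeo: "f \<in> Ck1_diffeos k M N"
  shows "\<exists>B. openin (strong_topology k M N) B \<and> f \<in> B \<and> B \<inter> Ck1_boundary_maps k M N \<subseteq> Ck1_diffeos k M N"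
proof -
  obtain g where f: "f \<in> Ck1_maps k M N" and g: "g \<in> Ck1_maps k N M"
    and gf: "\<And>p. p \<in> topspace (points M) \<Longrightarrow> g (f p) = p" and fg: "\<And>q. q \<in> topspace (points N) \<Longrightarrow> f (g q) = q"
    using f_diffeo unfolding Ck1_diffeos_def by blast
  have fc: "continuous_map (points M) (points N) f" and gc: "continuous_map (points N) (points M) g"
    using Ck1_mapsD(2) f g by blast+
  have f_top: "f p \<in> topspace (points N)" if "p \<in> topspace (points M)" for p
    using fc that by (auto simp: continuous_map_def)
  have g_top: "g q \<in> topspace (points M)" if "q \<in> topspace (points N)" for q
    using gc that by (auto simp: continuous_map_def)
  \<comment> \<open>Open inner patches are the cores that cover \<open>M\<close>; closed outer
    patches are the supports, being the compact sets of the elementary neighbourhoods.\<close>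
  have "\<exists>I :: ('a, 'b, 'm, 'n) patch set. (\<forall>d\<in>I. good_patch k M N f d) \<and>
     topspace (points M) \<subseteq> (\<Union>d\<in>I. open_patch M d (inner_radius d)) \<and>
     (\<forall>p\<in>topspace (points M). \<exists>W. openin (points M) W \<and> p \<in> W \<and> finite {d \<in> I. closed_patch M d (outer_radius d) \<inter> W \<noteq> {}})"
    by (rule locally_finite_refinement[OF smooth_manifold_locally_compact[OF M] smooth_manifoldD(2,3)[OF M]
        good_patch_exists[OF M N f g gf fg]])
  then obtain I :: "('a, 'b, 'm, 'n) patch set" where good: "\<And>d. d \<in> I \<Longrightarrow> good_patch k M N f d"
    and cover: "topspace (points M) \<subseteq> (\<Union>d\<in>I. open_patch M d (inner_radius d))"
    and lf: "\<forall>p\<in>topspace (points M). \<exists>W. openin (points M) W \<and> p \<in> W \<and> finite {d \<in> I. closed_patch M d (outer_radius d) \<inter> W \<noteq> {}}"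
    by blast
  have open_closed: "p \<in> closed_patch M d r" if "p \<in> open_patch M d r" for p r and d :: "('a, 'b, 'm, 'n) patch"
    by (rule subsetD[OF open_patch_subset[OF order_refl] that])
  have patch: "inner_radius d < middle_radius d" "middle_radius d < outer_radius d"
    "\<And>r. r \<le> outer_radius d \<Longrightarrow> compactin (points M) (closed_patch M d r)"
    "\<And>r. r \<le> outer_radius d \<Longrightarrow> closed_patch M d r \<subseteq> topspace (points M)" if "d \<in> I" for d
  proof -
    obtain U \<phi> V \<psi> where eq: "src d = (U, \<phi>)" "tgt d = (V, \<psi>)" by (metis prod.exhaust)
    note d = good_patchD[OF M N good[OF that] eq]
    show "inner_radius d < middle_radius d" "middle_radius d < outer_radius d" by (fact d)+
    show "compactin (points M) (closed_patch M d r)" if "r \<le> outer_radius d" for r using d(14)[OF that] .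
    then show "closed_patch M d r \<subseteq> topspace (points M)" if "r \<le> outer_radius d" for r
      using that by (intro compactin_subset_topspace)
  qed
  \<comment> \<open>The patches from which \<open>d\<close> must be kept apart. Their number is
    finite by compactness of the middle patch and local finiteness of the outer ones.\<close>
  define J where "J d = {i \<in> I. closed_patch M i (middle_radius i) \<inter> closed_patch M d (middle_radius d) \<noteq> {}}"
    for d :: "('a, 'b, 'm, 'n) patch"
  have J: "finite (J d)" if "d \<in> I" for d
  proof -
    have "finite {i \<in> I. closed_patch M i (outer_radius i) \<inter> closed_patch M d (middle_radius d) \<noteq> {}}"
      using patch[OF that] by (intro locally_finite_compactin[OF lf]) simp
    moreover have "J d \<subseteq> {i \<in> I. closed_patch M i (outer_radius i) \<inter> closed_patch M d (middle_radius d) \<noteq> {}}"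
    proof
      fix i assume i: "i \<in> J d"
      then have "closed_patch M i (middle_radius i) \<subseteq> closed_patch M i (outer_radius i)"
        using patch(2)[of i] by (auto simp: J_def closed_patch_def coord_ball_def)
      with i show "i \<in> {i \<in> I. closed_patch M i (outer_radius i) \<inter> closed_patch M d (middle_radius d) \<noteq> {}}"
        unfolding J_def by blast
    qed
    ultimately show ?thesis by (rule rev_finite_subset)
  qed
  have "\<exists>e>0. e \<le> tolerance d \<and> (\<forall>\<epsilon>\<le>ennreal e. \<forall>h\<in>elementary_nbhd k M N f (patch_data M d \<epsilon>).
    h ` closed_patch M d (inner_radius d) \<subseteq> f ` open_patch M d (middle_radius d) \<and>
    (\<forall>i\<in>J d. h ` (closed_patch M d (inner_radius d) - open_patch M i (outer_radius i)) \<inter> f ` closed_patch M i (middle_radius i) = {}))"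
    if d: "d \<in> I" for d
    using good J[OF d] d by (intro patch_size_exists[OF M N f gc gf fg]) (auto simp: J_def)
  then obtain e where e: "\<And>d. d \<in> I \<Longrightarrow> e d > 0" "\<And>d. d \<in> I \<Longrightarrow> e d \<le> tolerance d"
    and inside: "\<And>d h. d \<in> I \<Longrightarrow> h \<in> elementary_nbhd k M N f (patch_data M d (ennreal (e d))) \<Longrightarrow>
        h ` closed_patch M d (inner_radius d) \<subseteq> f ` open_patch M d (middle_radius d)"
    and apart: "\<And>d h i. d \<in> I \<Longrightarrow> h \<in> elementary_nbhd k M N f (patch_data M d (ennreal (e d))) \<Longrightarrow> i \<in> J d \<Longrightarrow>
        h ` (closed_patch M d (inner_radius d) - open_patch M i (outer_radius i)) \<inter> f ` closed_patch M i (middle_radius i) = {}"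
    by (metis order_refl)
  define D where "D = (\<lambda>d. patch_data M d (ennreal (e d))) ` I"
  define B where "B = Ck1_maps k M N \<inter> (\<Inter>i\<in>D. elementary_nbhd k M N f i)"
  have D: "D \<subseteq> elementary_data M N f"
  proof
    fix i assume "i \<in> D"
    then obtain d where d: "d \<in> I" "i = patch_data M d (ennreal (e d))" unfolding D_def by blast
    obtain U \<phi> V \<psi> where eq: "src d = (U, \<phi>)" "tgt d = (V, \<psi>)" by (metis prod.exhaust)
    note p = good_patchD[OF M N good[OF d(1)] eq]
    have "compact (coord_ball M d (outer_radius d))" unfolding coord_ball_def by (intro compact_Int_closed closed_half_space) simp
    then show "i \<in> elementary_data M N f"
      using p(3,4,9,10) e(1)[OF d(1)] unfolding d(2) patch_data_def eq p(12) by (simp add: elementary_data_def image_comp)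
  qed
  have "locally_finite_data M D"
    unfolding locally_finite_data_def
  proof
    fix p assume "p \<in> topspace (points M)"
    then obtain W where W: "openin (points M) W" "p \<in> W" "finite {d \<in> I. closed_patch M d (outer_radius d) \<inter> W \<noteq> {}}"
      using lf by blast
    \<comment> \<open>Different patches may yield the same data, which can only reduce the number of
      indices.\<close>
    have "{i \<in> D. case i of (K, (U, \<phi>), _) \<Rightarrow> \<phi> ` K \<inter> W \<noteq> {}}
        \<subseteq> (\<lambda>d. patch_data M d (ennreal (e d))) ` {d \<in> I. closed_patch M d (outer_radius d) \<inter> W \<noteq> {}}"
    proof
      fix i assume i: "i \<in> {i \<in> D. case i of (K, (U, \<phi>), _) \<Rightarrow> \<phi> ` K \<inter> W \<noteq> {}}"
      then obtain d where d: "d \<in> I" "i = patch_data M d (ennreal (e d))" unfolding D_def by blast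
      have "closed_patch M d (outer_radius d) \<inter> W \<noteq> {}"
        using i unfolding d(2) patch_data_def closed_patch_def by (cases "src d") auto
      with d show "i \<in> (\<lambda>d. patch_data M d (ennreal (e d))) ` {d \<in> I. closed_patch M d (outer_radius d) \<inter> W \<noteq> {}}"
        by blast
    qed
    from finite_subset[OF this finite_imageI[OF W(3)]] W(1,2)
    show "\<exists>W. openin (points M) W \<and> p \<in> W \<and> finite {i \<in> D. case i of (K, (U, \<phi>), _) \<Rightarrow> \<phi> ` K \<inter> W \<noteq> {}}"
      by (intro exI[of _ W] conjI)
  qed
  then have "B \<in> strong_basis k M N" using f D unfolding strong_basis_def B_def by blast
  then have "openin (strong_topology k M N) B" unfolding strong_topology_def by (rule topology_generated_by_Basis)
  moreover have "f \<in> B" unfolding B_def using f self_mem_elementary_nbhd[OF M f] D by blast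
  moreover have "B \<inter> Ck1_boundary_maps k M N \<subseteq> Ck1_diffeos k M N"
  proof
    fix h assume hB: "h \<in> B \<inter> Ck1_boundary_maps k M N"
    then have h: "h \<in> Ck1_maps k M N" and nb: "\<And>d. d \<in> I \<Longrightarrow> h \<in> elementary_nbhd k M N f (patch_data M d (ennreal (e d)))"
      unfolding B_def D_def by auto
    have h_top: "h p \<in> topspace (points N)" if "p \<in> topspace (points M)" for p
      using Ck1_mapsD(2)[OF h] that by (auto simp: continuous_map_def)
    have slope: "slope d * dist a b \<le> dist (coord_map V \<psi> h \<phi> a) (coord_map V \<psi> h \<phi> b)"
      if "d \<in> I" "src d = (U, \<phi>)" "tgt d = (V, \<psi>)" "a \<in> coord_ball M d (outer_radius d)" "b \<in> coord_ball M d (outer_radius d)"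
      for d U \<phi> V \<psi> a b
      using good_patch_nbhdD(1)[OF good[OF that(1)] that(2,3) _ nb[OF that(1)] e(2)[OF that(1)] that(4,5)] hB by blast
    have onto: "f ` closed_patch M d (inner_radius d) \<subseteq> h ` closed_patch M d (outer_radius d)" if "d \<in> I" for d
      using good_patch_nbhdD(2)[OF good[OF that] prod.collapse[symmetric] prod.collapse[symmetric] _ nb[OF that] e(2)[OF that]] hB
      by blast
    have inj_patch: "p = q" if pq: "d \<in> I" "p \<in> closed_patch M d (outer_radius d)" "q \<in> closed_patch M d (outer_radius d)" "h p = h q" for d p q
    proof -
      obtain U \<phi> V \<psi> where eq: "src d = (U, \<phi>)" "tgt d = (V, \<psi>)" by (metis prod.exhaust)
      note pd = good_patchD[OF M N good[OF pq(1)] eq]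
      obtain a b where ab: "a \<in> coord_ball M d (outer_radius d)" "p = \<phi> a" "b \<in> coord_ball M d (outer_radius d)" "q = \<phi> b"
        using pq(2,3) unfolding pd(12) by blast
      have "slope d * dist a b \<le> 0" using slope[OF pq(1) eq ab(1,3)] pq(4) ab by simp
      then have "dist a b \<le> 0" using pd(8) by (simp add: mult_le_0_iff)
      then show ?thesis using ab by simp
    qed
    have in_patch: "\<exists>d\<in>I. p \<in> closed_patch M d (inner_radius d)" if "p \<in> topspace (points M)" for p
      using cover that open_closed by blast
    have inj: "p = q" if p: "p \<in> topspace (points M)" and q: "q \<in> topspace (points M)" and eq: "h p = h q" for p q
    proof -
      obtain i d where i: "i \<in> I" "p \<in> closed_patch M i (inner_radius i)" and d: "d \<in> I" "q \<in> closed_patch M d (inner_radius d)"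
        using in_patch p q by blast
      obtain p' where p': "p' \<in> closed_patch M i (middle_radius i)" "h p = f p'"
        using inside[OF i(1) nb[OF i(1)]] i(2) open_closed by blast
      obtain q' where q': "q' \<in> closed_patch M d (middle_radius d)" "h q = f q'"
        using inside[OF d(1) nb[OF d(1)]] d(2) open_closed by blast
      have "p' \<in> topspace (points M)" "q' \<in> topspace (points M)"
        using p'(1) q'(1) patch(4)[OF i(1) less_imp_le[OF patch(2)[OF i(1)]]]
          patch(4)[OF d(1) less_imp_le[OF patch(2)[OF d(1)]]] by auto
      then have "p' = q'" using p'(2) q'(2) eq gf by metis
      \<comment> \<open>The common point \<open>p' = q'\<close> lies in both middle patches, so the
        separation chosen for \<open>d\<close> includes \<open>i\<close>.\<close>
      then have iJ: "i \<in> J d" unfolding J_def using i(1) p'(1) q'(1) by blast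
      have "q \<in> open_patch M i (outer_radius i)"
      proof (rule ccontr)
        assume "q \<notin> open_patch M i (outer_radius i)"
        then have "h q \<in> h ` (closed_patch M d (inner_radius d) - open_patch M i (outer_radius i))" using d(2) by blast
        moreover have "h q \<in> f ` closed_patch M i (middle_radius i)" using p' eq by auto
        ultimately show False using apart[OF d(1) nb[OF d(1)] iJ] by blast
      qed
      then have "q \<in> closed_patch M i (outer_radius i)" by (rule open_closed)
      moreover have "p \<in> closed_patch M i (outer_radius i)"
        using i(2) patch(1,2)[OF i(1)] by (auto simp: closed_patch_def coord_ball_def)
      ultimately show ?thesis using inj_patch[OF i(1)] eq by blast
    qed
    \<comment> \<open>Restricted to the points of \<open>N\<close>, since members of
      \<open>Ck1_maps\<close> are extensional.\<close>
    define hinv where "hinv = (\<lambda>q\<in>topspace (points N). inv_into (topspace (points M)) h q)"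
    \<comment> \<open>\<open>q\<close> is the image under \<open>f\<close> of \<open>g q\<close>,
      which lies in some inner patch, and \<open>h\<close> of the outer patch contains
      \<open>f\<close> of the inner one.\<close>
    have "q \<in> h ` topspace (points M)" if q: "q \<in> topspace (points N)" for q
    proof -
      obtain d where d: "d \<in> I" "g q \<in> closed_patch M d (inner_radius d)" using in_patch[OF g_top[OF q]] by blast
      then have "q \<in> h ` closed_patch M d (outer_radius d)" using onto[OF d(1)] fg[OF q] by force
      then show ?thesis using patch(4)[OF d(1) order_refl] by blast
    qed
    then have hinv: "hinv q \<in> topspace (points M)" "h (hinv q) = q" if "q \<in> topspace (points N)" for q
      using that by (auto simp: hinv_def inv_into_into f_inv_into_f)
    have hinv_h: "hinv (h p) = p" if "p \<in> topspace (points M)" for p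
      using inj hinv h_top that by blast
    have "hinv \<in> Ck1_maps k N M"
    proof (rule Ck1_maps_inverse[OF M N h _ hinv_h hinv(2)])
      show "hinv \<in> topspace (points N) \<rightarrow>\<^sub>E topspace (points M)" using hinv(1) by (auto simp: hinv_def)
      fix q assume q: "q \<in> topspace (points N)"
      obtain d where d: "d \<in> I" "g q \<in> open_patch M d (inner_radius d)" using cover g_top[OF q] by blast
      obtain U \<phi> V \<psi> where eq: "src d = (U, \<phi>)" "tgt d = (V, \<psi>)" by (metis prod.exhaust)
      note pd = good_patchD[OF M N good[OF d(1)] eq]
      note tc = charts_topological[OF pd(3)] and td = charts_topological[OF pd(4)]
      let ?K = "coord_ball M d (outer_radius d)"
      \<comment> \<open>Defined through \<open>g\<close>, whose continuity is known; that of
        \<open>hinv\<close> is still to be shown.\<close>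
      define O' where "O' = {q \<in> topspace (points N). g q \<in> open_patch M d (inner_radius d)}"
      have "openin (points M) (open_patch M d (inner_radius d))" using pd(5,6) by (intro pd(15)) simp
      with gc have O'_open: "openin (points N) O'" unfolding O'_def by (rule openin_continuous_map_preimage)
      have O'_f: "q \<in> f ` closed_patch M d (inner_radius d)" if "q \<in> O'" for q
      proof -
        have "g q \<in> closed_patch M d (inner_radius d)" "f (g q) = q"
          using that fg open_closed unfolding O'_def by auto
        then show ?thesis by (metis image_eqI)
      qed
      have "closed_patch M d (inner_radius d) \<subseteq> closed_patch M d (outer_radius d)"
        using pd(5,6) by (auto simp: closed_patch_def coord_ball_def)
      then have O'_V: "O' \<subseteq> \<psi> ` V" using O'_f pd(10) by blast
      have O'_hinv: "hinv q \<in> \<phi> ` ?K" if qO: "q \<in> O'" for q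
      proof -
        obtain p where p: "p \<in> closed_patch M d (outer_radius d)" "q = h p" using onto[OF d(1)] O'_f[OF qO] by blast
        then have "p \<in> topspace (points M)" using patch(4)[OF d(1) order_refl] by blast
        with p show ?thesis using hinv_h unfolding pd(12) by simp
      qed
      have coord: "coord_map U \<phi> hinv \<psi> y \<in> ?K" "y = coord_map V \<psi> h \<phi> (coord_map U \<phi> hinv \<psi> y)"
        if y: "y \<in> V" "\<psi> y \<in> O'" for y
      proof -
        obtain a where a: "a \<in> ?K" "hinv (\<psi> y) = \<phi> a" using O'_hinv[OF y(2)] by blast
        then have inv: "coord_map U \<phi> hinv \<psi> y = a" using pd(9) topological_chartD(3)[OF tc] by (simp add: subset_iff)
        with a show "coord_map U \<phi> hinv \<psi> y \<in> ?K" by simp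
        have "h (\<phi> a) = \<psi> y" using hinv(2)[of "\<psi> y"] a(2) y(2) O'_open openin_subset by fastforce
        then show "y = coord_map V \<psi> h \<phi> (coord_map U \<phi> hinv \<psi> y)"
          unfolding inv using y(1) topological_chartD(3)[OF td] by simp
      qed
      \<comment> \<open>The lower slope of \<open>h\<close> on the outer patch, read for the
        inverse.\<close>
      have "(1 / slope d)-lipschitz_on {y \<in> V. \<psi> y \<in> O'} (coord_map U \<phi> hinv \<psi>)"
      proof (rule lipschitz_onI)
        show "0 \<le> 1 / slope d" using pd(8) by simp
        fix y z assume "y \<in> {y \<in> V. \<psi> y \<in> O'}" "z \<in> {y \<in> V. \<psi> y \<in> O'}"
        then have yz: "y \<in> V" "\<psi> y \<in> O'" "z \<in> V" "\<psi> z \<in> O'" by auto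
        from slope[OF d(1) eq coord(1)[OF yz(1,2)] coord(1)[OF yz(3,4)]]
        have "slope d * dist (coord_map U \<phi> hinv \<psi> y) (coord_map U \<phi> hinv \<psi> z) \<le> dist y z"
          using coord(2)[OF yz(1,2)] coord(2)[OF yz(3,4)] by simp
        then show "dist (coord_map U \<phi> hinv \<psi> y) (coord_map U \<phi> hinv \<psi> z) \<le> 1 / slope d * dist y z"
          using pd(8) by (simp add: field_simps)
      qed
      then have lip: "locally_lipschitz_on {y \<in> V. \<psi> y \<in> O'} (coord_map U \<phi> hinv \<psi>)"
        unfolding locally_lipschitz_on_def by (meson Int_lower1 lipschitz_on_subset zero_less_one)
      show "\<exists>U \<phi> V \<psi> O'. (U, \<phi>) \<in> atlas M \<and> (V, \<psi>) \<in> atlas N \<and> openin (points N) O' \<and> q \<in> O' \<and>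
          O' \<subseteq> \<psi> ` V \<and> hinv ` O' \<subseteq> \<phi> ` U \<and> locally_lipschitz_on {y \<in> V. \<psi> y \<in> O'} (coord_map U \<phi> hinv \<psi>)"
      proof (intro exI conjI)
        show "hinv ` O' \<subseteq> \<phi> ` U" using O'_hinv pd(9) by blast
        show "q \<in> O'" using q d(2) unfolding O'_def by simp
      qed (fact pd(1) pd(2) O'_open O'_V lip)+
    qed
    with h hinv(2) hinv_h show "h \<in> Ck1_diffeos k M N" unfolding Ck1_diffeos_def by blast
  qed
  ultimately show ?thesis by blast
qed

theorem propositionA16:
  fixes M :: "('a, 'm::{finite,linorder}) manifold"
    and N :: "('b, 'n::{finite,linorder}) manifold"
    and k :: nat
  assumes "smooth_manifold M" and "smooth_manifold N"
  shows "openin (subtopology (strong_topology k M N) (Ck1_boundary_maps k M N))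
           (Ck1_diffeos k M N)"
proof -
  \<comment> \<open>Taking all admissible open sets avoids choosing a neighbourhood for each
    diffeomorphism.\<close>
  let ?\<B> = "{B. openin (strong_topology k M N) B \<and> B \<inter> Ck1_boundary_maps k M N \<subseteq> Ck1_diffeos k M N}"
  have "openin (strong_topology k M N) (\<Union>?\<B>)" by (rule openin_Union) blast
  moreover have "Ck1_diffeos k M N = \<Union>?\<B> \<inter> Ck1_boundary_maps k M N"
    using Ck1_diffeos_nbhd[OF assms] Ck1_diffeos_subset_boundary_maps[OF assms] by fast
  ultimately show ?thesis unfolding openin_subtopology by blast
qed

end
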